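(* For every integer $n\geq1$, the homotopical reduction $$\Sigma^{\mathrm{row,red}}(n):=R_{\Gamma^{(2)}(n)}\bigl(\Sigma^{\mathrm{row,N}}(n)\bigr)$$ is a finite coherent presentation of the stylic monoid $\mathrm{Styl}_n$. Its generating cells in dimensions $2$ and $3$ are $$\Sigma^{\mathrm{row,red}}_2(n)=\Sigma^{\mathrm{row}}_2(n)\setminus\mathcal B_n^{\mathrm{acyc}},\qquad \Sigma^{\mathrm{row,red}}_3(n)=\bigl\{\mathcal X_\tau\mid\tau\in\mathfrak T_n^{(1)}\setminus\{\tau_\beta\mid\beta\in\mathcal B_n^{\mathrm{acyc}}\}\bigr\},$$ where the boundaries of the surviving generating $3$-cells are reduced by $R_{\Gamma^{(2)}(n)}$.
   Context: **Rows and $N$-tableaux.** Fix $n\geq1$, $[n]=\{1<2<\cdots<n\}$. For a word $w$ over $[n]$, $\ell(w)$ is its length and $\mathrm{supp}(w)$ its set of letters. A row is a nonempty strictly increasing word over $[n]$, identified with its support; $\mathcal R_n$ is the set of rows. For rows $u,v$, $u\triangleleft v$ means $\mathrm{supp}(u)\subseteq\mathrm{supp}(v)$ and $\min(v)<\min(u)$. An $N$-tableau $T$ is a finite sequence of rows $u_k,\dots,u_1$ (top to bottom) with $u_{i+1}\triangleleft u_i$ for all $i$; $\mathcal R(T):=r_{u_k}\cdots r_{u_1}$. Right $N$-insertion of a letter $x$: insert $x$ in the bottom row $u_1$, i.e. replace $u_1$ by the row with support $\mathrm{supp}(u_1)\cup\{x\}$; if $u_1$ has a letter $>x$, the smallest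 such letter $y$ is bumped (it also stays in the row) and is inserted in the same way into the next row above, and so on; a letter bumped from the top row creates a new top row consisting of that letter. $N(w)$ is obtained by inserting the letters of $w$ from left to right starting from the empty tableau. For rows $u,v$, $N(uv)$ has at most two rows. $\mathrm{Styl}_n$ is the monoid generated by $[n]$ subject to $xx=x$, $zxy=xzy$ ($x\leq y<z$), $yzx=yxz$ ($x<y\leq z$). **Polygraphs.** A $2$-polygraph $\Sigma=(\Sigma_1,\Sigma_2)$ is a set $\Sigma_1$ with a set $\Sigma_2$ of $2$-cells between words of $\Sigma_1^*$; it presents the quotient of $\Sigma_1^*$ by the congruence generated by $\Sigma_2$. $\Sigma_2^\top$ is the free $(2,1)$-category on $\Sigma$. A $(3,1)$-polygraph adds a set $\Sigma_3$ of generating $3$-cells $A\colon f\Rrightarrow g$ between parallel $2$-cells of $\Sigma_2^\top$. $0$-composition is juxtaposition; $\star_1$ is $1$-composition. It is a coherent presentation of $M$ if the $2$-polygraph presents $M$ and every pair of parallel $2$-cells $(f,g)$ of $\Sigma_2^\top$ is filled by a $3$-cell of the free $(3,1)$-category it generates; finite if all generating sets are finite. **Row cells and confluences.** $\Sigma^{\mathrm{row}}(n)$ has $1$-cells $r_u$ ($u\in\mathcal R_n$) and $2$-cells $\alpha_{u,v}\colon r_ur_v\Rightarrow\mathcal R(N(uv))$ for $u\not\triangleleft v$. It is known to be convergent and to present $\mathrm{Styl}_n$. $\Lambda_w\colon w\Rightarrow\widehat w$ is the leftmost normalization path of a word $w$ in the $r_u$. $\mathfrak C_n=\{(u,v,t)\in\mathcal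 R_n^3\mid u\not\triangleleft v,\ v\not\triangleleft t\}$. For a row $u$ of length $\ge2$, $\partial u$ is $u$ with its first letter removed; $\mathfrak S_n=\{(u,v,t)\in\mathfrak C_n\mid\ell(u)\geq2,\ \partial u\not\triangleleft v\}$; $\mathfrak T_n^{(1)}=\mathfrak C_n\setminus\mathfrak S_n$. For $\tau=(u,v,t)\in\mathfrak T_n^{(1)}$ let $\mathcal X_\tau\colon L_\tau\Rrightarrow R_\tau$ be a generating $3$-cell with $L_\tau=(\alpha_{u,v}1_{r_t})\star_1\Lambda_{\mathcal R(N(uv))r_t}$, $R_\tau=(1_{r_u}\alpha_{v,t})\star_1\Lambda_{r_u\mathcal R(N(vt))}$. $\Sigma^{\mathrm{row,scoh}}(n)$ is the $(3,1)$-polygraph over $\Sigma^{\mathrm{row}}(n)$ with generating $3$-cells $\mathcal X_\tau$, $\tau\in\mathfrak T_n^{(1)}$. **Selected row cells.** A pair $(\tau,\beta)$, $\tau\in\mathfrak T_n^{(1)}$, $\beta=\alpha_{p,q}$, is eligible if $\beta$ occurs in $L_\tau$ or $R_\tau$ as a rewriting step with source exactly $r_pr_q$ (empty context), and this is the only occurrence of $\beta$ in $L_\tau$ and $R_\tau$ together (occurrences in any context counted). For an eligible pair, let $U$ be the one of $L_\tau,R_\tau$ containing $\beta$, $V$ the other, write $U=f\star_1\beta\star_1g$ and put $S_{\tau,\beta}=f^{-1}\star_1V\star_1g^{-1}$. A dependency of $(\tau,\beta)$ is a generating row $2$-cell occurring, itself or its inverse, in the expression $S_{\tau,\beta}$.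 Order the cells $\alpha_{u,v}$ lexicographically by $(\ell(u)+\ell(v),\ell(u),u,v)$ (rows compared lexicographically, a proper prefix being smaller), triples lexicographically by their three rows, and eligible pairs lexicographically by $(\beta,\tau)$. Scan the eligible pairs in increasing order, keeping $(\tau,\beta)$ iff neither $\tau$ nor $\beta$ occurs in an already kept pair. $\mathcal B_n^{\mathrm{match}}$ is the set of $\beta$ in kept pairs, $\tau_\beta$ the triple kept with $\beta$, $S_\beta=S_{\tau_\beta,\beta}$. Let $G$ be the directed graph on $\mathcal B_n^{\mathrm{match}}$ with an edge $\beta'\to\beta$ iff $\beta'$ is a dependency of $(\tau_\beta,\beta)$. Scan $\mathcal B_n^{\mathrm{match}}$ in increasing order, keeping $\beta$ iff the subgraph of $G$ induced by the already kept vertices and $\beta$ is acyclic; the kept set is $\mathcal B_n^{\mathrm{acyc}}$. **The reduction.** $\Sigma^{\mathrm{row,N}}(n)$ is obtained from $\Sigma^{\mathrm{row,scoh}}(n)$ by replacing, for each $\beta\in\mathcal B_n^{\mathrm{acyc}}$, the generating $3$-cell $\mathcal X_{\tau_\beta}$ by a generating $3$-cell $A_\beta\colon S_\beta\Rrightarrow\beta$. $\Gamma^{(2)}(n)=(\varnothing,\{A_\beta\mid\beta\in\mathcal B_n^{\mathrm{acyc}}\},\varnothing)$. The homotopical reduction $R_{\Gamma^{(2)}(n)}$ removes every $A_\beta$ and its target $\beta$ ($\beta\in\mathcal B_n^{\mathrm{acyc}}$); the boundaries of the remaining $3$-cells are transformed by the $2$-functor fixing all $1$-cells and all surviving $2$-cells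 and sending $\beta\in\mathcal B_n^{\mathrm{acyc}}$ recursively to the image of $S_\beta$ (the recursion terminates by acyclicity). *)

theory Defs
  imports
    "HOL-Algebra.Group"
    "HOL-Library.List_Lexorder"
    "HOL-Library.Product_Lexorder"
begin

section \<open>Presented monoids\<close>

inductive word_cong :: "'a set \<Rightarrow> ('a list \<times> 'a list) set \<Rightarrow> 'a list \<Rightarrow> 'a list \<Rightarrow> bool"
  for X :: "'a set" and R :: "('a list \<times> 'a list) set" where
  base: "\<lbrakk>(u, v) \<in> R; x \<in> lists X; y \<in> lists X\<rbrakk> \<Longrightarrow> word_cong X R (x @ u @ y) (x @ v @ y)"
| refl: "w \<in> lists X \<Longrightarrow> word_cong X R w w"
| sym: "word_cong X R u v \<Longrightarrow> word_cong X R v u"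
| trans: "\<lbrakk>word_cong X R u v; word_cong X R v w\<rbrakk> \<Longrightarrow> word_cong X R u w"

definition word_rel :: "'a set \<Rightarrow> ('a list \<times> 'a list) set \<Rightarrow> ('a list \<times> 'a list) set" where
  "word_rel X R = {(u, v). word_cong X R u v}"

definition presented_monoid ::
  "'a set \<Rightarrow> ('a list \<times> 'a list) set \<Rightarrow> 'a list set monoid" where
  "presented_monoid X R =
    \<lparr>carrier = lists X // word_rel X R,
     mult = (\<lambda>A B. \<Union>a\<in>A. \<Union>b\<in>B. word_rel X R `` {a @ b}),
     one = word_rel X R `` {[]}\<rparr>"

section \<open>Polygraphs\<close>

record ('a, 'b) polygraph2 =
  cells1 :: "'a set"
  cells2 :: "'b set"
  src2 :: "'b \<Rightarrow> 'a list"
  tgt2 :: "'b \<Rightarrow> 'a list"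

definition is_polygraph2 :: "('a, 'b, 'z) polygraph2_scheme \<Rightarrow> bool" where
  "is_polygraph2 P \<longleftrightarrow>
    (\<forall>b\<in>cells2 P. src2 P b \<in> lists (cells1 P) \<and> tgt2 P b \<in> lists (cells1 P))"

definition presents :: "('a, 'b, 'z) polygraph2_scheme \<Rightarrow> 'm monoid \<Rightarrow> bool" where
  "presents P M \<longleftrightarrow>
    presented_monoid (cells1 P) {(src2 P b, tgt2 P b) | b. b \<in> cells2 P} \<cong> M"

text \<open>
  The 2-cells of the free (2,1)-category on \<open>P\<close> are represented by well-typed expressions:
  \<open>is_cell2 P f u v\<close> says that \<open>f\<close> represents a 2-cell from \<open>u\<close> to \<open>v\<close>, and \<open>eq2 P f g\<close> that
  \<open>f\<close> and \<open>g\<close> represent the same 2-cell, i.e. are identified by the axioms of strict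
  2-categories with one 0-cell in which all 2-cells are invertible for 1-composition.
  Compositions are written in diagrammatic order.
\<close>

datatype ('a, gens2: 'b) cell2 =
  Id2 "'a list"
| Gen2 'b
| Comp0 "('a, 'b) cell2" "('a, 'b) cell2" (infixr \<open>\<star>\<^sub>0\<close> 75)
| Comp1 "('a, 'b) cell2" "('a, 'b) cell2" (infixr \<open>\<star>\<^sub>1\<close> 70)
| Inv2 "('a, 'b) cell2"

inductive is_cell2 ::
  "('a, 'b, 'z) polygraph2_scheme \<Rightarrow> ('a, 'b) cell2 \<Rightarrow> 'a list \<Rightarrow> 'a list \<Rightarrow> bool"
  for P :: "('a, 'b, 'z) polygraph2_scheme" where
  id: "w \<in> lists (cells1 P) \<Longrightarrow> is_cell2 P (Id2 w) w w"
| gen: "b \<in> cells2 P \<Longrightarrow> is_cell2 P (Gen2 b) (src2 P b) (tgt2 P b)"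
| comp0: "\<lbrakk>is_cell2 P f u v; is_cell2 P g u' v'\<rbrakk> \<Longrightarrow> is_cell2 P (f \<star>\<^sub>0 g) (u @ u') (v @ v')"
| comp1: "\<lbrakk>is_cell2 P f u v; is_cell2 P g v w\<rbrakk> \<Longrightarrow> is_cell2 P (f \<star>\<^sub>1 g) u w"
| inv: "is_cell2 P f u v \<Longrightarrow> is_cell2 P (Inv2 f) v u"

inductive eq2 ::
  "('a, 'b, 'z) polygraph2_scheme \<Rightarrow> ('a, 'b) cell2 \<Rightarrow> ('a, 'b) cell2 \<Rightarrow> bool"
  for P :: "('a, 'b, 'z) polygraph2_scheme" where
  refl: "is_cell2 P f u v \<Longrightarrow> eq2 P f f"
| sym: "eq2 P f g \<Longrightarrow> eq2 P g f"
| trans: "\<lbrakk>eq2 P f g; eq2 P g h\<rbrakk> \<Longrightarrow> eq2 P f h"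
| cong0: "\<lbrakk>eq2 P f f'; eq2 P g g'\<rbrakk> \<Longrightarrow> eq2 P (f \<star>\<^sub>0 g) (f' \<star>\<^sub>0 g')"
| cong1: "\<lbrakk>eq2 P f f'; eq2 P g g'; is_cell2 P f u v; is_cell2 P g v w\<rbrakk>
    \<Longrightarrow> eq2 P (f \<star>\<^sub>1 g) (f' \<star>\<^sub>1 g')"
| cong_inv: "eq2 P f f' \<Longrightarrow> eq2 P (Inv2 f) (Inv2 f')"
| assoc0: "\<lbrakk>is_cell2 P f u u'; is_cell2 P g v v'; is_cell2 P h w w'\<rbrakk>
    \<Longrightarrow> eq2 P ((f \<star>\<^sub>0 g) \<star>\<^sub>0 h) (f \<star>\<^sub>0 (g \<star>\<^sub>0 h))"
| unit0_left: "is_cell2 P f u v \<Longrightarrow> eq2 P (Id2 [] \<star>\<^sub>0 f) f"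
| unit0_right: "is_cell2 P f u v \<Longrightarrow> eq2 P (f \<star>\<^sub>0 Id2 []) f"
| assoc1: "\<lbrakk>is_cell2 P f u v; is_cell2 P g v w; is_cell2 P h w x\<rbrakk>
    \<Longrightarrow> eq2 P ((f \<star>\<^sub>1 g) \<star>\<^sub>1 h) (f \<star>\<^sub>1 (g \<star>\<^sub>1 h))"
| unit1_left: "is_cell2 P f u v \<Longrightarrow> eq2 P (Id2 u \<star>\<^sub>1 f) f"
| unit1_right: "is_cell2 P f u v \<Longrightarrow> eq2 P (f \<star>\<^sub>1 Id2 v) f"
| id_comp0: "\<lbrakk>u \<in> lists (cells1 P); v \<in> lists (cells1 P)\<rbrakk>
    \<Longrightarrow> eq2 P (Id2 u \<star>\<^sub>0 Id2 v) (Id2 (u @ v))"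
| exchange: "\<lbrakk>is_cell2 P f u v; is_cell2 P g v w; is_cell2 P f' u' v'; is_cell2 P g' v' w'\<rbrakk>
    \<Longrightarrow> eq2 P ((f \<star>\<^sub>1 g) \<star>\<^sub>0 (f' \<star>\<^sub>1 g')) ((f \<star>\<^sub>0 f') \<star>\<^sub>1 (g \<star>\<^sub>0 g'))"
| inv_right: "is_cell2 P f u v \<Longrightarrow> eq2 P (f \<star>\<^sub>1 Inv2 f) (Id2 u)"
| inv_left: "is_cell2 P f u v \<Longrightarrow> eq2 P (Inv2 f \<star>\<^sub>1 f) (Id2 v)"

definition parallel2 ::
  "('a, 'b, 'z) polygraph2_scheme \<Rightarrow> ('a, 'b) cell2 \<Rightarrow> ('a, 'b) cell2 \<Rightarrow> bool" where
  "parallel2 P f g \<longleftrightarrow> (\<exists>u v. is_cell2 P f u v \<and> is_cell2 P g u v)"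

record ('a, 'b, 'c) polygraph31 = "('a, 'b) polygraph2" +
  cells3 :: "'c set"
  src3 :: "'c \<Rightarrow> ('a, 'b) cell2"
  tgt3 :: "'c \<Rightarrow> ('a, 'b) cell2"

definition is_polygraph31 :: "('a, 'b, 'c) polygraph31 \<Rightarrow> bool" where
  "is_polygraph31 P \<longleftrightarrow>
    is_polygraph2 P \<and> (\<forall>c\<in>cells3 P. parallel2 P (src3 P c) (tgt3 P c))"

text \<open>
  The 3-cells of the free (3,1)-category on \<open>P\<close> are represented by expressions as well;
  \<open>is_cell3 P A f g\<close> says that \<open>A\<close> represents a 3-cell from \<open>f\<close> to \<open>g\<close>.  By rule \<open>bd\<close> the
  boundaries are 2-cells of the free (2,1)-category, i.e. expressions modulo \<open>eq2\<close>.
  Identifications between 3-cells do not affect which pairs of 2-cells are filled, so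
  equality of 3-cells is not needed.
\<close>

datatype ('a, 'b, 'c) cell3 =
  Id3 "('a, 'b) cell2"
| Gen3 'c
| Comp3_0 "('a, 'b, 'c) cell3" "('a, 'b, 'c) cell3"
| Comp3_1 "('a, 'b, 'c) cell3" "('a, 'b, 'c) cell3"
| Comp3_2 "('a, 'b, 'c) cell3" "('a, 'b, 'c) cell3"
| Inv3 "('a, 'b, 'c) cell3"

inductive is_cell3 ::
  "('a, 'b, 'c) polygraph31 \<Rightarrow> ('a, 'b, 'c) cell3 \<Rightarrow> ('a, 'b) cell2 \<Rightarrow> ('a, 'b) cell2 \<Rightarrow> bool"
  for P :: "('a, 'b, 'c) polygraph31" where
  id: "is_cell2 P f u v \<Longrightarrow> is_cell3 P (Id3 f) f f"
| gen: "c \<in> cells3 P \<Longrightarrow> is_cell3 P (Gen3 c) (src3 P c) (tgt3 P c)"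
| comp0: "\<lbrakk>is_cell3 P A f g; is_cell3 P B f' g'\<rbrakk>
    \<Longrightarrow> is_cell3 P (Comp3_0 A B) (f \<star>\<^sub>0 f') (g \<star>\<^sub>0 g')"
| comp1: "\<lbrakk>is_cell3 P A f g; is_cell3 P B f' g'; is_cell2 P f u v; is_cell2 P f' v w\<rbrakk>
    \<Longrightarrow> is_cell3 P (Comp3_1 A B) (f \<star>\<^sub>1 f') (g \<star>\<^sub>1 g')"
| comp2: "\<lbrakk>is_cell3 P A f g; is_cell3 P B g h\<rbrakk> \<Longrightarrow> is_cell3 P (Comp3_2 A B) f h"
| inv: "is_cell3 P A f g \<Longrightarrow> is_cell3 P (Inv3 A) g f"
| bd: "\<lbrakk>is_cell3 P A f g; eq2 P f f'; eq2 P g g'\<rbrakk> \<Longrightarrow> is_cell3 P A f' g'"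

definition coherent_presentation :: "('a, 'b, 'c) polygraph31 \<Rightarrow> 'm monoid \<Rightarrow> bool" where
  "coherent_presentation P M \<longleftrightarrow>
    is_polygraph31 P \<and> presents P M \<and>
    (\<forall>f g. parallel2 P f g \<longrightarrow> (\<exists>A. is_cell3 P A f g))"

definition finite_polygraph31 :: "('a, 'b, 'c) polygraph31 \<Rightarrow> bool" where
  "finite_polygraph31 P \<longleftrightarrow> finite (cells1 P) \<and> finite (cells2 P) \<and> finite (cells3 P)"

section \<open>Homotopical reduction\<close>

text \<open>
  Here \<open>C\<close> is the set of 3-cells of a collapsible part \<open>(\<emptyset>, C, \<emptyset>)\<close>: the target of each
  \<open>c \<in> C\<close> is a generating 2-cell, distinct for distinct \<open>c\<close>.
  The 2-functor \<open>reduce_cell2 P C\<close> sends such a target to the image of the source of \<open>c\<close>;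
  the recursion terminates on expressions over \<open>cells2 P\<close> when the relation
  ``occurs in the source of the 3-cell removing'' is acyclic on the finite set of removed cells.
\<close>

definition removed2 :: "('a, 'b, 'c) polygraph31 \<Rightarrow> 'c set \<Rightarrow> 'b set" where
  "removed2 P C = {b. \<exists>c\<in>C. tgt3 P c = Gen2 b}"

definition remover :: "('a, 'b, 'c) polygraph31 \<Rightarrow> 'c set \<Rightarrow> 'b \<Rightarrow> 'c" where
  "remover P C b = (THE c. c \<in> C \<and> tgt3 P c = Gen2 b)"

function (domintros) reduce_cell2 ::
  "('a, 'b, 'c) polygraph31 \<Rightarrow> 'c set \<Rightarrow> ('a, 'b) cell2 \<Rightarrow> ('a, 'b) cell2" where
  "reduce_cell2 P C (Id2 w) = Id2 w"
| "reduce_cell2 P C (Gen2 b) =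
    (if b \<in> removed2 P C then reduce_cell2 P C (src3 P (remover P C b)) else Gen2 b)"
| "reduce_cell2 P C (f \<star>\<^sub>0 g) = reduce_cell2 P C f \<star>\<^sub>0 reduce_cell2 P C g"
| "reduce_cell2 P C (f \<star>\<^sub>1 g) = reduce_cell2 P C f \<star>\<^sub>1 reduce_cell2 P C g"
| "reduce_cell2 P C (Inv2 f) = Inv2 (reduce_cell2 P C f)"
  by pat_completeness auto

definition homotopical_reduction ::
  "'c set \<Rightarrow> ('a, 'b, 'c) polygraph31 \<Rightarrow> ('a, 'b, 'c) polygraph31" where
  "homotopical_reduction C P = P\<lparr>
     cells2 := cells2 P - removed2 P C,
     cells3 := cells3 P - C,
     src3 := (\<lambda>c. reduce_cell2 P C (src3 P c)),
     tgt3 := (\<lambda>c. reduce_cell2 P C (tgt3 P c))\<rparr>"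

section \<open>Rows, tableaux and the stylic monoid\<close>

type_synonym row = "nat list"

definition rows :: "nat \<Rightarrow> row set" where
  "rows n = {u. u \<noteq> [] \<and> sorted_wrt (<) u \<and> set u \<subseteq> {1..n}}"

definition tri :: "row \<Rightarrow> row \<Rightarrow> bool" (infix \<open>\<lhd>\<^sub>N\<close> 50) where
  "u \<lhd>\<^sub>N v \<longleftrightarrow> set u \<subseteq> set v \<and> Min (set v) < Min (set u)"

text \<open>\<open>insert_rows\<close> works on the list of rows from bottom to top.\<close>

fun insert_rows :: "nat \<Rightarrow> row list \<Rightarrow> row list" where
  "insert_rows x [] = [[x]]"
| "insert_rows x (u # us) =
    sorted_list_of_set (insert x (set u)) #
      (if \<exists>y\<in>set u. x < y then insert_rows (Min {y \<in> set u. x < y}) us else us)"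

text \<open>
  \<open>N_tab w\<close> lists the rows of the tableau from top to bottom.  The 1-cell \<open>r\<^sub>u\<close> is
  identified with the row \<open>u\<close>, so that \<open>\<R>(T)\<close> is the list \<open>T\<close> itself.
\<close>

definition N_tab :: "nat list \<Rightarrow> row list" where
  "N_tab w = rev (fold insert_rows w [])"

definition styl_rels :: "nat \<Rightarrow> (nat list \<times> nat list) set" where
  "styl_rels n =
     {([x, x], [x]) | x. x \<in> {1..n}}
   \<union> {([z, x, y], [x, z, y]) | x y z. {x, y, z} \<subseteq> {1..n} \<and> x \<le> y \<and> y < z}
   \<union> {([y, z, x], [y, x, z]) | x y z. {x, y, z} \<subseteq> {1..n} \<and> x < y \<and> y \<le> z}"

definition Styl :: "nat \<Rightarrow> nat list set monoid" where
  "Styl n = presented_monoid {1..n} (styl_rels n)"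

section \<open>The row presentation\<close>

text \<open>The pair \<open>(u, v)\<close> stands for the 2-cell \<open>\<alpha>\<^bsub>u,v\<^esub>\<close>.\<close>

type_synonym row_cell = "row \<times> row"

definition row_polygraph :: "nat \<Rightarrow> (row, row_cell) polygraph2" where
  "row_polygraph n =
    \<lparr>cells1 = rows n,
     cells2 = {(u, v). u \<in> rows n \<and> v \<in> rows n \<and> \<not> u \<lhd>\<^sub>N v},
     src2 = (\<lambda>(u, v). [u, v]),
     tgt2 = (\<lambda>(u, v). N_tab (u @ v))\<rparr>"

text \<open>A rewriting step \<open>(x, (u, v), y)\<close> applies \<open>\<alpha>\<^bsub>u,v\<^esub>\<close> to the word \<open>x @ [u, v] @ y\<close>.\<close>

type_synonym row_step = "row list \<times> row_cell \<times> row list"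

fun step_target :: "row_step \<Rightarrow> row list" where
  "step_target (x, (u, v), y) = x @ N_tab (u @ v) @ y"

fun step_gen :: "row_step \<Rightarrow> row_cell" where
  "step_gen (x, b, y) = b"

fun step_cell :: "row_step \<Rightarrow> (row, row_cell) cell2" where
  "step_cell (x, b, y) = Id2 x \<star>\<^sub>0 Gen2 b \<star>\<^sub>0 Id2 y"

fun path_cell :: "row list \<Rightarrow> row_step list \<Rightarrow> (row, row_cell) cell2" where
  "path_cell w [] = Id2 w"
| "path_cell w (s # p) = step_cell s \<star>\<^sub>1 path_cell (step_target s) p"

fun leftmost_step :: "row list \<Rightarrow> row_step option" where
  "leftmost_step (u # v # w) =
    (if \<not> u \<lhd>\<^sub>N v then Some ([], (u, v), w)
     else map_option (\<lambda>(x, b, y). (u # x, b, y)) (leftmost_step (v # w)))"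
| "leftmost_step w = None"

function (domintros) Lambda_path :: "row list \<Rightarrow> row_step list" where
  "Lambda_path w =
    (case leftmost_step w of
       None \<Rightarrow> []
     | Some s \<Rightarrow> s # Lambda_path (step_target s))"
  by pat_completeness auto

type_synonym triple = "row \<times> row \<times> row"

definition confl_triples :: "nat \<Rightarrow> triple set" where
  "confl_triples n =
    {(u, v, t). u \<in> rows n \<and> v \<in> rows n \<and> t \<in> rows n \<and> \<not> u \<lhd>\<^sub>N v \<and> \<not> v \<lhd>\<^sub>N t}"

definition S_triples :: "nat \<Rightarrow> triple set" where
  "S_triples n =
    {(u, v, t). (u, v, t) \<in> confl_triples n \<and> length u \<ge> 2 \<and> \<not> tl u \<lhd>\<^sub>N v}"

definition T1_triples :: "nat \<Rightarrow> triple set" where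
  "T1_triples n = confl_triples n - S_triples n"

fun word3 :: "triple \<Rightarrow> row list" where
  "word3 (u, v, t) = [u, v, t]"

fun L_path :: "triple \<Rightarrow> row_step list" where
  "L_path (u, v, t) = ([], (u, v), [t]) # Lambda_path (N_tab (u @ v) @ [t])"

fun R_path :: "triple \<Rightarrow> row_step list" where
  "R_path (u, v, t) = ([u], (v, t), []) # Lambda_path (u # N_tab (v @ t))"

definition L_cell :: "triple \<Rightarrow> (row, row_cell) cell2" where
  "L_cell \<tau> = path_cell (word3 \<tau>) (L_path \<tau>)"

definition R_cell :: "triple \<Rightarrow> (row, row_cell) cell2" where
  "R_cell \<tau> = path_cell (word3 \<tau>) (R_path \<tau>)"

section \<open>Selected row cells\<close>

definition eligible :: "nat \<Rightarrow> (triple \<times> row_cell) set" where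
  "eligible n = {(\<tau>, \<beta>). \<tau> \<in> T1_triples n \<and>
     ([], \<beta>, []) \<in> set (L_path \<tau>) \<union> set (R_path \<tau>) \<and>
     length (filter (\<lambda>s. step_gen s = \<beta>) (L_path \<tau> @ R_path \<tau>)) = 1}"

fun S_cell :: "triple \<times> row_cell \<Rightarrow> (row, row_cell) cell2" where
  "S_cell (\<tau>, \<beta>) =
    (let s = ([], \<beta>, []);
         (U, V) = (if s \<in> set (L_path \<tau>) then (L_path \<tau>, R_path \<tau>) else (R_path \<tau>, L_path \<tau>));
         f = takeWhile (\<lambda>s'. s' \<noteq> s) U;
         g = tl (dropWhile (\<lambda>s'. s' \<noteq> s) U)
     in Inv2 (path_cell (word3 \<tau>) f) \<star>\<^sub>1 path_cell (word3 \<tau>) V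
          \<star>\<^sub>1 Inv2 (path_cell (step_target s) g))"

text \<open>
  Rows are compared by the lexicographic order of \<open>List_Lexorder\<close> (a proper prefix is
  smaller), tuples by that of \<open>Product_Lexorder\<close>.
\<close>

fun cell_key :: "row_cell \<Rightarrow> nat \<times> nat \<times> row \<times> row" where
  "cell_key (u, v) = (length u + length v, length u, u, v)"

fun pair_key :: "triple \<times> row_cell \<Rightarrow> (nat \<times> nat \<times> row \<times> row) \<times> triple" where
  "pair_key (\<tau>, \<beta>) = (cell_key \<beta>, \<tau>)"

definition kept_pairs :: "nat \<Rightarrow> (triple \<times> row_cell) set" where
  "kept_pairs n =
    fold (\<lambda>(\<tau>, \<beta>) K. if \<tau> \<notin> fst ` K \<and> \<beta> \<notin> snd ` K then insert (\<tau>, \<beta>) K else K)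
      (sorted_key_list_of_set pair_key (eligible n)) {}"

definition B_match :: "nat \<Rightarrow> row_cell set" where
  "B_match n = snd ` kept_pairs n"

definition tau_of :: "nat \<Rightarrow> row_cell \<Rightarrow> triple" where
  "tau_of n \<beta> = (THE \<tau>. (\<tau>, \<beta>) \<in> kept_pairs n)"

definition S_of :: "nat \<Rightarrow> row_cell \<Rightarrow> (row, row_cell) cell2" where
  "S_of n \<beta> = S_cell (tau_of n \<beta>, \<beta>)"

definition dep_graph :: "nat \<Rightarrow> (row_cell \<times> row_cell) set" where
  "dep_graph n =
    {(\<beta>', \<beta>). \<beta>' \<in> B_match n \<and> \<beta> \<in> B_match n \<and> \<beta>' \<in> gens2 (S_of n \<beta>)}"

definition B_acyc :: "nat \<Rightarrow> row_cell set" where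
  "B_acyc n =
    fold (\<lambda>\<beta> K. if acyclic (dep_graph n \<inter> insert \<beta> K \<times> insert \<beta> K) then insert \<beta> K else K)
      (sorted_key_list_of_set cell_key (B_match n)) {}"

section \<open>The semi-coherent row presentation and its reduction\<close>

text \<open>\<open>X_cell \<tau>\<close> and \<open>A_cell \<beta>\<close> are the names of the 3-cells \<open>\<X>\<^sub>\<tau>\<close> and \<open>A\<^sub>\<beta>\<close>.\<close>

datatype row_cell3 = X_cell triple | A_cell row_cell

fun row_src3 :: "nat \<Rightarrow> row_cell3 \<Rightarrow> (row, row_cell) cell2" where
  "row_src3 n (X_cell \<tau>) = L_cell \<tau>"
| "row_src3 n (A_cell \<beta>) = S_of n \<beta>"

fun row_tgt3 :: "row_cell3 \<Rightarrow> (row, row_cell) cell2" where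
  "row_tgt3 (X_cell \<tau>) = R_cell \<tau>"
| "row_tgt3 (A_cell \<beta>) = Gen2 \<beta>"

definition row_scoh :: "nat \<Rightarrow> (row, row_cell, row_cell3) polygraph31" where
  "row_scoh n = polygraph2.extend (row_polygraph n)
    \<lparr>cells3 = X_cell ` T1_triples n, src3 = row_src3 n, tgt3 = row_tgt3\<rparr>"

definition row_N :: "nat \<Rightarrow> (row, row_cell, row_cell3) polygraph31" where
  "row_N n = (row_scoh n)
    \<lparr>cells3 := (cells3 (row_scoh n) - (\<lambda>\<beta>. X_cell (tau_of n \<beta>)) ` B_acyc n) \<union> A_cell ` B_acyc n\<rparr>"

definition Gamma2 :: "nat \<Rightarrow> row_cell3 set" where
  "Gamma2 n = A_cell ` B_acyc n"

definition row_red :: "nat \<Rightarrow> (row, row_cell, row_cell3) polygraph31" where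
  "row_red n = homotopical_reduction (Gamma2 n) (row_N n)"

end

theory Submission
  imports Defs
begin

text \<open>
  Call two parallel 2-cells equivalent if they are filled by a 3-cell.  Row words rewrite to
  the tableau of their concatenation; this terminates, and the normal form is unique because
  \<open>N_tab\<close> is constant on the classes of \<open>Styl n\<close>.  As in Squier's theorem, coherence of the
  semi-coherent presentation reduces to filling the confluence of every \<open>(u, v, t)\<close> with
  \<open>\<not> u \<lhd>\<^sub>N v\<close> and \<open>\<not> v \<lhd>\<^sub>N t\<close>.  Outside \<open>T1_triples n\<close> write \<open>u = x # u'\<close> and precompose with
  the invertible cell \<open>[[x], u'] \<Rightarrow> [u]\<close>: the diagram over \<open>[[x], u', v, t]\<close> decomposes into
  the confluence of \<open>(u', v, t)\<close>, which is filled by induction on \<open>length u\<close>, and confluences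
  of triples starting with \<open>[x]\<close> or of the form \<open>(x # p, q, t)\<close> with \<open>p \<lhd>\<^sub>N q\<close>, which
  belong to \<open>T1_triples n\<close>.  Finally \<open>A_cell \<beta>\<close> fills the boundary of \<open>X_cell (tau_of n \<beta>)\<close>,
  and the 2-functor of the homotopical reduction fixes the surviving 2-cells and makes the
  boundary of every \<open>A_cell \<beta>\<close> trivial.
\<close>


section \<open>Fillings of 2-cells\<close>

text \<open>The condition on \<open>tl u\<close> in \<open>S_triples\<close> says that
  \<open>(u', v, t)\<close> is again a branching, so the induction has a smaller confluence to use.
  The merging cell on \<open>[[x], u']\<close> has the one-row target \<open>[u]\<close> because
  \<open>x\<close> is below every letter of \<open>u'\<close> and nothing is bumped; it can be
  cancelled since every 2-cell is invertible.

  The obstacle is circularity. Coherence over the four-row word \<open>[[x], u', v, t]\<close>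
  cannot be taken from the general theorem, which would use the confluence of
  \<open>(u, v, t)\<close> itself. Hence normalizing \<open>[x] # w\<close> is compared with first
  normalizing \<open>w\<close> under bounds on \<open>w\<close> that are stable under steps and
  exclude every triple not yet available.

  Convergence is established separately from fillings: steps do not change the tableau of the
  concatenation, and irreducible words are tableaux, so no critical branching is inspected for
  uniqueness of normal forms. The order proving termination also puts all row words into the domain
  of \<open>Lambda_path\<close> and carries the inductions on words.

  Only existence of 3-cells matters, so coherence is moved between polygraphs by maps of expressions
  that respect \<open>eq2\<close> and send generating 3-cells to fillable pairs.\<close>

lemma is_cell2_unique:
  assumes "is_cell2 P f u v" "is_cell2 P f u' v'"
  shows "u' = u \<and> v' = v"
  using assms
proof (induction arbitrary: u' v' rule: is_cell2.induct)
  case (id w) then show ?case by (auto elim: is_cell2.cases)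
next
  case (gen b) then show ?case by (auto elim: is_cell2.cases)
next
  case (comp0 f u v g x y)
  from comp0.prems obtain a b c d where "is_cell2 P f a b" "is_cell2 P g c d" "u' = a @ c" "v' = b @ d"
    by (cases rule: is_cell2.cases) auto
  then show ?case using comp0.IH(1)[of a b] comp0.IH(2)[of c d] by simp
next
  case (comp1 f u v g w)
  from comp1.prems obtain a where "is_cell2 P f u' a" "is_cell2 P g a v'"
    by (cases rule: is_cell2.cases) auto
  then show ?case using comp1.IH(1)[of u' a] comp1.IH(2)[of a v'] by simp
next
  case (inv f u v)
  from inv.prems have "is_cell2 P f v' u'"
    by (cases rule: is_cell2.cases) auto
  then show ?case using inv.IH by blast
qed

lemma is_cell2_parallel:
  assumes "\<exists>a b. is_cell2 P f a b \<and> is_cell2 P g a b" "is_cell2 P f u v"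
  shows "is_cell2 P g u v"
proof -
  obtain a b where *: "is_cell2 P f a b" "is_cell2 P g a b" using assms(1) by blast
  with is_cell2_unique[OF *(1) assms(2)] show ?thesis by simp
qed

lemma is_cell2_lists:
  assumes "is_polygraph2 P" "is_cell2 P f u v"
  shows "u \<in> lists (cells1 P) \<and> v \<in> lists (cells1 P)"
  using assms(2,1) by induction (auto simp: is_polygraph2_def)

text \<open>Rules such as \<open>trans\<close> and \<open>cong1\<close> give the boundary of at most
  one side; uniqueness of boundaries transports it to the other.\<close>

lemma eq2_is_cell2:
  assumes P: "is_polygraph2 P" and "eq2 P f g"
  shows "\<exists>u v. is_cell2 P f u v \<and> is_cell2 P g u v"
  using assms(2)
proof (induction rule: eq2.induct)
  case (trans f g h)
  then obtain u v where *: "is_cell2 P f u v" "is_cell2 P g u v" by blast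
  from is_cell2_parallel[OF trans.IH(2) *(2)] *(1) show ?case by blast
next
  case (cong1 f f' g g' u v w)
  from is_cell2.comp1[OF cong1.hyps(3,4)]
    is_cell2.comp1[OF is_cell2_parallel[OF cong1.IH(1) cong1.hyps(3)]
      is_cell2_parallel[OF cong1.IH(2) cong1.hyps(4)]] show ?case by blast
next
  case (assoc0 f u u' g v v' h w w')
  from is_cell2.comp0[OF is_cell2.comp0[OF assoc0(1,2)] assoc0(3)]
    is_cell2.comp0[OF assoc0(1) is_cell2.comp0[OF assoc0(2,3)]]
  show ?case by auto
next
  case (unit0_left f u v)
  from is_cell2.comp0[OF is_cell2.id[OF lists.Nil] unit0_left] unit0_left show ?case by auto
next
  case (unit0_right f u v)
  from is_cell2.comp0[OF unit0_right is_cell2.id[OF lists.Nil]] unit0_right show ?case by auto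
next
  case (unit1_left f u v)
  from is_cell2.comp1[OF is_cell2.id unit1_left] is_cell2_lists[OF P unit1_left] unit1_left
  show ?case by blast
next
  case (unit1_right f u v)
  from is_cell2.comp1[OF unit1_right is_cell2.id] is_cell2_lists[OF P unit1_right] unit1_right
  show ?case by blast
next
  case (id_comp0 u v)
  then have "u @ v \<in> lists (cells1 P)" by simp
  from is_cell2.id[OF this] is_cell2.comp0[OF id_comp0[THEN is_cell2.id]] show ?case by blast
next
  case (exchange f u v g w f' u' v' g' w')
  from is_cell2.comp0[OF is_cell2.comp1[OF exchange(1,2)] is_cell2.comp1[OF exchange(3,4)]]
    is_cell2.comp1[OF is_cell2.comp0[OF exchange(1,3)] is_cell2.comp0[OF exchange(2,4)]]
  show ?case by blast
next
  case (inv_right f u v)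
  from is_cell2.comp1[OF inv_right is_cell2.inv[OF inv_right]] 
    is_cell2.id[OF conjunct1[OF is_cell2_lists[OF P inv_right]]]
  show ?case by blast
next
  case (inv_left f u v)
  from is_cell2.comp1[OF is_cell2.inv[OF inv_left] inv_left] 
    is_cell2.id[OF conjunct2[OF is_cell2_lists[OF P inv_left]]]
  show ?case by blast
next
  case (assoc1 f u v g w h x)
  from is_cell2.comp1[OF is_cell2.comp1[OF assoc1(1,2)] assoc1(3)]
    is_cell2.comp1[OF assoc1(1) is_cell2.comp1[OF assoc1(2,3)]]
  show ?case by blast
next
  case (cong0 f f' g g')
  then obtain a b c d where "is_cell2 P f a b" "is_cell2 P f' a b"
    "is_cell2 P g c d" "is_cell2 P g' c d" by blast
  then show ?case using is_cell2.comp0[of P f a b g c d] is_cell2.comp0[of P f' a b g' c d] by blast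
next
  case (cong_inv f f')
  then show ?case by (blast intro: is_cell2.inv)
qed blast+

definition fill2 :: "('a, 'b, 'c) polygraph31 \<Rightarrow> ('a, 'b) cell2 \<Rightarrow> ('a, 'b) cell2 \<Rightarrow> bool" where
  "fill2 P f g \<longleftrightarrow> (\<exists>A. is_cell3 P A f g)"

lemma fill2_refl: "is_cell2 P f u v \<Longrightarrow> fill2 P f f"
  unfolding fill2_def by (blast intro: is_cell3.id)

lemma fill2_sym: "fill2 P f g \<Longrightarrow> fill2 P g f"
  unfolding fill2_def by (blast intro: is_cell3.inv)

lemma fill2_trans [trans]: "fill2 P f g \<Longrightarrow> fill2 P g h \<Longrightarrow> fill2 P f h"
  unfolding fill2_def by (blast intro: is_cell3.comp2)

lemma fill2_comp0: "fill2 P f g \<Longrightarrow> fill2 P f' g' \<Longrightarrow> fill2 P (f \<star>\<^sub>0 f') (g \<star>\<^sub>0 g')"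
  unfolding fill2_def by (blast intro: is_cell3.comp0)

lemma fill2_comp1:
  "fill2 P f g \<Longrightarrow> fill2 P f' g' \<Longrightarrow> is_cell2 P f u v \<Longrightarrow> is_cell2 P f' v w
    \<Longrightarrow> fill2 P (f \<star>\<^sub>1 f') (g \<star>\<^sub>1 g')"
  unfolding fill2_def by (blast intro: is_cell3.comp1)

lemma fill2_gen: "c \<in> cells3 P \<Longrightarrow> fill2 P (src3 P c) (tgt3 P c)"
  unfolding fill2_def by (blast intro: is_cell3.gen)

lemma fill2_eq2:
  assumes "is_polygraph2 P" "eq2 P f g" shows "fill2 P f g"
proof -
  obtain u v where "is_cell2 P f u v" using eq2_is_cell2 assms by blast
  then show ?thesis
    unfolding fill2_def using is_cell3.bd[OF is_cell3.id eq2.refl assms(2)] by blast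
qed

lemma fill2_cancel_left:
  assumes P: "is_polygraph2 P" and a: "is_cell2 P a u v"
    and f: "is_cell2 P f v w" and g: "is_cell2 P g v w"
    and fg: "fill2 P (a \<star>\<^sub>1 f) (a \<star>\<^sub>1 g)"
  shows "fill2 P f g"
proof -
  have *: "eq2 P (Inv2 a \<star>\<^sub>1 (a \<star>\<^sub>1 h)) h" if h: "is_cell2 P h v w" for h
  proof -
    have i: "is_cell2 P (Inv2 a) v u" using a by (rule is_cell2.inv)
    have "eq2 P (Inv2 a \<star>\<^sub>1 (a \<star>\<^sub>1 h)) ((Inv2 a \<star>\<^sub>1 a) \<star>\<^sub>1 h)"
      by (rule eq2.sym, rule eq2.assoc1[OF i a h])
    moreover have "eq2 P ((Inv2 a \<star>\<^sub>1 a) \<star>\<^sub>1 h) (Id2 v \<star>\<^sub>1 h)"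
      by (rule eq2.cong1[OF eq2.inv_left[OF a] eq2.refl[OF h] is_cell2.comp1[OF i a] h])
    ultimately show ?thesis using eq2.unit1_left[OF h] eq2.trans by blast
  qed
  have "fill2 P (Inv2 a \<star>\<^sub>1 (a \<star>\<^sub>1 f)) (Inv2 a \<star>\<^sub>1 (a \<star>\<^sub>1 g))"
    by (rule fill2_comp1[OF fill2_refl[OF is_cell2.inv[OF a]] fg is_cell2.inv[OF a]
          is_cell2.comp1[OF a f]])
  from fill2_trans[OF fill2_sym[OF fill2_eq2[OF P *[OF f]]]
      fill2_trans[OF this fill2_eq2[OF P *[OF g]]]]
  show ?thesis .
qed

text \<open>Solves for \<open>V\<close> when its conjugate by \<open>f\<close> and \<open>g\<close>
  is equivalent to \<open>b\<close>. This is how a filling of the boundary of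
  \<open>A_cell \<beta>\<close> yields one for the replaced \<open>X_cell\<close>: \<open>V\<close>
  is one side of that confluence, and the composite of \<open>f\<close>, \<open>b\<close>,
  \<open>g\<close> is the other.\<close>

lemma fill2_conjugate:
  assumes P: "is_polygraph2 P" and f: "is_cell2 P f u p" and b: "is_cell2 P b p q"
    and g: "is_cell2 P g q v" and V: "is_cell2 P V u v"
    and h: "fill2 P (Inv2 f \<star>\<^sub>1 V \<star>\<^sub>1 Inv2 g) b"
  shows "fill2 P V (f \<star>\<^sub>1 b \<star>\<^sub>1 g)"
proof -
  note t = is_cell2.comp1 is_cell2.inv
  have fi: "is_cell2 P (Inv2 f) p u" and gi: "is_cell2 P (Inv2 g) v q" using t(2)[OF f] t(2)[OF g] .
  let ?W = "Inv2 f \<star>\<^sub>1 V \<star>\<^sub>1 Inv2 g"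
  have vg: "is_cell2 P (V \<star>\<^sub>1 Inv2 g) u q" and W: "is_cell2 P ?W p q"
    using t(1)[OF V gi] t(1)[OF fi t(1)[OF V gi]] by auto
  have Wg: "is_cell2 P (?W \<star>\<^sub>1 g) p v" using t(1)[OF W g] .
  have Ig: "is_cell2 P (Inv2 g \<star>\<^sub>1 g) v v" using t(1)[OF gi g] .
  have VIg: "is_cell2 P (V \<star>\<^sub>1 (Inv2 g \<star>\<^sub>1 g)) u v" using t(1)[OF V Ig] .
  have e1: "eq2 P ((V \<star>\<^sub>1 Inv2 g) \<star>\<^sub>1 g) V"
  proof -
    have "eq2 P ((V \<star>\<^sub>1 Inv2 g) \<star>\<^sub>1 g) (V \<star>\<^sub>1 (Inv2 g \<star>\<^sub>1 g))" by (rule eq2.assoc1[OF V gi g])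
    moreover have "eq2 P (V \<star>\<^sub>1 (Inv2 g \<star>\<^sub>1 g)) (V \<star>\<^sub>1 Id2 v)"
      by (rule eq2.cong1[OF eq2.refl[OF V] eq2.inv_left[OF g] V Ig])
    ultimately show ?thesis using eq2.unit1_right[OF V] eq2.trans by blast
  qed
  have e2: "eq2 P (?W \<star>\<^sub>1 g) (Inv2 f \<star>\<^sub>1 V)"
  proof -
    have "eq2 P (?W \<star>\<^sub>1 g) (Inv2 f \<star>\<^sub>1 ((V \<star>\<^sub>1 Inv2 g) \<star>\<^sub>1 g))"
      by (rule eq2.assoc1[OF fi vg g])
    moreover have "eq2 P (Inv2 f \<star>\<^sub>1 ((V \<star>\<^sub>1 Inv2 g) \<star>\<^sub>1 g)) (Inv2 f \<star>\<^sub>1 V)"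
      by (rule eq2.cong1[OF eq2.refl[OF fi] e1 fi]) (rule t(1)[OF vg g])
    ultimately show ?thesis using eq2.trans by blast
  qed
  have e3: "eq2 P (f \<star>\<^sub>1 (?W \<star>\<^sub>1 g)) V"
  proof -
    have If: "is_cell2 P (f \<star>\<^sub>1 Inv2 f) u u" using t(1)[OF f fi] .
    have "eq2 P (f \<star>\<^sub>1 (?W \<star>\<^sub>1 g)) (f \<star>\<^sub>1 (Inv2 f \<star>\<^sub>1 V))"
      by (rule eq2.cong1[OF eq2.refl[OF f] e2 f Wg])
    moreover have "eq2 P (f \<star>\<^sub>1 (Inv2 f \<star>\<^sub>1 V)) ((f \<star>\<^sub>1 Inv2 f) \<star>\<^sub>1 V)"
      by (rule eq2.sym[OF eq2.assoc1[OF f fi V]])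
    moreover have "eq2 P ((f \<star>\<^sub>1 Inv2 f) \<star>\<^sub>1 V) (Id2 u \<star>\<^sub>1 V)"
      by (rule eq2.cong1[OF eq2.inv_right[OF f] eq2.refl[OF V] If V])
    ultimately show ?thesis using eq2.unit1_left[OF V] eq2.trans by blast
  qed
  have "fill2 P (f \<star>\<^sub>1 (?W \<star>\<^sub>1 g)) (f \<star>\<^sub>1 (b \<star>\<^sub>1 g))"
    by (rule fill2_comp1[OF fill2_refl[OF f] fill2_comp1[OF h fill2_refl[OF g] W g] f Wg])
  from fill2_trans[OF fill2_sym[OF fill2_eq2[OF P e3]] this] show ?thesis .
qed

text \<open>\<open>F\<close> acts on raw expressions and has to be strict only on typed ones. It
  then turns each axiom of \<open>eq2\<close> into an instance of the same axiom, and each 3-cell of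
  \<open>P\<close> into a filling in \<open>Q\<close>, provided the generating 3-cells are sent to
  filled pairs. It is applied to the identity and to the reduction functor.\<close>

lemma fill2_functor:
  assumes Q: "is_polygraph2 Q"
    and tyF: "\<And>f u v. is_cell2 P f u v \<Longrightarrow> is_cell2 Q (F f) u v"
    and idF: "\<And>w. w \<in> lists (cells1 P) \<Longrightarrow> F (Id2 w) = Id2 w"
    and F0: "\<And>f g u v u' v'. is_cell2 P f u v \<Longrightarrow> is_cell2 P g u' v' \<Longrightarrow> F (f \<star>\<^sub>0 g) = F f \<star>\<^sub>0 F g"
    and F1: "\<And>f g u v w. is_cell2 P f u v \<Longrightarrow> is_cell2 P g v w \<Longrightarrow> F (f \<star>\<^sub>1 g) = F f \<star>\<^sub>1 F g"
    and Fi: "\<And>f u v. is_cell2 P f u v \<Longrightarrow> F (Inv2 f) = Inv2 (F f)"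
    and P: "is_polygraph2 P" and c1: "cells1 P = cells1 Q"
    and par: "\<And>c. c \<in> cells3 P \<Longrightarrow> parallel2 P (src3 P c) (tgt3 P c)"
    and gen: "\<And>c. c \<in> cells3 P \<Longrightarrow> fill2 Q (F (src3 P c)) (F (tgt3 P c))"
    and fg: "fill2 P f g"
  shows "fill2 Q (F f) (F g)"
proof -
  have t2: "eq2 P f g \<Longrightarrow> \<exists>u v. is_cell2 P f u v \<and> is_cell2 P g u v" for f g
    using eq2_is_cell2[OF P] by blast
  have lst: "u \<in> lists (cells1 P)" "v \<in> lists (cells1 P)" if "is_cell2 P f u v" for f u v
    using is_cell2_lists[OF P that] by auto
  have eqF: "eq2 Q (F f) (F g)" if "eq2 P f g" for f g
    using that
  proof (induction rule: eq2.induct)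
    case (refl f u v) then show ?case using tyF eq2.refl by blast
  next
    case (sym f g) then show ?case using eq2.sym by blast
  next
    case (trans f g h) then show ?case using eq2.trans by blast
  next
    case (cong0 f f' g g')
    have "F (f \<star>\<^sub>0 g) = F f \<star>\<^sub>0 F g" "F (f' \<star>\<^sub>0 g') = F f' \<star>\<^sub>0 F g'"
      using F0 t2[OF cong0.hyps(1)] t2[OF cong0.hyps(2)] by blast+
    then show ?case using eq2.cong0[OF cong0.IH] by simp
  next
    case (cong1 f f' g g' u v w)
    then have "is_cell2 P f' u v" "is_cell2 P g' v w"
      using is_cell2_parallel[OF t2] cong1.hyps by blast+
    then show ?case
      using eq2.cong1[OF cong1.IH tyF[OF cong1.hyps(3)] tyF[OF cong1.hyps(4)]]
        F1[OF cong1.hyps(3,4)] F1[of f' u v g' w] by simp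
  next
    case (cong_inv f f')
    have "F (Inv2 f) = Inv2 (F f)" "F (Inv2 f') = Inv2 (F f')"
      using Fi t2[OF cong_inv.hyps] by blast+
    then show ?case using eq2.cong_inv[OF cong_inv.IH] by simp
  next
    case (assoc0 f u u' g v v' h w w')
    note 1 = is_cell2.comp0[OF assoc0(1,2)] is_cell2.comp0[OF assoc0(2,3)]
    show ?case
      using eq2.assoc0[OF assoc0[THEN tyF]]
      by (simp only: F0[OF assoc0(1,2)] F0[OF assoc0(2,3)] F0[OF assoc0(1) 1(2)] F0[OF 1(1) assoc0(3)])
  next
    case (unit0_left f u v)
    show ?case
      using eq2.unit0_left[OF tyF[OF unit0_left]]
      by (simp only: F0[OF is_cell2.id[OF lists.Nil] unit0_left] idF[OF lists.Nil])
  next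
    case (unit0_right f u v)
    show ?case
      using eq2.unit0_right[OF tyF[OF unit0_right]]
      by (simp only: F0[OF unit0_right is_cell2.id[OF lists.Nil]] idF[OF lists.Nil])
  next
    case (assoc1 f u v g w h x)
    note 1 = is_cell2.comp1[OF assoc1(1,2)] is_cell2.comp1[OF assoc1(2,3)]
    show ?case
      using eq2.assoc1[OF assoc1[THEN tyF]]
      by (simp only: F1[OF assoc1(1,2)] F1[OF assoc1(2,3)] F1[OF assoc1(1) 1(2)] F1[OF 1(1) assoc1(3)])
  next
    case (unit1_left f u v)
    show ?case
      using eq2.unit1_left[OF tyF[OF unit1_left]]
      by (simp only: F1[OF is_cell2.id[OF lst(1)[OF unit1_left]] unit1_left] idF[OF lst(1)[OF unit1_left]])
  next
    case (unit1_right f u v)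
    show ?case
      using eq2.unit1_right[OF tyF[OF unit1_right]]
      by (simp only: F1[OF unit1_right is_cell2.id[OF lst(2)[OF unit1_right]]] idF[OF lst(2)[OF unit1_right]])
  next
    case (id_comp0 u v)
    then have "F (Id2 u \<star>\<^sub>0 Id2 v) = Id2 u \<star>\<^sub>0 Id2 v" "F (Id2 (u @ v)) = Id2 (u @ v)"
      using F0[OF is_cell2.id is_cell2.id] idF by simp_all
    then show ?case using id_comp0 c1 eq2.id_comp0 by metis
  next
    case (exchange f u v g w f' u' v' g' w')
    have 1: "is_cell2 P (f \<star>\<^sub>1 g) u w" "is_cell2 P (f' \<star>\<^sub>1 g') u' w'"
      using exchange by (blast intro: is_cell2.comp1)+
    have 2: "is_cell2 P (f \<star>\<^sub>0 f') (u @ u') (v @ v')" "is_cell2 P (g \<star>\<^sub>0 g') (v @ v') (w @ w')"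
      using exchange by (blast intro: is_cell2.comp0)+
    show ?case
      using eq2.exchange[OF exchange[THEN tyF]] by (simp only: F0[OF 1] F1[OF 2]
          F1[OF exchange(1,2)] F1[OF exchange(3,4)] F0[OF exchange(1,3)] F0[OF exchange(2,4)])
  next
    case (inv_right f u v)
    then show ?case
      using eq2.inv_right[OF tyF[OF inv_right]] F1[OF inv_right is_cell2.inv[OF inv_right]]
        Fi[OF inv_right] idF lst(1)[OF inv_right] by simp
  next
    case (inv_left f u v)
    then show ?case
      using eq2.inv_left[OF tyF[OF inv_left]] F1[OF is_cell2.inv[OF inv_left] inv_left]
        Fi[OF inv_left] idF lst(2)[OF inv_left] by simp
  qed
  obtain A where "is_cell3 P A f g" using fg unfolding fill2_def by blast
  \<comment> \<open>Parallelism is carried along because \<open>F0\<close> and \<open>F1\<close>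
    require the types of both boundaries.\<close>
  then have "parallel2 P f g \<and> fill2 Q (F f) (F g)"
  proof (induction rule: is_cell3.induct)
    case (id f u v)
    then show ?case using tyF fill2_refl unfolding parallel2_def by blast
  next
    case (gen c)
    then show ?case using par assms(10) by blast
  next
    case (comp0 A f g B f' g')
    then obtain u v u' v' where 1: "is_cell2 P f u v" "is_cell2 P g u v"
      "is_cell2 P f' u' v'" "is_cell2 P g' u' v'" unfolding parallel2_def by blast
    then have "parallel2 P (f \<star>\<^sub>0 f') (g \<star>\<^sub>0 g')"
      unfolding parallel2_def by (blast intro: is_cell2.comp0)
    moreover have "F (f \<star>\<^sub>0 f') = F f \<star>\<^sub>0 F f'" "F (g \<star>\<^sub>0 g') = F g \<star>\<^sub>0 F g'" using F0 1 by blast+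
    ultimately show ?case using comp0.IH fill2_comp0[of Q "F f" "F g" "F f'" "F g'"] by simp
  next
    case (comp1 A f g B f' g' u v w)
    then have 1: "is_cell2 P g u v" "is_cell2 P g' v w"
      using is_cell2_parallel unfolding parallel2_def by blast+
    then have "parallel2 P (f \<star>\<^sub>1 f') (g \<star>\<^sub>1 g')"
      unfolding parallel2_def using comp1.hyps(3,4) by (blast intro: is_cell2.comp1)
    moreover have "F (f \<star>\<^sub>1 f') = F f \<star>\<^sub>1 F f'" "F (g \<star>\<^sub>1 g') = F g \<star>\<^sub>1 F g'"
      using F1 1 comp1.hyps by blast+
    ultimately show ?case
      using fill2_comp1[of Q "F f" "F g" "F f'" "F g'" u v w] comp1 tyF by simp
  next
    case (comp2 A f g B h)
    then obtain u v where *: "is_cell2 P f u v" "is_cell2 P g u v" unfolding parallel2_def by blast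
    have "parallel2 P f h"
      using *(1) is_cell2_parallel[OF _ *(2)] comp2.IH(2) unfolding parallel2_def by blast
    then show ?case using comp2.IH fill2_trans by blast
  next
    case (inv A f g)
    then show ?case using fill2_sym unfolding parallel2_def by blast
  next
    case (bd A f g f' g')
    obtain u v where "is_cell2 P f u v" "is_cell2 P g u v"
      using bd.IH unfolding parallel2_def by blast
    then have "is_cell2 P f' u v" "is_cell2 P g' u v"
      using is_cell2_parallel[OF t2] bd.hyps by blast+
    moreover have "fill2 Q (F f') (F g')"
      using fill2_trans[OF fill2_sym[OF fill2_eq2[OF Q eqF[OF bd.hyps(2)]]]
          fill2_trans[OF conjunct2[OF bd.IH] fill2_eq2[OF Q eqF[OF bd.hyps(3)]]]] .
    ultimately show ?case unfolding parallel2_def by blast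
  qed
  then show ?thesis by blast
qed

declare One_nat_def [simp del]

section \<open>Word congruences\<close>

lemma word_cong_lists:
  assumes R: "R \<subseteq> lists X \<times> lists X" and "word_cong X R u v"
  shows "u \<in> lists X \<and> v \<in> lists X"
  using assms(2) by induction (use R in auto)

lemma word_cong_context:
  assumes "word_cong X R u v" "a \<in> lists X" "b \<in> lists X"
  shows "word_cong X R (a @ u @ b) (a @ v @ b)"
  using assms
proof (induction rule: word_cong.induct)
  case (base u v x y)
  then show ?case using word_cong.base[of u v R "a @ x" X "y @ b"] by simp
next
  case (refl w)
  then show ?case by (intro word_cong.refl) simp
qed (blast intro: word_cong.sym word_cong.trans)+

lemma word_cong_append:
  assumes R: "R \<subseteq> lists X \<times> lists X"
    and "word_cong X R u v" "word_cong X R u' v'"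
  shows "word_cong X R (u @ u') (v @ v')"
proof -
  have l: "u' \<in> lists X" "v \<in> lists X" using word_cong_lists[OF R] assms by blast+
  have "word_cong X R (u @ u') (v @ u')"
    using word_cong_context[OF assms(2) lists.Nil l(1)] by simp
  moreover have "word_cong X R (v @ u') (v @ v')"
    using word_cong_context[OF assms(3) l(2) lists.Nil] by simp
  ultimately show ?thesis by (rule word_cong.trans)
qed

lemma equiv_word_rel:
  assumes R: "R \<subseteq> lists X \<times> lists X"
  shows "equiv (lists X) (word_rel X R)"
proof (rule equivI)
  show "word_rel X R \<subseteq> lists X \<times> lists X"
    unfolding word_rel_def using word_cong_lists[OF R] by blast
  show "refl_on (lists X) (word_rel X R)"
    unfolding word_rel_def by (auto simp: refl_on_def intro: word_cong.refl)
  show "sym (word_rel X R)" unfolding word_rel_def sym_def by (auto intro: word_cong.sym)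
  show "trans (word_rel X R)" unfolding word_rel_def trans_def by (auto intro: word_cong.trans)
qed

lemma presented_monoid_iso:
  assumes R: "R \<subseteq> lists X \<times> lists X" and S: "S \<subseteq> lists Y \<times> lists Y"
    and hom: "\<And>a b. \<phi> (a @ b) = \<phi> a @ \<phi> b"
    and lst: "\<And>u. u \<in> lists X \<Longrightarrow> \<phi> u \<in> lists Y"
    and iff: "\<And>u v. u \<in> lists X \<Longrightarrow> v \<in> lists X \<Longrightarrow> word_cong X R u v \<longleftrightarrow> word_cong Y S (\<phi> u) (\<phi> v)"
    and surj: "\<And>w. w \<in> lists Y \<Longrightarrow> \<exists>u\<in>lists X. word_cong Y S (\<phi> u) w"
  shows "presented_monoid X R \<cong> presented_monoid Y S"
proof -
  let ?r = "word_rel X R" and ?s = "word_rel Y S"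
  have eR: "equiv (lists X) ?r" and eS: "equiv (lists Y) ?s"
    using equiv_word_rel[OF R] equiv_word_rel[OF S] by auto
  \<comment> \<open>All classes in this union coincide, as \<open>cls\<close> shows, so
    \<open>h\<close> is the induced map without a choice of representatives.\<close>
  define h where "h A = (\<Union>a\<in>A. ?s `` {\<phi> a})" for A
  have cls: "h (?r `` {a}) = ?s `` {\<phi> a}" if a: "a \<in> lists X" for a
  proof -
    have "?s `` {\<phi> b} = ?s `` {\<phi> a}" if "b \<in> ?r `` {a}" for b
    proof -
      from that have "word_cong X R a b" unfolding word_rel_def by blast
      moreover from this have "b \<in> lists X" using word_cong_lists[OF R] by blast
      ultimately have "word_cong Y S (\<phi> a) (\<phi> b)" using iff a by blast
      then have "(\<phi> a, \<phi> b) \<in> ?s" unfolding word_rel_def by blast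
      then show ?thesis using equiv_class_eq[OF eS] by metis
    qed
    moreover have "a \<in> ?r `` {a}" using equiv_class_self[OF eR a] .
    ultimately show ?thesis unfolding h_def by blast
  qed
  have multR: "(\<Union>a\<in>?r `` {a}. \<Union>b\<in>?r `` {b}. ?r `` {a @ b}) = ?r `` {a @ b}"
    if ab: "a \<in> lists X" "b \<in> lists X" for a b
  proof -
    have "?r `` {a' @ b'} = ?r `` {a @ b}" if "a' \<in> ?r `` {a}" "b' \<in> ?r `` {b}" for a' b'
    proof -
      have "(a @ b, a' @ b') \<in> ?r"
        using that word_cong_append[OF R] unfolding word_rel_def by blast
      then show ?thesis using equiv_class_eq[OF eR] by metis
    qed
    then show ?thesis using equiv_class_self[OF eR ab(1)] equiv_class_self[OF eR ab(2)] by blast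
  qed
  have multS: "(\<Union>a\<in>?s `` {a}. \<Union>b\<in>?s `` {b}. ?s `` {a @ b}) = ?s `` {a @ b}"
    if ab: "a \<in> lists Y" "b \<in> lists Y" for a b
  proof -
    have "?s `` {a' @ b'} = ?s `` {a @ b}" if "a' \<in> ?s `` {a}" "b' \<in> ?s `` {b}" for a' b'
    proof -
      have "(a @ b, a' @ b') \<in> ?s"
        using that word_cong_append[OF S] unfolding word_rel_def by blast
      then show ?thesis using equiv_class_eq[OF eS] by metis
    qed
    then show ?thesis using equiv_class_self[OF eS ab(1)] equiv_class_self[OF eS ab(2)] by blast
  qed
  have "h \<in> hom (presented_monoid X R) (presented_monoid Y S)"
  proof (rule homI)
    fix A assume "A \<in> carrier (presented_monoid X R)"
    then obtain a where a: "a \<in> lists X" "A = ?r `` {a}"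
      unfolding presented_monoid_def by (auto elim!: quotientE)
    then show "h A \<in> carrier (presented_monoid Y S)"
      using cls[OF a(1)] quotientI[OF lst[OF a(1)]] unfolding presented_monoid_def by simp
  next
    fix A B assume "A \<in> carrier (presented_monoid X R)" "B \<in> carrier (presented_monoid X R)"
    then obtain a b where a: "a \<in> lists X" "A = ?r `` {a}" and b: "b \<in> lists X" "B = ?r `` {b}"
      unfolding presented_monoid_def by (auto elim!: quotientE)
    have "h (\<Union>a\<in>A. \<Union>b\<in>B. ?r `` {a @ b}) = ?s `` {\<phi> a @ \<phi> b}"
      unfolding a(2) b(2) multR[OF a(1) b(1)] using cls[of "a @ b"] a b hom by simp
    also have "\<dots> = (\<Union>a\<in>h A. \<Union>b\<in>h B. ?s `` {a @ b})"
      unfolding a(2) b(2) cls[OF a(1)] cls[OF b(1)] multS[OF lst[OF a(1)] lst[OF b(1)]] ..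
    finally show "h (A \<otimes>\<^bsub>presented_monoid X R\<^esub> B) = h A \<otimes>\<^bsub>presented_monoid Y S\<^esub> h B"
      unfolding presented_monoid_def by simp
  qed
  moreover have "bij_betw h (lists X // ?r) (lists Y // ?s)"
  proof (rule bij_betwI')
    fix A B assume "A \<in> lists X // ?r" "B \<in> lists X // ?r"
    then obtain a b where a: "a \<in> lists X" "A = ?r `` {a}" and b: "b \<in> lists X" "B = ?r `` {b}"
      by (auto elim!: quotientE)
    have "h A = h B \<longleftrightarrow> word_cong Y S (\<phi> a) (\<phi> b)"
      unfolding a(2) b(2) cls[OF a(1)] cls[OF b(1)]
      using eq_equiv_class_iff[OF eS lst[OF a(1)] lst[OF b(1)]] unfolding word_rel_def by simp
    also have "\<dots> \<longleftrightarrow> A = B"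
      unfolding a(2) b(2) iff[OF a(1) b(1), symmetric]
      using eq_equiv_class_iff[OF eR a(1) b(1)] unfolding word_rel_def by simp
    finally show "h A = h B \<longleftrightarrow> A = B" .
  next
    fix A assume "A \<in> lists X // ?r"
    then obtain a where a: "a \<in> lists X" "A = ?r `` {a}" by (auto elim!: quotientE)
    then show "h A \<in> lists Y // ?s" using cls[OF a(1)] quotientI[OF lst[OF a(1)]] by simp
  next
    fix B assume "B \<in> lists Y // ?s"
    then obtain b where b: "b \<in> lists Y" "B = ?s `` {b}" by (auto elim!: quotientE)
    obtain a where a: "a \<in> lists X" "word_cong Y S (\<phi> a) b" using surj[OF b(1)] by blast
    then have "B = h (?r `` {a})"
      unfolding b(2) cls[OF a(1)] using equiv_class_eq[OF eS, of "\<phi> a" b]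
      unfolding word_rel_def by auto
    then show "\<exists>A\<in>lists X // ?r. B = h A" using a(1) quotientI by metis
  qed
  ultimately have "h \<in> iso (presented_monoid X R) (presented_monoid Y S)"
    unfolding iso_def presented_monoid_def by simp
  then show ?thesis unfolding is_iso_def by blast
qed

text \<open>Whiskered generators, inverses and 1-composites of 2-cells are the base case, symmetry
  and transitivity of the congruence. Claims about the presented monoid thus become claims about
  existence of 2-cells.\<close>

lemma word_cong_is_cell2:
  assumes P: "is_polygraph2 P"
  shows "word_cong (cells1 P) {(src2 P b, tgt2 P b) | b. b \<in> cells2 P} u v
    \<longleftrightarrow> (\<exists>f. is_cell2 P f u v)"
proof
  let ?R = "{(src2 P b, tgt2 P b) | b. b \<in> cells2 P}"
  assume "word_cong (cells1 P) ?R u v"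
  then show "\<exists>f. is_cell2 P f u v"
  proof induction
    case (base u v x y)
    then obtain b where b: "b \<in> cells2 P" "u = src2 P b" "v = tgt2 P b" by blast
    from is_cell2.comp0[OF is_cell2.id[OF base(2)] is_cell2.comp0[OF is_cell2.gen[OF b(1)]
          is_cell2.id[OF base(3)]]]
    show ?case using b by blast
  qed (blast intro: is_cell2.id is_cell2.inv is_cell2.comp1)+
next
  let ?R = "{(src2 P b, tgt2 P b) | b. b \<in> cells2 P}"
  have R: "?R \<subseteq> lists (cells1 P) \<times> lists (cells1 P)"
    using P unfolding is_polygraph2_def by blast
  assume "\<exists>f. is_cell2 P f u v"
  then obtain f where "is_cell2 P f u v" by blast
  then show "word_cong (cells1 P) ?R u v"
  proof induction
    case (gen b)
    then show ?case using word_cong.base[of "src2 P b" "tgt2 P b" ?R "[]" "cells1 P" "[]"] by auto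
  next
    case (comp0 f u v g u' v')
    then show ?case using word_cong_append[OF R] by blast
  qed (blast intro: word_cong.intros)+
qed

section \<open>N-insertion\<close>

definition nxt :: "nat set \<Rightarrow> nat \<Rightarrow> nat option" where
  "nxt U x = (if \<exists>y\<in>U. x < y then Some (Min {y \<in> U. x < y}) else None)"

text \<open>The word sent upwards by a row \<open>U\<close> while \<open>w\<close> is inserted;
  \<open>U\<close> only grows, as a bumped letter also stays.\<close>

fun bumps :: "nat set \<Rightarrow> nat list \<Rightarrow> nat list" where
  "bumps U [] = []"
| "bumps U (x # w) = (case nxt U x of None \<Rightarrow> [] | Some y \<Rightarrow> [y]) @ bumps (insert x U) w"

lemma nxt_None_iff: "nxt U x = None \<longleftrightarrow> (\<forall>y\<in>U. y \<le> x)"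
  unfolding nxt_def by (force simp: not_less)

lemma nxt_Some_iff:
  assumes "finite U"
  shows "nxt U x = Some y \<longleftrightarrow> y \<in> U \<and> x < y \<and> (\<forall>z\<in>U. x < z \<longrightarrow> y \<le> z)"
proof
  assume *: "nxt U x = Some y"
  then have ex: "{y \<in> U. x < y} \<noteq> {}" unfolding nxt_def by (auto split: if_splits)
  from * have "y = Min {y \<in> U. x < y}" unfolding nxt_def by (auto split: if_splits)
  moreover have "Min {y \<in> U. x < y} \<in> {y \<in> U. x < y}" using ex assms by (intro Min_in) auto
  ultimately show "y \<in> U \<and> x < y \<and> (\<forall>z\<in>U. x < z \<longrightarrow> y \<le> z)" using assms by auto
next
  assume *: "y \<in> U \<and> x < y \<and> (\<forall>z\<in>U. x < z \<longrightarrow> y \<le> z)"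
  then have "Min {y \<in> U. x < y} = y" using assms by (intro Min_eqI) auto
  then show "nxt U x = Some y" unfolding nxt_def using * by auto
qed

lemma nxt_empty: "nxt {} x = None"
  by (simp add: nxt_def)

lemma nxt_insert:
  assumes "finite U"
  shows "nxt (insert z U) x =
    (if x < z then Some (case nxt U x of None \<Rightarrow> z | Some y \<Rightarrow> min y z) else nxt U x)"
proof (cases "nxt U x")
  case None
  then have "\<forall>y\<in>U. y \<le> x" by (simp add: nxt_None_iff)
  then have "nxt (insert z U) x = (if x < z then Some z else None)"
    using assms by (auto simp: nxt_Some_iff nxt_None_iff)
  then show ?thesis using None by simp
next
  case (Some y)
  have "y \<in> U \<and> x < y \<and> (\<forall>z\<in>U. x < z \<longrightarrow> y \<le> z)" using Some assms by (simp add: nxt_Some_iff)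
  then have "nxt (insert z U) x = Some (if x < z then min y z else y)"
    using assms by (auto simp: nxt_Some_iff min_def)
  then show ?thesis using Some by simp
qed

lemma nxt_mono:
  assumes "finite U" "x \<le> y"
  shows "nxt U x = None \<Longrightarrow> nxt U y = None"
    and "nxt U x = Some a \<Longrightarrow> y < a \<Longrightarrow> nxt U y = Some a"
    and "nxt U x = Some a \<Longrightarrow> nxt U y = Some b \<Longrightarrow> a \<le> b"
    and "nxt U x = Some a \<Longrightarrow> x < a"
  using assms by (auto simp: nxt_None_iff nxt_Some_iff)

lemma sorted_wrt_less_sorted_list_of_set:
  "sorted_wrt (<) u \<Longrightarrow> sorted_list_of_set (set u) = (u :: nat list)"
  by (simp add: sorted_list_of_set.idem_if_sorted_distinct strict_sorted_iff)

lemma insert_rows_Cons: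
  "insert_rows x (u # us) = sorted_list_of_set (insert x (set u)) #
     fold insert_rows (case nxt (set u) x of None \<Rightarrow> [] | Some y \<Rightarrow> [y]) us"
  by (auto simp: nxt_def)

text \<open>A word can be inserted row by row: the bottom row absorbs all its letters, and the
  letters bumped meanwhile form the word received by the rest of the tableau. Claims on tableaux
  become inductions on rows.\<close>

lemma fold_insert_rows_Cons:
  assumes "sorted_wrt (<) u"
  shows "fold insert_rows w (u # us) =
    sorted_list_of_set (set u \<union> set w) # fold insert_rows (bumps (set u) w) us"
  using assms
proof (induction w arbitrary: u us)
  case Nil
  then show ?case by (simp add: sorted_wrt_less_sorted_list_of_set)
next
  case (Cons x w)
  let ?u = "sorted_list_of_set (insert x (set u))"
  have "set ?u = insert x (set u)" "sorted_wrt (<) ?u"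
    by (rule set_sorted_list_of_set, simp, rule strict_sorted_list_of_set)
  with Cons.IH[of ?u "fold insert_rows (case nxt (set u) x of None \<Rightarrow> [] | Some y \<Rightarrow> [y]) us"]
  show ?case by (simp add: insert_rows_Cons del: insert_rows.simps sorted_list_of_set_insert_remove)
qed

text \<open>Lets the row-by-row formula apply to the empty tableau, viewed as having one empty
  bottom row.\<close>

lemma fold_insert_rows_Nil:
  "w \<noteq> [] \<Longrightarrow> fold insert_rows w [] = fold insert_rows w [[]]"
  by (cases w) auto

text \<open>
  The relations \<open>zyy = zzy\<close> are consequences of the others; adding them makes the set
  closed under passing from a word to the word of bumped letters.
\<close>

definition styl_pairs :: "(nat list \<times> nat list) set" where
  "styl_pairs =
     {([x, x], [x]) | x. True}
   \<union> {([z, x, y], [x, z, y]) | x y z. x \<le> y \<and> y < z}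
   \<union> {([y, z, x], [y, x, z]) | x y z. x < y \<and> y \<le> z}
   \<union> {([z, y, y], [z, z, y]) | y z. y < z}"

lemma styl_pairs_iff:
  "([p, q], [r]) \<in> styl_pairs \<longleftrightarrow> p = q \<and> q = r"
  "([p, q, r], [p', q', r']) \<in> styl_pairs \<longleftrightarrow>
    (p = q' \<and> q = p' \<and> r = r' \<and> q \<le> r \<and> r < p)
    \<or> (p = p' \<and> q = r' \<and> r = q' \<and> r < p \<and> p \<le> q)
    \<or> (q = r \<and> p' = p \<and> q' = p \<and> r' = q \<and> q < p)"
  unfolding styl_pairs_def by auto

lemma bumps_styl_pairs:
  assumes U: "finite U" and "(w, w') \<in> styl_pairs"
  shows "bumps U w = bumps U w' \<or> (bumps U w, bumps U w') \<in> styl_pairs"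
proof -
  consider (a) x where "w = [x, x]" "w' = [x]"
    | (b) x y z where "w = [z, x, y]" "w' = [x, z, y]" "x \<le> y" "y < z"
    | (c) x y z where "w = [y, z, x]" "w' = [y, x, z]" "x < y" "y \<le> z"
    | (d) y z where "w = [z, y, y]" "w' = [z, z, y]" "y < z"
    using assms(2) unfolding styl_pairs_def by blast
  then show ?thesis
  proof cases
    case a
    then show ?thesis using U
      by (cases "nxt U x") (auto simp: nxt_insert styl_pairs_iff)
  next
    case b
    note m = nxt_mono[OF U b(3)] nxt_mono[OF U less_imp_le[OF b(4)]] nxt_mono(4)[OF U order.refl]
    \<comment> \<open>Either \<open>x\<close> bumps a letter at most \<open>y\<close>, or
      \<open>x\<close> and \<open>y\<close> see the same next letter of \<open>U\<close>; likewise
      for \<open>y\<close> and \<open>z\<close>. If all three see the same letter \<open>c\<close>,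
      the bumped words are \<open>c z z\<close> and \<open>c c z\<close>, which is where the added
      relation arises.\<close>
    have x: "(\<exists>a. nxt U x = Some a \<and> a \<le> y) \<or> nxt U x = nxt U y"
      using m(1,2) by (metis not_le not_None_eq)
    have z: "(\<exists>e. nxt U y = Some e \<and> e \<le> z) \<or> nxt U z = nxt U y"
      using m(5,6) by (metis not_le not_None_eq)
    have y: "y < e" if "nxt U y = Some e" for e using m(4,9) that by blast
    have z': "z < e" if "nxt U z = Some e" for e using m(9) that by blast
    show ?thesis
    proof (cases "nxt U z")
      case None
      then show ?thesis using x z y b U
        by (auto simp: nxt_insert styl_pairs_iff split: option.splits)
    next
      case (Some c)
      then have "z < c" using z' by blast
      then show ?thesis using Some x z y b U
        by (auto simp: nxt_insert styl_pairs_iff min_def split: option.splits)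
    qed
  next
    case c
    note m = nxt_mono[OF U c(4)] nxt_mono(4)[OF U order.refl]
    \<comment> \<open>\<open>k\<close> is the letter that \<open>x\<close> bumps once
      \<open>y\<close> is in the row; the presence of \<open>z\<close>, being at least
      \<open>y\<close>, does not alter it.\<close>
    define k where "k = (case nxt U x of None \<Rightarrow> y | Some a \<Rightarrow> min a y)"
    have k: "k \<le> y" unfolding k_def by (cases "nxt U x") auto
    show ?thesis
    proof (cases "nxt U z")
      case None
      moreover have "min k z = k" using k c by simp
      ultimately have "bumps U w = bumps U w'"
        using c U by (cases "nxt U y") (simp_all add: nxt_insert flip: k_def)
      then show ?thesis ..
    next
      case (Some e)
      with m(1) obtain d where d: "nxt U y = Some d" by fastforce
      from m(3)[OF d Some] m(5)[OF d] have d': "d \<le> e" "y < d" .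
      show ?thesis using c U Some d d' k
        by (simp add: nxt_insert styl_pairs_iff flip: k_def)
    qed
  next
    case d
    \<comment> \<open>\<open>k\<close> is the letter that \<open>y\<close> bumps once
      \<open>z\<close> is in the row: twice for \<open>w\<close>, once for
      \<open>w'\<close>.\<close>
    define k where "k = (case nxt U y of None \<Rightarrow> z | Some a \<Rightarrow> min a z)"
    have k: "k \<le> z" unfolding k_def by (cases "nxt U y") auto
    have "z < e" if "nxt U z = Some e" for e using nxt_mono(4)[OF U order.refl that] .
    then show ?thesis using d U k
      by (cases "nxt U z") (auto simp: nxt_insert styl_pairs_iff simp flip: k_def)
  qed
qed

text \<open>The new bottom row depends only on the set of inserted letters, which is the same on
  both sides, and the bumped words are equal or again related.\<close>

lemma fold_insert_rows_styl_pairs: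
  assumes "(w, w') \<in> styl_pairs" "\<forall>u\<in>set T. sorted_wrt (<) u"
  shows "fold insert_rows w T = fold insert_rows w' T"
  using assms
proof (induction T arbitrary: w w')
  case Nil
  have "w \<noteq> []" "w' \<noteq> []" "set w = set w'" using Nil unfolding styl_pairs_def by auto
  moreover have "fold insert_rows (bumps {} w) [] = fold insert_rows (bumps {} w') []"
    using Nil unfolding styl_pairs_def by (auto simp: nxt_insert nxt_empty)
  ultimately show ?case
    using fold_insert_rows_Cons[of "[]" w "[]"] fold_insert_rows_Cons[of "[]" w' "[]"]
    by (simp add: fold_insert_rows_Nil)
next
  case (Cons u us)
  then have "fold insert_rows (bumps (set u) w) us = fold insert_rows (bumps (set u) w') us"
    using bumps_styl_pairs[of "set u" w w'] by auto
  moreover have "set w = set w'" using Cons unfolding styl_pairs_def by auto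
  ultimately show ?case using Cons fold_insert_rows_Cons by simp
qed


lemma fold_insert_rows_strict:
  "\<forall>u\<in>set T. sorted_wrt (<) u \<Longrightarrow> \<forall>u\<in>set (fold insert_rows w T). sorted_wrt (<) u"
proof (induction w arbitrary: T)
  case (Cons x w)
  have "\<forall>u\<in>set (insert_rows x T). sorted_wrt (<) u"
    using Cons.prems
  proof (induction T arbitrary: x)
    case (Cons u us)
    have "sorted_wrt (<) (sorted_list_of_set (insert x (set u)))"
      by (rule strict_sorted_list_of_set)
    then show ?case using Cons
      by (auto simp: insert_rows_Cons simp del: insert_rows.simps(2) sorted_list_of_set_insert_remove
          split: option.splits)
  qed simp
  then show ?case using Cons.IH by simp
qed simp

lemma styl_rels_subset: "styl_rels n \<subseteq> styl_pairs"
  unfolding styl_rels_def styl_pairs_def by blast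

lemma styl_rels_lists: "styl_rels n \<subseteq> lists {1..n} \<times> lists {1..n}"
  unfolding styl_rels_def by auto

abbreviation styl_cong :: "nat \<Rightarrow> nat list \<Rightarrow> nat list \<Rightarrow> bool" where
  "styl_cong n \<equiv> word_cong {1..n} (styl_rels n)"

lemma styl_cong_fold_insert_rows:
  assumes "styl_cong n w w'" "\<forall>u\<in>set T. sorted_wrt (<) u"
  shows "fold insert_rows w T = fold insert_rows w' T"
  using assms
proof (induction arbitrary: T rule: word_cong.induct)
  case (base u v x y)
  then show ?case
    using fold_insert_rows_styl_pairs[OF subsetD[OF styl_rels_subset base(1)] fold_insert_rows_strict[OF base(4)]]
    by simp
qed metis+

lemma styl_cong_N_tab: "styl_cong n w w' \<Longrightarrow> N_tab w = N_tab w'"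
  unfolding N_tab_def using styl_cong_fold_insert_rows[of n w w' "[]"] by simp

section \<open>Insertion of sorted words and tableaux of two rows\<close>

lemma bumps_sorted: "finite U \<Longrightarrow> sorted w \<Longrightarrow> bumps U w = List.map_filter (nxt U) w"
proof (induction w arbitrary: U)
  case (Cons x w)
  \<comment> \<open>An inserted \<open>x\<close> is at most every later letter \<open>y\<close>, so
    it is never the next letter above \<open>y\<close>.\<close>
  have "\<forall>y\<in>set w. nxt (insert x U) y = nxt U y"
    using Cons.prems by (auto simp: nxt_insert not_less dest: leD)
  then have "List.map_filter (nxt (insert x U)) w = List.map_filter (nxt U) w"
    by (simp add: List.map_filter_def cong: map_cong filter_cong)
  then have "bumps (insert x U) w = List.map_filter (nxt U) w"
    using Cons by simp
  then show ?case by (simp split: option.splits)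
qed simp

lemma set_bumps_sorted:
  "finite U \<Longrightarrow> sorted w \<Longrightarrow> set (bumps U w) = {y. \<exists>x\<in>set w. nxt U x = Some y}"
  by (force simp: bumps_sorted List.map_filter_def)

lemma sorted_bumps:
  assumes "finite U" "sorted w" shows "sorted (bumps U w)"
  unfolding bumps_sorted[OF assms] using assms(2)
proof (induction w)
  case (Cons x w)
  show ?case
  proof (cases "nxt U x")
    case None
    then show ?thesis using Cons by simp
  next
    case (Some y)
    have "y \<le> z" if "z \<in> set (List.map_filter (nxt U) w)" for z
    proof -
      from that obtain x' where "x' \<in> set w" "nxt U x' = Some z"
        by (force simp: List.map_filter_def)
      then show ?thesis using nxt_mono(3)[OF assms(1) _ Some] Cons.prems by auto
    qed
    then show ?thesis using Cons Some by simp
  qed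
qed simp

lemma fold_insert_rows_sorted_Nil:
  assumes "sorted w"
  shows "fold insert_rows w [] = (if w = [] then [] else [sorted_list_of_set (set w)])"
proof -
  have "bumps {} w = []"
    using set_bumps_sorted[OF finite.emptyI assms] by (simp add: nxt_empty)
  then show ?thesis
    using fold_insert_rows_Cons[of "[]" w "[]"] by (simp add: fold_insert_rows_Nil)
qed

definition bump :: "row \<Rightarrow> row \<Rightarrow> nat set" where
  "bump u v = {y. \<exists>x\<in>set v. nxt (set u) x = Some y}"

text \<open>The word bumped by an increasing \<open>v\<close> is weakly increasing and therefore
  fills at most one further row.\<close>

lemma N_tab_two_rows:
  assumes "u \<noteq> []" "sorted_wrt (<) u" "sorted_wrt (<) v"
  shows "N_tab (u @ v) = (if bump u v = {} then [] else [sorted_list_of_set (bump u v)])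
    @ [sorted_list_of_set (set u \<union> set v)]"
proof -
  have s: "sorted u" "sorted v" using assms by (auto simp: strict_sorted_imp_sorted)
  have "fold insert_rows u [] = [u]"
    using fold_insert_rows_sorted_Nil[OF s(1)] assms
    by (simp add: sorted_wrt_less_sorted_list_of_set)
  moreover have "set (bumps (set u) v) = bump u v"
    unfolding bump_def using set_bumps_sorted s by auto
  moreover from this have "bumps (set u) v = [] \<longleftrightarrow> bump u v = {}" by auto
  ultimately show ?thesis
    using fold_insert_rows_sorted_Nil[OF sorted_bumps[OF finite_set s(2), of u]]
      fold_insert_rows_Cons[OF assms(2), of v "[]"]
    unfolding N_tab_def by simp
qed

text \<open>If the bottom row \<open>u\<close> satisfies \<open>u \<lhd>\<^sub>N v\<close>, each
  letter of \<open>u\<close> is bumped by the largest letter of \<open>v\<close> below it. So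
  \<open>u\<close> moves up as a whole and \<open>v\<close> takes its place. \<open>v\<close> is
  only weakly sorted because the word bumped to the next row may repeat letters.\<close>

lemma fold_insert_rows_chain:
  assumes "sorted v" "v \<noteq> []" "R = [] \<or> hd R \<lhd>\<^sub>N v" "successively (\<lambda>a b. b \<lhd>\<^sub>N a) R"
    "\<forall>u\<in>set R. u \<noteq> [] \<and> sorted_wrt (<) u"
  shows "fold insert_rows v R = sorted_list_of_set (set v) # R"
  using assms
proof (induction R arbitrary: v)
  case Nil
  then show ?case by (simp add: fold_insert_rows_sorted_Nil)
next
  case (Cons u us)
  let ?b = "bumps (set u) v"
  have u: "u \<noteq> []" "sorted_wrt (<) u" and uv: "set u \<subseteq> set v" "Min (set v) < Min (set u)"
    using Cons.prems by (auto simp: tri_def)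
  have b: "set ?b = set u"
  proof -
    have "\<exists>x\<in>set v. nxt (set u) x = Some y" if y: "y \<in> set u" for y
    proof -
      let ?A = "{x \<in> set v. x < y}"
      have "Min (set u) \<le> y" using y by simp
      then have ne: "?A \<noteq> {}" using uv Cons.prems(2) Min_in[of "set v"] by fastforce
      define x where "x = Max ?A"
      have x: "x \<in> ?A" unfolding x_def using ne by (intro Max_in) auto
      have "z \<le> x" if "z \<in> set v" "z < y" for z unfolding x_def using that by (intro Max_ge) auto
      then have "\<forall>z\<in>set u. x < z \<longrightarrow> y \<le> z" using uv(1) by (meson not_less subsetD leD)
      then show ?thesis using x y by (auto simp: nxt_Some_iff)
    qed
    then show ?thesis
      unfolding set_bumps_sorted[OF finite_set Cons.prems(1)] by (auto simp: nxt_Some_iff)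
  qed
  have "fold insert_rows ?b us = sorted_list_of_set (set ?b) # us"
  proof (rule Cons.IH)
    show "sorted ?b" using sorted_bumps Cons.prems(1) by simp
    show "?b \<noteq> []" using b u by auto
    show "us = [] \<or> hd us \<lhd>\<^sub>N ?b" using Cons.prems(4) b by (cases us) (auto simp: tri_def)
    show "successively (\<lambda>a b. b \<lhd>\<^sub>N a) us" using Cons.prems(4) by (cases us) auto
    show "\<forall>u\<in>set us. u \<noteq> [] \<and> sorted_wrt (<) u" using Cons.prems(5) by simp
  qed
  then show ?case
    using uv(1) b u by (simp add: fold_insert_rows_Cons sorted_wrt_less_sorted_list_of_set Un_absorb1)
qed

text \<open>Reading a tableau from its top row, every row read pushes the earlier ones up unchanged.
  This makes tableaux their own normal forms.\<close>

lemma N_tab_concat: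
  assumes "successively (\<lhd>\<^sub>N) T" "T \<in> lists (rows n)"
  shows "N_tab (concat T) = T"
proof -
  have "fold insert_rows (concat T) [] = rev T" using assms
  proof (induction T rule: rev_induct)
    case (snoc v T)
    have "fold insert_rows v (rev T) = sorted_list_of_set (set v) # rev T"
    proof (rule fold_insert_rows_chain)
      show "rev T = [] \<or> hd (rev T) \<lhd>\<^sub>N v"
        using snoc.prems by (cases T rule: rev_cases) (auto simp: successively_append_iff)
      show "successively (\<lambda>a b. b \<lhd>\<^sub>N a) (rev T)"
        using snoc.prems by (simp add: successively_append_iff)
    qed (use snoc.prems in \<open>auto simp: rows_def strict_sorted_imp_sorted\<close>)
    then show ?case
      using snoc by (simp add: successively_append_iff sorted_wrt_less_sorted_list_of_set rows_def)
  qed simp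
  then show ?thesis unfolding N_tab_def by simp
qed


section \<open>Insertion as a computation in the stylic monoid\<close>

lemma styl_cong_slide_left:
  assumes "sorted (y # c)" "x < y" "set (x # y # c) \<subseteq> {1..n}"
  shows "styl_cong n (y # c @ [x]) (y # x # c)"
  using assms
proof (induction c arbitrary: y)
  case Nil
  then show ?case using word_cong.refl[of "[y, x]" "{1..n}"] by auto
next
  case (Cons z c)
  have "styl_cong n (z # c @ [x]) (z # x # c)" using Cons by auto
  from word_cong_context[OF this, of "[y]" "[]"]
  have "styl_cong n (y # z # c @ [x]) (y # z # x # c)" using Cons.prems by simp
  moreover have "([y, z, x], [y, x, z]) \<in> styl_rels n"
    using Cons.prems unfolding styl_rels_def by auto
  from word_cong.base[OF this, of "[]" "{1..n}" c]
  have "styl_cong n (y # z # x # c) (y # x # z # c)" using Cons.prems by auto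
  ultimately show ?case using word_cong.trans by fastforce
qed

text \<open>A letter \<open>b\<close> of \<open>a\<close> next to \<open>y\<close> lets
  \<open>y\<close> pass because the letter \<open>x\<close> behind them satisfies
  \<open>b \<le> x < y\<close>.\<close>

lemma styl_cong_bump_left:
  assumes "sorted (a @ [x])" "x < y" "set (y # x # a) \<subseteq> {1..n}"
  shows "styl_cong n (a @ [y, x]) (y # a @ [x])"
  using assms
proof (induction a arbitrary: x rule: rev_induct)
  case Nil
  then show ?case using word_cong.refl[of "[y, x]" "{1..n}"] by auto
next
  case (snoc b a)
  have b: "b \<le> x" "sorted (a @ [b])" using snoc.prems by (auto simp: sorted_append)
  have "([y, b, x], [b, y, x]) \<in> styl_rels n"
    using snoc.prems b unfolding styl_rels_def by auto
  from word_cong.sym[OF word_cong.base[OF this, of a "{1..n}" "[]"]]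
  have "styl_cong n (a @ [b, y, x]) (a @ [y, b, x])" using snoc.prems by auto
  moreover have "styl_cong n (a @ [y, b]) (y # a @ [b])" using snoc b by auto
  from word_cong_context[OF this, of "[]" "[x]"]
  have "styl_cong n (a @ [y, b, x]) (y # a @ [b, x])" using snoc.prems by auto
  ultimately show ?case using word_cong.trans by fastforce
qed

lemma styl_cong_dup:
  assumes "x \<in> {1..n}" "a \<in> lists {1..n}" "b \<in> lists {1..n}"
  shows "styl_cong n (a @ x # x # b) (a @ x # b)"
proof -
  have "([x, x], [x]) \<in> styl_rels n" using assms unfolding styl_rels_def by blast
  from word_cong.base[OF this assms(2,3)] show ?thesis by simp
qed

text \<open>The chain \<open>y a x\<close>, \<open>a y x\<close>, \<open>a y y x\<close>,
  \<open>a y x y\<close>, \<open>y a x y\<close> of congruent words accounts for the bumped letter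
  that also stays in its row.\<close>

lemma styl_cong_keep:
  assumes "sorted (a @ [x])" "x < y" "set (y # x # a) \<subseteq> {1..n}"
  shows "styl_cong n (y # a @ [x]) (y # a @ [x, y])"
proof -
  note 1 = styl_cong_bump_left[OF assms]
  have "([y, y, x], [y, x, y]) \<in> styl_rels n"
    using assms unfolding styl_rels_def by auto
  from word_cong.base[OF this, of a "{1..n}" "[]"]
  have 2: "styl_cong n (a @ [y, y, x]) (a @ [y, x, y])" using assms by auto
  have 3: "styl_cong n (a @ [y, y, x]) (a @ [y, x])"
    using styl_cong_dup[of y n a "[x]"] assms by auto
  have 4: "styl_cong n (a @ [y, x, y]) (y # a @ [x, y])"
    using word_cong_context[OF 1, of "[]" "[y]"] assms by auto
  show ?thesis
    using word_cong.trans[OF word_cong.sym[OF 1] word_cong.trans[OF word_cong.sym[OF 3]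
          word_cong.trans[OF 2 4]]] .
qed

lemma styl_cong_insert:
  assumes "sorted_wrt (<) u" "set u \<subseteq> {1..n}" "x \<in> {1..n}"
  shows "styl_cong n (u @ [x]) ((case nxt (set u) x of None \<Rightarrow> [] | Some y \<Rightarrow> [y])
    @ sorted_list_of_set (insert x (set u)))"
proof -
  \<comment> \<open>The row splits into letters below, equal to and above \<open>x\<close>. In
    \<open>u @ [x]\<close> the letter \<open>x\<close> slides left until it stands behind the least
    larger letter \<open>y\<close>, then \<open>y\<close> moves to the front, a double
    \<open>x\<close> is merged, and a copy of \<open>y\<close> is restored.\<close>
  define a where "a = filter (\<lambda>y. y < x) u"
  define b where "b = filter (\<lambda>y. y = x) u"
  define c where "c = filter (\<lambda>y. x < y) u"
  have su: "sorted u" "distinct u" using assms(1) by (auto simp: strict_sorted_iff)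
  have abc: "sorted_wrt (<) (a @ b @ c)"
    using assms(1) unfolding a_def b_def c_def
    by (auto simp: sorted_wrt_append intro: sorted_wrt_filter)
  have u: "u = a @ b @ c"
  proof (rule sorted_distinct_set_unique)
    show "set u = set (a @ b @ c)" unfolding a_def b_def c_def by auto
  qed (use abc su in \<open>auto simp: strict_sorted_iff\<close>)
  have "\<forall>y\<in>set b. y = x" "distinct b" using su unfolding b_def by auto
  then have bd: "b = [] \<or> b = [x]" by (cases b rule: remdups_adj.cases) auto
  have row: "sorted_list_of_set (insert x (set u)) = a @ x # c"
  proof -
    have "sorted_wrt (<) a" "sorted_wrt (<) c" using abc by (simp_all add: sorted_wrt_append)
    moreover have "\<forall>y\<in>set a. y < x" "\<forall>y\<in>set c. x < y" unfolding a_def c_def by auto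
    ultimately have "sorted_wrt (<) (a @ x # c)"
      by (auto simp: sorted_wrt_append dest: order.strict_trans)
    moreover have "insert x (set u) = set (a @ x # c)" unfolding a_def c_def by auto
    ultimately show ?thesis by (metis sorted_wrt_less_sorted_list_of_set)
  qed
  have l: "set a \<subseteq> {1..n}" "set c \<subseteq> {1..n}" "a \<in> lists {1..n}" "c \<in> lists {1..n}"
    using assms(2) unfolding a_def c_def by auto
  have sax: "sorted (a @ [x])" using su unfolding a_def by (auto simp: sorted_append intro: sorted_wrt_filter)
  have dup: "styl_cong n (a @ b @ [x] @ c) (a @ x # c)"
    using styl_cong_dup[OF assms(3) l(3,4)] word_cong.refl[of "a @ x # c" "{1..n}"] bd l assms(3)
    by (elim disjE) simp_all
  show ?thesis
  proof (cases c)
    case Nil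
    then have "nxt (set u) x = None" unfolding nxt_None_iff c_def by (auto simp: filter_empty_conv)
    then show ?thesis using dup Nil unfolding row by (simp add: u)
  next
    case (Cons y c')
    have "y \<in> set c" using Cons by simp
    then have "x < y" "y \<in> set u" unfolding c_def by auto
    moreover have "sorted_wrt (<) (y # c')" using abc Cons by (simp add: sorted_wrt_append)
    then have "sorted (y # c')" by (rule strict_sorted_imp_sorted)
    moreover from this have "\<forall>z\<in>set c. y \<le> z" using Cons by auto
    ultimately have y: "x < y" "y \<in> set u" "\<forall>z\<in>set c. y \<le> z" "sorted (y # c')" by blast+
    have nx: "nxt (set u) x = Some y"
      using y unfolding nxt_Some_iff[OF finite_set] c_def by auto
    have sub: "set (x # y # c') \<subseteq> {1..n}" "set (y # x # a) \<subseteq> {1..n}" using l assms Cons by auto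
    have lc: "c' \<in> lists {1..n}" "y # a \<in> lists {1..n}" using l Cons sub by auto
    have lb: "b \<in> lists {1..n}" using bd assms(3) by (elim disjE) simp_all
    have "styl_cong n (a @ b @ (y # c' @ [x])) (a @ b @ (y # x # c'))"
      using word_cong_context[OF styl_cong_slide_left[OF y(4,1) sub(1)], of "a @ b" "[]"] l lb by simp
    moreover have "styl_cong n ((a @ b) @ y # x # c') (y # a @ b @ [x] @ c')"
    proof -
      have "sorted ((a @ b) @ [x])" "set (y # x # (a @ b)) \<subseteq> {1..n}"
        using sax sub bd by (elim disjE; simp add: sorted_append)+
      from word_cong_context[OF styl_cong_bump_left[OF this(1) y(1) this(2)], of "[]" c'] lc
      show ?thesis by simp
    qed
    moreover have "styl_cong n (y # a @ b @ [x] @ c') (y # a @ x # c')"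
      using styl_cong_dup[of x n "y # a" c'] word_cong.refl[of "y # a @ x # c'" "{1..n}"] bd lc assms(3)
      by (elim disjE) simp_all
    moreover have "styl_cong n (y # a @ x # c') (y # a @ [x, y] @ c')"
      using word_cong_context[OF styl_cong_keep[OF sax y(1) sub(2)], of "[]" c'] lc by simp
    ultimately have "styl_cong n (a @ b @ y # c' @ [x]) (y # a @ [x, y] @ c')"
      by (metis append.assoc word_cong.trans)
    then show ?thesis unfolding row nx by (simp add: u Cons)
  qed
qed

lemma styl_cong_insert_rows:
  assumes "\<forall>u\<in>set R. sorted_wrt (<) u \<and> set u \<subseteq> {1..n}" "x \<in> {1..n}"
  shows "styl_cong n (concat (rev R) @ [x]) (concat (rev (insert_rows x R)))"
  using assms
proof (induction R arbitrary: x)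
  case Nil
  then show ?case by (auto intro: word_cong.refl)
next
  case (Cons u us)
  have l: "concat (rev us) \<in> lists {1..n}" using Cons.prems by fastforce
  let ?r = "sorted_list_of_set (insert x (set u))"
  have r: "?r \<in> lists {1..n}"
    using Cons.prems set_sorted_list_of_set[of "insert x (set u)"] by auto
  have 1: "styl_cong n (concat (rev us) @ u @ [x]) (concat (rev us) @
    (case nxt (set u) x of None \<Rightarrow> [] | Some y \<Rightarrow> [y]) @ ?r)"
    using word_cong_context[OF styl_cong_insert[of u n x] l lists.Nil] Cons.prems by simp
  show ?case
  proof (cases "nxt (set u) x")
    case None
    then show ?thesis using 1 by (simp add: insert_rows_Cons del: insert_rows.simps)
  next
    case (Some y)
    then have "y \<in> {1..n}" using Cons.prems by (auto simp: nxt_Some_iff)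
    then have "styl_cong n (concat (rev us) @ [y]) (concat (rev (insert_rows y us)))"
      using Cons by auto
    from word_cong_context[OF this lists.Nil r]
    have "styl_cong n (concat (rev us) @ y # ?r) (concat (rev (insert_rows y us)) @ ?r)" by simp
    with 1 Some have "styl_cong n (concat (rev us) @ u @ [x]) (concat (rev (insert_rows y us)) @ ?r)"
      using word_cong.trans by fastforce
    then show ?thesis using Some by (simp add: insert_rows_Cons del: insert_rows.simps)
  qed
qed

lemma insert_rows_rows:
  assumes "set R \<subseteq> rows n" "x \<in> {1..n}"
  shows "set (insert_rows x R) \<subseteq> rows n"
  using assms
proof (induction R arbitrary: x)
  case Nil
  then show ?case by (auto simp: rows_def)
next
  case (Cons u us)
  let ?r = "sorted_list_of_set (insert x (set u))"
  have "set ?r = insert x (set u)" "sorted_wrt (<) ?r"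
    by (rule set_sorted_list_of_set, simp, rule strict_sorted_list_of_set)
  moreover have "set u \<subseteq> {1..n}" using Cons.prems by (auto simp: rows_def)
  moreover from calculation have "?r \<noteq> []" by auto
  ultimately have "?r \<in> rows n"
    using Cons.prems(2) unfolding rows_def mem_Collect_eq by (metis insert_subset)
  moreover have "y \<in> {1..n}" if "nxt (set u) x = Some y" for y
    using that \<open>set u \<subseteq> {1..n}\<close> by (auto simp: nxt_Some_iff)
  ultimately show ?case using Cons
    by (auto simp: insert_rows_Cons simp del: insert_rows.simps sorted_list_of_set_insert_remove
        split: option.splits)
qed

lemma N_tab_rows: "w \<in> lists {1..n} \<Longrightarrow> N_tab w \<in> lists (rows n)"
proof (induction w rule: rev_induct)
  case (snoc x w)
  then have "set (rev (N_tab w)) \<subseteq> rows n" "x \<in> {1..n}" by auto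
  from insert_rows_rows[OF this] show ?case by (auto simp: N_tab_def)
qed (simp add: N_tab_def)

lemma rows_concat: "w \<in> lists (rows n) \<Longrightarrow> concat w \<in> lists {1..n}"
  by (fastforce simp: rows_def)

text \<open>Together with \<open>styl_cong_N_tab\<close> this makes tableaux a cross-section of the
  congruence; it also makes each row cell valid in the stylic monoid.\<close>

lemma styl_cong_concat_N_tab:
  "w \<in> lists {1..n} \<Longrightarrow> styl_cong n w (concat (N_tab w))"
proof (induction w rule: rev_induct)
  case Nil
  then show ?case by (auto simp: N_tab_def intro: word_cong.refl)
next
  case (snoc x w)
  then have "styl_cong n (w @ [x]) (concat (N_tab w) @ [x])"
    using word_cong_context[of _ _ w "concat (N_tab w)" "[]" "[x]"] by auto
  moreover have "styl_cong n (concat (N_tab w) @ [x]) (concat (N_tab (w @ [x])))"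
    using styl_cong_insert_rows[of "rev (N_tab w)" n x] N_tab_rows[of w n] snoc.prems
    by (auto simp: N_tab_def rows_def)
  ultimately show ?case by (rule word_cong.trans)
qed

section \<open>Termination\<close>

text \<open>
  A step that keeps the number of rows decreases the following weight for the least letter
  \<open>y\<close> whose positions change: it can only add \<open>y\<close> to rows containing a smaller letter, and
  among the other rows it moves occurrences of \<open>y\<close> to the right or merges them.
\<close>

definition letter_cost :: "nat \<Rightarrow> nat set \<Rightarrow> nat \<Rightarrow> nat" where
  "letter_cost y U k =
    (if \<exists>z\<in>U. z < y then (if y \<in> U then 0 else 1) else (if y \<in> U then k else 0))"

fun letter_weight :: "nat \<Rightarrow> row list \<Rightarrow> nat" where
  "letter_weight y [] = 0"
| "letter_weight y (u # w) = letter_cost y (set u) (Suc (length w)) + letter_weight y w"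

text \<open>The length comes first and settles the steps that merge two rows into one. All lists
  compared have length \<open>n + 2\<close>, so \<open>lex\<close> decides at the first differing
  entry.\<close>

definition row_order :: "nat \<Rightarrow> (row list \<times> row list) set" where
  "row_order n =
    inv_image (lex less_than) (\<lambda>w. length w # map (\<lambda>y. letter_weight y w) [0..<Suc n])"

lemma wf_row_order: "wf (row_order n)"
  unfolding row_order_def by (intro wf_inv_image wf_lex wf_less_than)

lemma letter_cost_cong:
  assumes "\<And>z. z \<le> y \<Longrightarrow> z \<in> A \<longleftrightarrow> z \<in> B"
  shows "letter_cost y A k = letter_cost y B k"
proof -
  have "(\<exists>z\<in>A. z < y) \<longleftrightarrow> (\<exists>z\<in>B. z < y)" using assms by (meson less_imp_le)
  then show ?thesis using assms by (simp add: letter_cost_def)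
qed

lemma letter_weight_append_eq:
  "length w = length w' \<Longrightarrow> letter_weight y w = letter_weight y w'
    \<Longrightarrow> letter_weight y (x @ w) = letter_weight y (x @ w')"
  by (induction x) auto

lemma letter_weight_append_less:
  "length w = length w' \<Longrightarrow> letter_weight y w < letter_weight y w'
    \<Longrightarrow> letter_weight y (x @ w) < letter_weight y (x @ w')"
  by (induction x) auto

lemma lex_less_than_nth:
  assumes "length xs = length ys" "j < length xs" "\<And>i. i < j \<Longrightarrow> xs ! i = ys ! i" "xs ! j < ys ! j"
  shows "(xs, ys) \<in> lex less_than"
proof -
  have "take j xs = take j ys" using assms by (intro nth_take_lemma) auto
  moreover have "xs = take j xs @ xs ! j # drop (Suc j) xs" "ys = take j ys @ ys ! j # drop (Suc j) ys"
    using assms by (auto simp: id_take_nth_drop[symmetric])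
  ultimately show ?thesis
    unfolding lex_conv using assms by (metis (mono_tags, lifting) case_prodI less_than_iff mem_Collect_eq)
qed

lemma bump_subset: "bump u v \<subseteq> set u"
  unfolding bump_def by (auto simp: nxt_Some_iff)

lemma finite_bump [simp]: "finite (bump u v)"
  using finite_subset[OF bump_subset] by simp

lemma row_order_step:
  assumes u: "u \<in> rows n" and v: "v \<in> rows n" and uv: "\<not> u \<lhd>\<^sub>N v"
  shows "(x @ N_tab (u @ v) @ y, x @ [u, v] @ y) \<in> row_order n"
proof (cases "bump u v = {}")
  case True
  then have "N_tab (u @ v) = [sorted_list_of_set (set u \<union> set v)]"
    using N_tab_two_rows[of u v] u v by (simp add: rows_def)
  then show ?thesis unfolding row_order_def by simp
next
  case False
  let ?U = "set u" and ?V = "set v" and ?B = "bump u v"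
  let ?p = "sorted_list_of_set ?B" and ?q = "sorted_list_of_set (?U \<union> ?V)"
  have N: "N_tab (u @ v) = [?p, ?q]"
    using N_tab_two_rows[of u v] u v False by (simp add: rows_def)
  define D where "D y \<longleftrightarrow> (y \<in> ?B) \<noteq> (y \<in> ?U) \<or> (y \<in> ?U \<union> ?V) \<noteq> (y \<in> ?V)" for y
  \<comment> \<open>If neither row changed, the minimum of \<open>u\<close> would be bumped by a
    smaller letter of \<open>v\<close>, and \<open>u\<close> would be contained in \<open>v\<close>,
    giving \<open>u \<lhd>\<^sub>N v\<close>.\<close>
  have "\<exists>y. D y"
  proof (rule ccontr)
    assume "\<nexists>y. D y"
    then have *: "?B = ?U" "?U \<subseteq> ?V" unfolding D_def by auto
    have "?U \<noteq> {}" using u by (simp add: rows_def)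
    then have "Min ?U \<in> ?B" using * by simp
    then obtain z where "z \<in> ?V" "z < Min ?U"
      unfolding bump_def by (auto simp: nxt_Some_iff)
    then have "Min ?V < Min ?U" by (meson Min_le finite_set le_less_trans)
    then show False using uv * unfolding tri_def by blast
  qed
  define d where "d = (LEAST y. D y)"
  have d: "D d" and less: "\<And>z. z < d \<Longrightarrow> \<not> D z"
    using LeastI_ex[OF \<open>\<exists>y. D y\<close>] not_less_Least unfolding d_def by auto
  have "d \<in> ?U \<union> ?V" using d bump_subset unfolding D_def by blast
  then have dn: "d < Suc n" using u v unfolding rows_def by force
  have low: "z \<in> ?B \<longleftrightarrow> z \<in> ?U" "z \<in> ?U \<union> ?V \<longleftrightarrow> z \<in> ?V" if "z < d" for z
    using less[OF that] unfolding D_def by auto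
  have eq: "letter_weight z ([?p, ?q] @ y) = letter_weight z ([u, v] @ y)" if "z < d" for z
  proof -
    have "letter_cost z ?B k = letter_cost z ?U k" "letter_cost z (?U \<union> ?V) k = letter_cost z ?V k" for k
      by (rule letter_cost_cong, use low that le_less_trans in blast)+
    then show ?thesis by simp
  qed
  have lt: "letter_weight d ([?p, ?q] @ y) < letter_weight d ([u, v] @ y)"
  \<comment> \<open>If \<open>v\<close> has a letter below \<open>d\<close>, the first row keeps or
    lacks \<open>d\<close> as before, so the change is that \<open>d\<close> enters the second row,
    whose cost drops from 1 to 0. Otherwise \<open>d\<close> cannot be bumped and leaves the first
    row, whose positional cost exceeds the one that the second row can gain.\<close>
  proof (cases "\<exists>z\<in>?V. z < d")
    case True
    have "d \<in> ?B" if dU: "d \<in> ?U"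
    proof (cases "\<exists>z\<in>?U. z < d")
      case True
      define m where "m = Max {z \<in> ?U. z < d}"
      have "m \<in> {z \<in> ?U. z < d}" unfolding m_def using True by (intro Max_in) auto
      then have m: "m \<in> ?U" "m < d" by auto
      have "z \<le> m" if "z \<in> ?U" "z < d" for z unfolding m_def using that by (intro Max_ge) auto
      then have "nxt ?U m = Some d" using m dU by (auto simp: nxt_Some_iff not_less[symmetric])
      moreover have "m \<in> ?V" using low(2)[OF m(2)] m(1) by blast
      ultimately show ?thesis unfolding bump_def by blast
    next
      case False
      obtain z where z: "z \<in> ?V" "z < d" using True by blast
      have "nxt ?U z = Some d" using z False dU by (auto simp: nxt_Some_iff not_less[symmetric])
      then show ?thesis using z unfolding bump_def by blast
    qed
    then have B: "d \<in> ?B \<longleftrightarrow> d \<in> ?U" using bump_subset by blast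
    then have "d \<in> ?U" "d \<notin> ?V" using d unfolding D_def by auto
    moreover have "letter_cost d ?B k = letter_cost d ?U k" for k
      using low B by (intro letter_cost_cong) (metis le_neq_implies_less)
    moreover have "letter_cost d ?V k = 1" "letter_cost d (?U \<union> ?V) k = 0" for k
      unfolding letter_cost_def using True \<open>d \<in> ?U\<close> \<open>d \<notin> ?V\<close> by auto
    ultimately show ?thesis by simp
  next
    case False
    have "d \<notin> ?B" using False unfolding bump_def by (auto simp: nxt_Some_iff)
    then have "d \<in> ?U" using d unfolding D_def by blast
    have "\<not> (\<exists>z\<in>?U. z < d)" using False low(2) by blast
    moreover from this have "\<not> (\<exists>z\<in>?B. z < d)" using bump_subset by blast
    ultimately show ?thesis
      using False \<open>d \<in> ?U\<close> \<open>d \<notin> ?B\<close> by (auto simp: letter_cost_def)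
  qed
  have "(length (x @ [?p, ?q] @ y) # map (\<lambda>z. letter_weight z (x @ [?p, ?q] @ y)) [0..<Suc n],
     length (x @ [u, v] @ y) # map (\<lambda>z. letter_weight z (x @ [u, v] @ y)) [0..<Suc n])
    \<in> lex less_than" (is "(?xs, ?ys) \<in> _")
  \<comment> \<open>The weight of \<open>d\<close> sits at index \<open>Suc d\<close>, since the
    length occupies index 0.\<close>
  proof (rule lex_less_than_nth[where j = "Suc d"])
    show "?xs ! i = ?ys ! i" if "i < Suc d" for i
      using that dn letter_weight_append_eq[OF _ eq] by (cases i) (auto simp del: upt_Suc append.simps)
    show "?xs ! Suc d < ?ys ! Suc d"
      using dn letter_weight_append_less[OF _ lt] by (auto simp del: upt_Suc append.simps)
  qed (use dn in auto)
  then show ?thesis unfolding row_order_def N by simp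
qed

section \<open>Leftmost normalization\<close>

abbreviation tableau :: "row list \<Rightarrow> bool" where
  "tableau \<equiv> successively (\<lhd>\<^sub>N)"

fun src_step :: "row_step \<Rightarrow> row list" where
  "src_step (x, (u, v), y) = x @ [u, v] @ y"

fun is_redex :: "row_step \<Rightarrow> bool" where
  "is_redex (x, (u, v), y) \<longleftrightarrow> \<not> u \<lhd>\<^sub>N v"

fun row_path :: "nat \<Rightarrow> row list \<Rightarrow> row_step list \<Rightarrow> row list \<Rightarrow> bool" where
  "row_path n w [] w' \<longleftrightarrow> w \<in> lists (rows n) \<and> w = w'"
| "row_path n w (s # p) w' \<longleftrightarrow>
    w \<in> lists (rows n) \<and> src_step s = w \<and> is_redex s \<and> row_path n (step_target s) p w'"

fun wh_step :: "row list \<Rightarrow> row list \<Rightarrow> row_step \<Rightarrow> row_step" where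
  "wh_step a b (x, g, y) = (a @ x, g, y @ b)"

abbreviation whisker :: "row list \<Rightarrow> row_step list \<Rightarrow> row list \<Rightarrow> row_step list" where
  "whisker a p b \<equiv> map (wh_step a b) p"

lemma src_wh_step [simp]: "src_step (wh_step a b s) = a @ src_step s @ b"
  by (cases s rule: src_step.cases) simp

lemma tgt_wh_step [simp]: "step_target (wh_step a b s) = a @ step_target s @ b"
  by (cases s rule: src_step.cases) simp

lemma redex_wh_step [simp]: "is_redex (wh_step a b s) = is_redex s"
  by (cases s rule: src_step.cases) simp

lemma wh_step_Nil [simp]: "wh_step [] [] s = s"
  by (cases s rule: src_step.cases) simp

lemma row_path_lists: "row_path n w p w' \<Longrightarrow> w \<in> lists (rows n) \<and> w' \<in> lists (rows n)"
  by (induction p arbitrary: w) auto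

lemma row_path_append:
  "row_path n w (p @ q) w'' \<longleftrightarrow> (\<exists>w'. row_path n w p w' \<and> row_path n w' q w'')"
  by (induction p arbitrary: w) (auto dest: row_path_lists)

lemma row_path_whisker:
  "row_path n w p w' \<Longrightarrow> a \<in> lists (rows n) \<Longrightarrow> b \<in> lists (rows n)
    \<Longrightarrow> row_path n (a @ w @ b) (whisker a p b) (a @ w' @ b)"
  by (induction p arbitrary: w) auto

lemma row_path_unique: "row_path n w p w' \<Longrightarrow> row_path n w p w'' \<Longrightarrow> w' = w''"
  by (induction p arbitrary: w) auto

lemma N_tab_lists: "u \<in> rows n \<Longrightarrow> v \<in> rows n \<Longrightarrow> N_tab (u @ v) \<in> lists (rows n)"
  by (rule N_tab_rows) (auto simp: rows_def)

lemma step_target_lists: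
  "src_step s \<in> lists (rows n) \<Longrightarrow> step_target s \<in> lists (rows n)"
  using N_tab_lists by (cases s rule: src_step.cases) fastforce

lemma row_order_step_target:
  "src_step s \<in> lists (rows n) \<Longrightarrow> is_redex s \<Longrightarrow> (step_target s, src_step s) \<in> row_order n"
  by (cases s rule: src_step.cases) (use row_order_step in auto)

definition nf :: "row list \<Rightarrow> row list" where
  "nf w = N_tab (concat w)"

lemma styl_cong_concat_step:
  assumes "src_step s \<in> lists (rows n)"
  shows "styl_cong n (concat (src_step s)) (concat (step_target s))"
proof (cases s rule: src_step.cases)
  case (1 x u v y)
  then have l: "concat x \<in> lists {1..n}" "concat y \<in> lists {1..n}" "u @ v \<in> lists {1..n}"
    using assms rows_concat[of x n] rows_concat[of y n] rows_concat[of "[u, v]" n] by auto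
  show ?thesis
    using word_cong_context[OF styl_cong_concat_N_tab[OF l(3)] l(1,2)] 1 by simp
qed

lemma nf_step_target: "src_step s \<in> lists (rows n) \<Longrightarrow> nf (step_target s) = nf (src_step s)"
  unfolding nf_def using styl_cong_N_tab[OF styl_cong_concat_step] by metis

lemma nf_row_path: "row_path n w p w' \<Longrightarrow> nf w' = nf w"
proof (induction p arbitrary: w)
  case (Cons s p)
  then show ?case using nf_step_target[of s n] by (metis row_path.simps(2))
qed simp

lemma leftmost_step_None_iff: "leftmost_step w = None \<longleftrightarrow> tableau w"
  by (induction w rule: leftmost_step.induct) auto

lemma leftmost_step_Some_iff:
  "leftmost_step w = Some (x, (u, v), y) \<longleftrightarrow>
    w = x @ [u, v] @ y \<and> \<not> u \<lhd>\<^sub>N v \<and> tableau (x @ [u])"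
proof (induction w arbitrary: x rule: leftmost_step.induct)
  case (1 a b w)
  show ?case
  proof (cases "a \<lhd>\<^sub>N b")
    case True
    then show ?thesis using 1 by (cases x; cases "tl x") (auto simp: successively_Cons)
  next
    case False
    then show ?thesis by (cases x; cases "tl x") (auto simp: successively_Cons)
  qed
qed (auto simp: Cons_eq_append_conv)

lemma leftmost_step_Some:
  assumes "leftmost_step w = Some s"
  shows "src_step s = w" "is_redex s"
  using assms by (cases s rule: src_step.cases; simp add: leftmost_step_Some_iff)+

lemma leftmost_step_append:
  "leftmost_step w = Some s \<Longrightarrow> leftmost_step (w @ y) = Some (wh_step [] y s)"
  by (cases s rule: src_step.cases) (auto simp: leftmost_step_Some_iff)

lemma Lambda_path_dom: "w \<in> lists (rows n) \<Longrightarrow> Lambda_path_dom w"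
proof (induction w rule: wf_induct_rule[OF wf_row_order[of n]])
  case (1 w)
  show ?case
  proof (rule Lambda_path.domintros)
    fix x u v y assume "leftmost_step w = Some (x, (u, v), y)" (is "_ = Some ?s")
    then have "src_step ?s = w" "is_redex ?s" by (rule leftmost_step_Some)+
    then show "Lambda_path_dom (x @ N_tab (u @ v) @ y)"
      using 1 row_order_step_target[of ?s n] step_target_lists[of ?s n] by simp
  qed
qed

lemma Lambda_path_simp:
  "w \<in> lists (rows n) \<Longrightarrow> Lambda_path w =
    (case leftmost_step w of None \<Rightarrow> [] | Some s \<Rightarrow> s # Lambda_path (step_target s))"
  using Lambda_path.psimps[OF Lambda_path_dom] .

lemma Lambda_path_None: "w \<in> lists (rows n) \<Longrightarrow> tableau w \<Longrightarrow> Lambda_path w = []"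
  by (simp add: Lambda_path_simp flip: leftmost_step_None_iff)

lemma Lambda_path_Some:
  "w \<in> lists (rows n) \<Longrightarrow> leftmost_step w = Some s \<Longrightarrow> Lambda_path w = s # Lambda_path (step_target s)"
  by (simp add: Lambda_path_simp)

lemma nf_tableau: "w \<in> lists (rows n) \<Longrightarrow> tableau w \<Longrightarrow> nf w = w"
  unfolding nf_def by (rule N_tab_concat)

text \<open>The path can stop only at a tableau, which is its own \<open>nf\<close>, and
  \<open>nf\<close> is invariant along steps. This is where termination and the insertion invariant
  combine into convergence.\<close>

lemma row_path_Lambda:
  "w \<in> lists (rows n) \<Longrightarrow> row_path n w (Lambda_path w) (nf w)"
proof (induction w rule: wf_induct_rule[OF wf_row_order[of n]])
  case (1 w)
  show ?case
  proof (cases "leftmost_step w")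
    case None
    then have "tableau w" by (simp add: leftmost_step_None_iff)
    then show ?thesis using 1 Lambda_path_None nf_tableau by auto
  next
    case (Some s)
    note s = leftmost_step_Some[OF Some]
    then have "row_path n (step_target s) (Lambda_path (step_target s)) (nf (step_target s))"
      using 1 row_order_step_target[of s n] step_target_lists[of s n] by auto
    then show ?thesis
      using Lambda_path_Some[OF 1(2) Some] s 1(2) nf_step_target[of s n] by auto
  qed
qed

lemma nf_lists: "w \<in> lists (rows n) \<Longrightarrow> nf w \<in> lists (rows n)"
  using row_path_Lambda row_path_lists by blast

text \<open>The leftmost strategy does not touch \<open>y\<close> before \<open>w\<close> has become
  a tableau.\<close>

lemma Lambda_path_append:
  assumes "w \<in> lists (rows n)" "y \<in> lists (rows n)"
  shows "Lambda_path (w @ y) = whisker [] (Lambda_path w) y @ Lambda_path (nf w @ y)"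
  using assms(1)
proof (induction w rule: wf_induct_rule[OF wf_row_order[of n]])
  case (1 w)
  show ?case
  proof (cases "leftmost_step w")
    case None
    then have "tableau w" by (simp add: leftmost_step_None_iff)
    then show ?thesis using 1 Lambda_path_None nf_tableau by auto
  next
    case (Some s)
    note s = leftmost_step_Some[OF Some]
    then have "Lambda_path (step_target s @ y) =
      whisker [] (Lambda_path (step_target s)) y @ Lambda_path (nf (step_target s) @ y)"
      using 1 row_order_step_target[of s n] step_target_lists[of s n] by auto
    then show ?thesis
      using Lambda_path_Some[OF 1(2) Some] s 1(2) nf_step_target[of s n] assms(2)
        Lambda_path_Some[OF _ leftmost_step_append[OF Some], of y n] by auto
  qed
qed

section \<open>Paths of row cells\<close>

declare eq2.trans [trans]

lemma eq2_comp0_left: "eq2 P f f' \<Longrightarrow> is_cell2 P g u v \<Longrightarrow> eq2 P (f \<star>\<^sub>0 g) (f' \<star>\<^sub>0 g)"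
  by (rule eq2.cong0[OF _ eq2.refl])

lemma eq2_comp0_right: "eq2 P g g' \<Longrightarrow> is_cell2 P f u v \<Longrightarrow> eq2 P (f \<star>\<^sub>0 g) (f \<star>\<^sub>0 g')"
  by (rule eq2.cong0[OF eq2.refl])

lemma eq2_whisker_right:
  assumes "is_cell2 P f u v" "is_cell2 P g v w" "b \<in> lists (cells1 P)"
  shows "eq2 P ((f \<star>\<^sub>1 g) \<star>\<^sub>0 Id2 b) ((f \<star>\<^sub>0 Id2 b) \<star>\<^sub>1 (g \<star>\<^sub>0 Id2 b))"
proof -
  note b = is_cell2.id[OF assms(3)]
  have "eq2 P ((f \<star>\<^sub>1 g) \<star>\<^sub>0 Id2 b) ((f \<star>\<^sub>1 g) \<star>\<^sub>0 (Id2 b \<star>\<^sub>1 Id2 b))"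
    by (rule eq2_comp0_right[OF eq2.sym[OF eq2.unit1_left[OF b]] is_cell2.comp1[OF assms(1,2)]])
  also have "eq2 P \<dots> ((f \<star>\<^sub>0 Id2 b) \<star>\<^sub>1 (g \<star>\<^sub>0 Id2 b))"
    by (rule eq2.exchange[OF assms(1,2) b b])
  finally show ?thesis .
qed

lemma eq2_whisker_left:
  assumes "is_cell2 P f u v" "is_cell2 P g v w" "a \<in> lists (cells1 P)"
  shows "eq2 P (Id2 a \<star>\<^sub>0 (f \<star>\<^sub>1 g)) ((Id2 a \<star>\<^sub>0 f) \<star>\<^sub>1 (Id2 a \<star>\<^sub>0 g))"
proof -
  note a = is_cell2.id[OF assms(3)]
  have "eq2 P (Id2 a \<star>\<^sub>0 (f \<star>\<^sub>1 g)) ((Id2 a \<star>\<^sub>1 Id2 a) \<star>\<^sub>0 (f \<star>\<^sub>1 g))"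
    by (rule eq2_comp0_left[OF eq2.sym[OF eq2.unit1_left[OF a]] is_cell2.comp1[OF assms(1,2)]])
  also have "eq2 P \<dots> ((Id2 a \<star>\<^sub>0 f) \<star>\<^sub>1 (Id2 a \<star>\<^sub>0 g))"
    by (rule eq2.exchange[OF a a assms(1,2)])
  finally show ?thesis .
qed

lemma eq2_whisker:
  assumes "is_cell2 P f u v" "is_cell2 P g v w" "a \<in> lists (cells1 P)" "b \<in> lists (cells1 P)"
  shows "eq2 P (Id2 a \<star>\<^sub>0 (f \<star>\<^sub>1 g) \<star>\<^sub>0 Id2 b) ((Id2 a \<star>\<^sub>0 f \<star>\<^sub>0 Id2 b) \<star>\<^sub>1 (Id2 a \<star>\<^sub>0 g \<star>\<^sub>0 Id2 b))"
proof -
  note a = is_cell2.id[OF assms(3)] and b = is_cell2.id[OF assms(4)]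
  have "eq2 P (Id2 a \<star>\<^sub>0 (f \<star>\<^sub>1 g) \<star>\<^sub>0 Id2 b) (Id2 a \<star>\<^sub>0 ((f \<star>\<^sub>0 Id2 b) \<star>\<^sub>1 (g \<star>\<^sub>0 Id2 b)))"
    by (rule eq2_comp0_right[OF eq2_whisker_right[OF assms(1,2,4)] a])
  also have "eq2 P \<dots> ((Id2 a \<star>\<^sub>0 f \<star>\<^sub>0 Id2 b) \<star>\<^sub>1 (Id2 a \<star>\<^sub>0 g \<star>\<^sub>0 Id2 b))"
    by (rule eq2_whisker_left[OF is_cell2.comp0[OF assms(1) b] is_cell2.comp0[OF assms(2) b] assms(3)])
  finally show ?thesis .
qed

text \<open>By exchange with identities, both sides equal
  \<open>f \<star>\<^sub>0 h\<close>.\<close>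

lemma eq2_exchange_steps:
  assumes f: "is_cell2 P f u u'" and h: "is_cell2 P h w w'" and P: "is_polygraph2 P"
  shows "eq2 P ((f \<star>\<^sub>0 Id2 w) \<star>\<^sub>1 (Id2 u' \<star>\<^sub>0 h)) ((Id2 u \<star>\<^sub>0 h) \<star>\<^sub>1 (f \<star>\<^sub>0 Id2 w'))"
proof -
  have l: "u \<in> lists (cells1 P)" "u' \<in> lists (cells1 P)" "w \<in> lists (cells1 P)" "w' \<in> lists (cells1 P)"
    using is_cell2_lists[OF P f] is_cell2_lists[OF P h] by auto
  note i = l[THEN is_cell2.id]
  have "eq2 P ((f \<star>\<^sub>0 Id2 w) \<star>\<^sub>1 (Id2 u' \<star>\<^sub>0 h)) ((f \<star>\<^sub>1 Id2 u') \<star>\<^sub>0 (Id2 w \<star>\<^sub>1 h))"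
    by (rule eq2.sym[OF eq2.exchange[OF f i(2,3) h]])
  also have "eq2 P \<dots> (f \<star>\<^sub>0 h)"
    by (rule eq2.cong0[OF eq2.unit1_right[OF f] eq2.unit1_left[OF h]])
  also have "eq2 P \<dots> ((Id2 u \<star>\<^sub>1 f) \<star>\<^sub>0 (h \<star>\<^sub>1 Id2 w'))"
    by (rule eq2.cong0[OF eq2.sym[OF eq2.unit1_left[OF f]] eq2.sym[OF eq2.unit1_right[OF h]]])
  also have "eq2 P \<dots> ((Id2 u \<star>\<^sub>0 h) \<star>\<^sub>1 (f \<star>\<^sub>0 Id2 w'))"
    by (rule eq2.exchange[OF i(1) f h i(4)])
  finally show ?thesis .
qed

text \<open>The 3-cells are left free, so that one calculus of paths serves both
  \<open>row_scoh\<close> and \<open>row_N\<close>.\<close>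

locale row_cells =
  fixes n :: nat and P :: "(row, row_cell, 'c) polygraph31"
  assumes cells1: "cells1 P = rows n"
    and cells2: "cells2 P = {(u, v). u \<in> rows n \<and> v \<in> rows n \<and> \<not> u \<lhd>\<^sub>N v}"
    and src2: "src2 P = (\<lambda>(u, v). [u, v])"
    and tgt2: "tgt2 P = (\<lambda>(u, v). N_tab (u @ v))"
begin

lemma polygraph2: "is_polygraph2 P"
  unfolding is_polygraph2_def using N_tab_lists by (auto simp: cells1 cells2 src2 tgt2)

lemma is_cell2_gen:
  "u \<in> rows n \<Longrightarrow> v \<in> rows n \<Longrightarrow> \<not> u \<lhd>\<^sub>N v \<Longrightarrow> is_cell2 P (Gen2 (u, v)) [u, v] (N_tab (u @ v))"
  using is_cell2.gen[of "(u, v)" P] by (simp add: cells2 src2 tgt2)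

lemma is_cell2_Id2: "w \<in> lists (rows n) \<Longrightarrow> is_cell2 P (Id2 w) w w"
  using is_cell2.id[of w P] by (simp add: cells1)

lemma is_cell2_step:
  assumes "src_step s \<in> lists (rows n)" "is_redex s"
  shows "is_cell2 P (step_cell s) (src_step s) (step_target s)"
proof (cases s rule: src_step.cases)
  case (1 x u v y)
  then have "x \<in> lists (rows n)" "y \<in> lists (rows n)" "u \<in> rows n" "v \<in> rows n" "\<not> u \<lhd>\<^sub>N v"
    using assms by auto
  then show ?thesis
    using is_cell2.comp0[OF is_cell2_Id2 is_cell2.comp0[OF is_cell2_gen is_cell2_Id2]] 1 by simp
qed

lemma is_cell2_path: "row_path n w p w' \<Longrightarrow> is_cell2 P (path_cell w p) w w'"
proof (induction p arbitrary: w)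
  case Nil
  then show ?case using is_cell2_Id2 by auto
next
  case (Cons s p)
  then have "src_step s = w" "w \<in> lists (rows n)" "is_redex s" "row_path n (step_target s) p w'"
    by (simp_all only: row_path.simps)
  then show ?case using is_cell2.comp1[OF is_cell2_step[of s] Cons.IH[of "step_target s"]] by simp
qed

lemma path_cell_append:
  "row_path n w p w' \<Longrightarrow> row_path n w' q w'' \<Longrightarrow>
    eq2 P (path_cell w (p @ q)) (path_cell w p \<star>\<^sub>1 path_cell w' q)"
proof (induction p arbitrary: w)
  case Nil
  then show ?case using eq2.sym[OF eq2.unit1_left[OF is_cell2_path]] by auto
next
  case (Cons s p)
  then have s: "src_step s \<in> lists (rows n)" "is_redex s" and p: "row_path n (step_target s) p w'"
    by simp_all
  note c = is_cell2_step[OF s] is_cell2_path[OF p] is_cell2_path[OF Cons.prems(2)]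
  have pq: "is_cell2 P (path_cell (step_target s) (p @ q)) (step_target s) w''"
    using is_cell2_path[of "step_target s" "p @ q" w''] p Cons.prems(2) row_path_append by metis
  have "eq2 P (step_cell s \<star>\<^sub>1 path_cell (step_target s) (p @ q))
    (step_cell s \<star>\<^sub>1 (path_cell (step_target s) p \<star>\<^sub>1 path_cell w' q))"
    by (rule eq2.cong1[OF eq2.refl[OF c(1)] Cons.IH[OF p Cons.prems(2)] c(1) pq])
  also have "eq2 P \<dots> ((step_cell s \<star>\<^sub>1 path_cell (step_target s) p) \<star>\<^sub>1 path_cell w' q)"
    by (rule eq2.sym[OF eq2.assoc1[OF c]])
  finally show ?case by simp
qed

lemma step_cell_whisker:
  assumes s: "src_step s \<in> lists (rows n)" "is_redex s" and a: "a \<in> lists (rows n)" and b: "b \<in> lists (rows n)"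
  shows "eq2 P (step_cell (wh_step a b s)) (Id2 a \<star>\<^sub>0 step_cell s \<star>\<^sub>0 Id2 b)"
proof (cases s rule: src_step.cases)
  case (1 x u v y)
  let ?g = "Gen2 (u, v)"
  have l: "x \<in> lists (rows n)" "y \<in> lists (rows n)" using s 1 by auto
  have g: "is_cell2 P ?g [u, v] (N_tab (u @ v))" using s 1 is_cell2_gen by auto
  note i = is_cell2_Id2[OF a] is_cell2_Id2[OF b] is_cell2_Id2[OF l(1)] is_cell2_Id2[OF l(2)]
  have id: "eq2 P (Id2 (w @ w')) (Id2 w \<star>\<^sub>0 Id2 w')"
    if "w \<in> lists (rows n)" "w' \<in> lists (rows n)" for w w'
    using eq2.sym[OF eq2.id_comp0[of w P w']] that by (simp add: cells1)
  have gy: "is_cell2 P (?g \<star>\<^sub>0 Id2 y) ([u, v] @ y) (N_tab (u @ v) @ y)"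
    by (rule is_cell2.comp0[OF g i(4)])
  have "eq2 P (Id2 (a @ x) \<star>\<^sub>0 ?g \<star>\<^sub>0 Id2 (y @ b)) ((Id2 a \<star>\<^sub>0 Id2 x) \<star>\<^sub>0 ?g \<star>\<^sub>0 (Id2 y \<star>\<^sub>0 Id2 b))"
    by (rule eq2.cong0[OF id[OF a l(1)] eq2.cong0[OF eq2.refl[OF g] id[OF l(2) b]]])
  also have "eq2 P \<dots> ((Id2 a \<star>\<^sub>0 Id2 x) \<star>\<^sub>0 ((?g \<star>\<^sub>0 Id2 y) \<star>\<^sub>0 Id2 b))"
    by (rule eq2_comp0_right[OF eq2.sym[OF eq2.assoc0[OF g i(4,2)]] is_cell2.comp0[OF i(1,3)]])
  also have "eq2 P \<dots> (Id2 a \<star>\<^sub>0 Id2 x \<star>\<^sub>0 ((?g \<star>\<^sub>0 Id2 y) \<star>\<^sub>0 Id2 b))"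
    by (rule eq2.assoc0[OF i(1,3) is_cell2.comp0[OF gy i(2)]])
  also have "eq2 P \<dots> (Id2 a \<star>\<^sub>0 (Id2 x \<star>\<^sub>0 ?g \<star>\<^sub>0 Id2 y) \<star>\<^sub>0 Id2 b)"
    by (rule eq2_comp0_right[OF eq2.sym[OF eq2.assoc0[OF i(3) gy i(2)]] i(1)])
  finally show ?thesis using 1 by simp
qed

lemma path_cell_whisker:
  assumes a: "a \<in> lists (rows n)" and b: "b \<in> lists (rows n)"
  shows "row_path n w p w' \<Longrightarrow>
    eq2 P (path_cell (a @ w @ b) (whisker a p b)) (Id2 a \<star>\<^sub>0 path_cell w p \<star>\<^sub>0 Id2 b)"
proof (induction p arbitrary: w)
  case Nil
  then have w: "w \<in> lists (rows n)" "w' = w" by auto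
  have "eq2 P (Id2 (a @ w @ b)) (Id2 a \<star>\<^sub>0 Id2 (w @ b))"
    using a b w by (intro eq2.sym[OF eq2.id_comp0]) (auto simp: cells1)
  also have "eq2 P \<dots> (Id2 a \<star>\<^sub>0 (Id2 w \<star>\<^sub>0 Id2 b))"
    by (rule eq2_comp0_right[OF eq2.sym[OF eq2.id_comp0] is_cell2_Id2[OF a]]) (use b w in \<open>auto simp: cells1\<close>)
  finally show ?case by (simp add: w)
next
  case (Cons s p)
  then have s: "src_step s \<in> lists (rows n)" "is_redex s" and p: "row_path n (step_target s) p w'"
    by simp_all
  have s': "src_step (wh_step a b s) \<in> lists (rows n)" "is_redex (wh_step a b s)"
    using s a b by auto
  have c: "is_cell2 P (path_cell (a @ step_target s @ b) (whisker a p b))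
      (step_target (wh_step a b s)) (a @ w' @ b)"
    using is_cell2_path[OF row_path_whisker[OF p a b]] by simp
  have "eq2 P (step_cell (wh_step a b s) \<star>\<^sub>1 path_cell (a @ step_target s @ b) (whisker a p b))
    ((Id2 a \<star>\<^sub>0 step_cell s \<star>\<^sub>0 Id2 b) \<star>\<^sub>1 (Id2 a \<star>\<^sub>0 path_cell (step_target s) p \<star>\<^sub>0 Id2 b))"
    by (rule eq2.cong1[OF step_cell_whisker[OF s a b] Cons.IH[OF p] is_cell2_step[OF s'] c])
  also have "eq2 P \<dots> (Id2 a \<star>\<^sub>0 (step_cell s \<star>\<^sub>1 path_cell (step_target s) p) \<star>\<^sub>0 Id2 b)"
    by (rule eq2.sym[OF eq2_whisker[OF is_cell2_step[OF s] is_cell2_path[OF p]]])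
      (use a b in \<open>simp_all add: cells1\<close>)
  finally show ?case by simp
qed

text \<open>The common end point is part of the relation, so that composing and whiskering fillings
  become operations on lists of steps.\<close>

definition peq :: "row list \<Rightarrow> row_step list \<Rightarrow> row_step list \<Rightarrow> bool" where
  "peq w p q \<longleftrightarrow> (\<exists>w'. row_path n w p w' \<and> row_path n w q w') \<and> fill2 P (path_cell w p) (path_cell w q)"

lemma peq_refl: "row_path n w p w' \<Longrightarrow> peq w p p"
  unfolding peq_def using fill2_refl[OF is_cell2_path] by blast

lemma peq_sym: "peq w p q \<Longrightarrow> peq w q p"
  unfolding peq_def using fill2_sym by blast

lemma peq_trans [trans]: "peq w p q \<Longrightarrow> peq w q r \<Longrightarrow> peq w p r"
  unfolding peq_def using row_path_unique fill2_trans by metis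

lemma peq_target: "peq w p q \<Longrightarrow> row_path n w p w' \<Longrightarrow> row_path n w q w'"
  unfolding peq_def using row_path_unique by metis

lemma peq_append:
  assumes "peq w p q" "row_path n w p w'" "peq w' r s"
  shows "peq w (p @ r) (q @ s)"
proof -
  have q: "row_path n w q w'" using peq_target assms by blast
  obtain w'' where rs: "row_path n w' r w''" "row_path n w' s w''"
    using assms(3) unfolding peq_def by blast
  have "fill2 P (path_cell w p \<star>\<^sub>1 path_cell w' r) (path_cell w q \<star>\<^sub>1 path_cell w' s)"
    using assms unfolding peq_def
    by (intro fill2_comp1[OF _ _ is_cell2_path[OF assms(2)] is_cell2_path[OF rs(1)]]) auto
  from fill2_trans[OF fill2_eq2[OF polygraph2 path_cell_append[OF assms(2) rs(1)]]
      fill2_trans[OF this fill2_sym[OF fill2_eq2[OF polygraph2 path_cell_append[OF q rs(2)]]]]]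
  show ?thesis unfolding peq_def using q assms(2) rs row_path_append by blast
qed

lemma peq_append_right: "peq w p q \<Longrightarrow> row_path n w p w' \<Longrightarrow> row_path n w' r w'' \<Longrightarrow> peq w (p @ r) (q @ r)"
  by (rule peq_append[OF _ _ peq_refl])

lemma peq_append_left: "row_path n w p w' \<Longrightarrow> peq w' r s \<Longrightarrow> peq w (p @ r) (p @ s)"
  by (rule peq_append[OF peq_refl])

lemma peq_Cons:
  "src_step s \<in> lists (rows n) \<Longrightarrow> is_redex s \<Longrightarrow> peq (step_target s) p q \<Longrightarrow> peq (src_step s) (s # p) (s # q)"
  using peq_append_left[of "src_step s" "[s]" "step_target s" p q] step_target_lists by auto

lemma peq_whisker:
  assumes "peq w p q" "a \<in> lists (rows n)" "b \<in> lists (rows n)"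
  shows "peq (a @ w @ b) (whisker a p b) (whisker a q b)"
proof -
  obtain w' where pq: "row_path n w p w'" "row_path n w q w'"
    using assms(1) unfolding peq_def by blast
  have "fill2 P (Id2 a \<star>\<^sub>0 path_cell w p \<star>\<^sub>0 Id2 b) (Id2 a \<star>\<^sub>0 path_cell w q \<star>\<^sub>0 Id2 b)"
    using assms(1) fill2_refl[OF is_cell2_Id2] assms(2,3) unfolding peq_def
    by (intro fill2_comp0) auto
  from fill2_trans[OF fill2_eq2[OF polygraph2 path_cell_whisker[OF assms(2,3) pq(1)]]
      fill2_trans[OF this fill2_sym[OF fill2_eq2[OF polygraph2 path_cell_whisker[OF assms(2,3) pq(2)]]]]]
  show ?thesis unfolding peq_def using row_path_whisker[OF _ assms(2,3)] pq by blast
qed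

text \<open>Paths are invertible as 2-cells. A confluence at \<open>w'\<close> can thus be deduced
  from one at a longer word \<open>w\<close> that rewrites to \<open>w'\<close>.\<close>

lemma peq_cancel:
  assumes "peq w (a @ p) (a @ q)" "row_path n w a w'"
  shows "peq w' p q"
proof -
  obtain w'' where "row_path n w (a @ p) w''" "row_path n w (a @ q) w''"
    using assms(1) unfolding peq_def by blast
  then have pq: "row_path n w' p w''" "row_path n w' q w''"
    using assms(2) row_path_unique row_path_append by metis+
  have f: "fill2 P (path_cell w (a @ p)) (path_cell w (a @ q))" using assms(1) unfolding peq_def by blast
  from fill2_trans[OF fill2_sym[OF fill2_eq2[OF polygraph2 path_cell_append[OF assms(2) pq(1)]]]
      fill2_trans[OF f fill2_eq2[OF polygraph2 path_cell_append[OF assms(2) pq(2)]]]]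
  have "fill2 P (path_cell w' p) (path_cell w' q)"
    by (rule fill2_cancel_left[OF polygraph2 is_cell2_path[OF assms(2)] is_cell2_path[OF pq(1)] is_cell2_path[OF pq(2)]])
  then show ?thesis unfolding peq_def using pq by blast
qed

text \<open>For empty \<open>x\<close> this is the exchange law up to units; whiskering gives the
  rest.\<close>

lemma peq_exchange:
  assumes l: "x @ [u, v] @ y @ [u', v'] @ z \<in> lists (rows n)" and uv: "\<not> u \<lhd>\<^sub>N v" "\<not> u' \<lhd>\<^sub>N v'"
  shows "peq (x @ [u, v] @ y @ [u', v'] @ z)
    [(x, (u, v), y @ [u', v'] @ z), (x @ N_tab (u @ v) @ y, (u', v'), z)]
    [(x @ [u, v] @ y, (u', v'), z), (x, (u, v), y @ N_tab (u' @ v') @ z)]"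
proof -
  let ?N = "N_tab (u @ v)" and ?N' = "N_tab (u' @ v')"
  let ?h = "(y, (u', v'), z)"
  let ?w = "y @ [u', v'] @ z" and ?w' = "y @ ?N' @ z"
  have N: "?N \<in> lists (rows n)" "?N' \<in> lists (rows n)" using l N_tab_lists by auto
  have h: "src_step ?h \<in> lists (rows n)" "is_redex ?h" using l uv by auto
  have f: "is_cell2 P (Gen2 (u, v)) [u, v] ?N" using is_cell2_gen l uv by auto
  have w: "?w \<in> lists (rows n)" "?w' \<in> lists (rows n)" and u: "[u, v] \<in> lists (rows n)" using l N by auto
  have ch: "is_cell2 P (step_cell ?h) ?w ?w'" using is_cell2_step[OF h] by simp
  have s: "eq2 P (step_cell ([], (u, v), t)) (Gen2 (u, v) \<star>\<^sub>0 Id2 t)" if "t \<in> lists (rows n)" for t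
    using eq2.unit0_left[OF is_cell2.comp0[OF f is_cell2_Id2[OF that]]] by simp
  have k: "eq2 P (step_cell (wh_step a [] ?h)) (Id2 a \<star>\<^sub>0 step_cell ?h)" if "a \<in> lists (rows n)" for a
    using eq2.trans[OF step_cell_whisker[OF h that lists.Nil]
        eq2_comp0_right[OF eq2.unit0_right[OF ch] is_cell2_Id2[OF that]]] .
  have p1: "row_path n ([u, v] @ ?w) [([], (u, v), ?w), (?N @ y, (u', v'), z)] (?N @ ?w')"
    and p2: "row_path n ([u, v] @ ?w) [([u, v] @ y, (u', v'), z), ([], (u, v), ?w')] (?N @ ?w')"
    using l N uv by auto
  have t1: "is_cell2 P (step_cell ([], (u, v), ?w)) ([u, v] @ ?w) (?N @ ?w)"
    and t2: "is_cell2 P (step_cell ([], (u, v), ?w')) ([u, v] @ ?w') (?N @ ?w')"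
    using is_cell2_step[of "([], (u, v), ?w)"] is_cell2_step[of "([], (u, v), ?w')"] l uv N by simp_all
  have t3: "is_cell2 P (step_cell (wh_step a [] ?h)) (a @ ?w) (a @ ?w')" if "a \<in> lists (rows n)" for a
    using is_cell2_step[of "wh_step a [] ?h"] h that by simp
  have unit: "eq2 P (path_cell t [r, r']) (step_cell r \<star>\<^sub>1 step_cell r')" if "row_path n t [r, r'] t'" for t r r' t'
  proof -
    have r: "src_step r \<in> lists (rows n)" "is_redex r" "src_step r' = step_target r" "is_redex r'" "step_target r' = t'"
      using that by simp_all
    then have r': "src_step r' \<in> lists (rows n)" using step_target_lists by simp
    note c = is_cell2_step[OF r(1,2)] is_cell2_step[OF r' r(4)]
    have "is_cell2 P (step_cell r' \<star>\<^sub>1 Id2 (step_target r')) (src_step r') (step_target r')"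
      using is_cell2.comp1[OF c(2) is_cell2_Id2[OF step_target_lists[OF r']]] .
    from eq2.cong1[OF eq2.refl[OF c(1)] eq2.unit1_right[OF c(2)] c(1)[folded r(3)] this]
    show ?thesis by simp
  qed
  have "eq2 P (path_cell ([u, v] @ ?w) [([], (u, v), ?w), (?N @ y, (u', v'), z)])
    (step_cell ([], (u, v), ?w) \<star>\<^sub>1 step_cell (?N @ y, (u', v'), z))"
    by (rule unit[OF p1])
  also have "eq2 P \<dots> ((Gen2 (u, v) \<star>\<^sub>0 Id2 ?w) \<star>\<^sub>1 (Id2 ?N \<star>\<^sub>0 step_cell ?h))"
    using eq2.cong1[OF s[OF w(1)] k[OF N(1)] t1 t3[OF N(1)]] by simp
  also have "eq2 P \<dots> ((Id2 [u, v] \<star>\<^sub>0 step_cell ?h) \<star>\<^sub>1 (Gen2 (u, v) \<star>\<^sub>0 Id2 ?w'))"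
    by (rule eq2_exchange_steps[OF f ch polygraph2])
  also have "eq2 P \<dots> (step_cell ([u, v] @ y, (u', v'), z) \<star>\<^sub>1 step_cell ([], (u, v), ?w'))"
    using eq2.sym[OF eq2.cong1[OF k[OF u] s[OF w(2)] t3[OF u] t2]] by simp
  also have "eq2 P \<dots> (path_cell ([u, v] @ ?w) [([u, v] @ y, (u', v'), z), ([], (u, v), ?w')])"
    by (rule eq2.sym[OF unit[OF p2]])
  finally have "peq ([u, v] @ ?w) [([], (u, v), ?w), (?N @ y, (u', v'), z)]
      [([u, v] @ y, (u', v'), z), ([], (u, v), ?w')]"
    unfolding peq_def using p1 p2 fill2_eq2[OF polygraph2] by blast
  from peq_whisker[OF this, of x "[]"] l show ?thesis by simp
qed


text \<open>
  Fillability of the confluence of \<open>(u, v, t)\<close>, in the form that also makes sense (and is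
  trivial) when \<open>u \<lhd>\<^sub>N v\<close>.
\<close>

definition triple_filled :: "row \<Rightarrow> row \<Rightarrow> row \<Rightarrow> bool" where
  "triple_filled u v t \<longleftrightarrow> peq [u, v, t] (R_path (u, v, t)) (Lambda_path [u, v, t])"

lemma L_path_Lambda:
  "u \<in> rows n \<Longrightarrow> v \<in> rows n \<Longrightarrow> t \<in> rows n \<Longrightarrow> \<not> u \<lhd>\<^sub>N v \<Longrightarrow> L_path (u, v, t) = Lambda_path [u, v, t]"
  by (simp add: Lambda_path_Some[of "[u, v, t]" n])

lemma row_path_R_path:
  assumes "u \<in> rows n" "v \<in> rows n" "t \<in> rows n" "\<not> v \<lhd>\<^sub>N t"
  shows "row_path n [u, v, t] (R_path (u, v, t)) (nf [u, v, t])"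
proof -
  have l: "u # N_tab (v @ t) \<in> lists (rows n)" using assms N_tab_lists by simp
  then show ?thesis
    using assms row_path_Lambda[OF l] nf_step_target[of "([u], (v, t), [])" n] by simp
qed

text \<open>As \<open>u \<lhd>\<^sub>N v\<close>, the leftmost redex is \<open>(v, t)\<close> and
  both paths coincide.\<close>

lemma triple_filled_tri:
  assumes "u \<in> rows n" "v \<in> rows n" "t \<in> rows n" "u \<lhd>\<^sub>N v" "\<not> v \<lhd>\<^sub>N t"
  shows "triple_filled u v t"
proof -
  have "Lambda_path [u, v, t] = R_path (u, v, t)"
    using assms by (simp add: Lambda_path_Some[of "[u, v, t]" n])
  then show ?thesis unfolding triple_filled_def using peq_refl[OF row_path_R_path] assms by simp
qed

lemma triple_filled_context:
  assumes "triple_filled u v t" and l: "x @ [u, v, t] @ y \<in> lists (rows n)" and vt: "\<not> v \<lhd>\<^sub>N t"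
  shows "peq (x @ [u, v, t] @ y)
    ((x @ [u], (v, t), y) # whisker x (Lambda_path (u # N_tab (v @ t))) y)
    (whisker x (Lambda_path [u, v, t]) y)"
  using peq_whisker[of "[u, v, t]" "R_path (u, v, t)" "Lambda_path [u, v, t]" x y] assms
  unfolding triple_filled_def by simp

text \<open>Once the first three rows are normalized, the leftmost paths on both sides continue
  identically from \<open>nf [u, v, t] @ y\<close>.\<close>

lemma triple_filled_right:
  assumes "triple_filled u v t" and l: "[u, v, t] @ y \<in> lists (rows n)" and vt: "\<not> v \<lhd>\<^sub>N t"
  shows "peq ([u, v, t] @ y) (([u], (v, t), y) # Lambda_path (u # N_tab (v @ t) @ y))
    (Lambda_path ([u, v, t] @ y))"
proof -
  have uvt: "[u, v, t] \<in> lists (rows n)" "y \<in> lists (rows n)" "u # N_tab (v @ t) \<in> lists (rows n)"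
    using l N_tab_lists by auto
  have nf: "nf (u # N_tab (v @ t)) = nf [u, v, t]"
    using nf_step_target[of "([u], (v, t), [])" n] uvt by simp
  have c: "peq ([u, v, t] @ y) (([u], (v, t), y) # whisker [] (Lambda_path (u # N_tab (v @ t))) y)
    (whisker [] (Lambda_path [u, v, t]) y)"
    using triple_filled_context[of u v t "[]" y] assms by simp
  have p: "row_path n ([u, v, t] @ y) (whisker [] (Lambda_path [u, v, t]) y) (nf [u, v, t] @ y)"
    using row_path_whisker[OF row_path_Lambda[OF uvt(1)] lists.Nil uvt(2)] by simp
  have "peq ([u, v, t] @ y)
    ((([u], (v, t), y) # whisker [] (Lambda_path (u # N_tab (v @ t))) y) @ Lambda_path (nf [u, v, t] @ y))
    (whisker [] (Lambda_path [u, v, t]) y @ Lambda_path (nf [u, v, t] @ y))"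
    by (rule peq_sym[OF peq_append_right[OF peq_sym[OF c] p row_path_Lambda]])
      (use nf_lists[OF uvt(1)] uvt(2) in simp)
  then show ?thesis
    using Lambda_path_append[OF uvt(1,2)] Lambda_path_append[OF uvt(3,2)] nf by simp
qed

end

section \<open>Confluences of triples\<close>

locale row_cells_T1 = row_cells +
  assumes T1_filled: "\<tau> \<in> T1_triples n \<Longrightarrow> fill2 P (L_cell \<tau>) (R_cell \<tau>)"
begin

lemma triple_filled_T1:
  assumes "(u, v, t) \<in> T1_triples n"
  shows "triple_filled u v t"
proof -
  have *: "u \<in> rows n" "v \<in> rows n" "t \<in> rows n" "\<not> u \<lhd>\<^sub>N v" "\<not> v \<lhd>\<^sub>N t"
    using assms by (auto simp: T1_triples_def confl_triples_def)
  have "row_path n [u, v, t] (Lambda_path [u, v, t]) (nf [u, v, t])"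
    using row_path_Lambda * by simp
  moreover have "fill2 P (path_cell [u, v, t] (R_path (u, v, t))) (path_cell [u, v, t] (Lambda_path [u, v, t]))"
    using fill2_sym[OF T1_filled[OF assms]] L_path_Lambda[of u v t] *
    unfolding L_cell_def R_cell_def by (simp del: L_path.simps R_path.simps path_cell.simps)
  ultimately show ?thesis
    unfolding triple_filled_def peq_def using row_path_R_path[of u v t] * by blast
qed

text \<open>Triples in \<open>S_triples\<close> have a first row of length at least 2.\<close>

lemma triple_filled_single:
  assumes "[x] \<in> rows n" "u \<in> rows n" "v \<in> rows n" "\<not> u \<lhd>\<^sub>N v"
  shows "triple_filled [x] u v"
proof (cases "[x] \<lhd>\<^sub>N u")
  case True
  then show ?thesis using triple_filled_tri assms by blast
next
  case False
  then show ?thesis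
    using assms by (intro triple_filled_T1) (auto simp: T1_triples_def confl_triples_def S_triples_def)
qed

lemma rows_ConsI:
  assumes "u \<in> rows n" "[x] \<in> rows n" "x < hd u"
  shows "x # u \<in> rows n"
proof -
  have "\<forall>y\<in>set u. x < y" using assms unfolding rows_def by (cases u) auto
  then show ?thesis using assms unfolding rows_def by auto
qed

lemma not_tri_hd: "[x] \<in> rows n \<Longrightarrow> u \<in> rows n \<Longrightarrow> x < hd u \<Longrightarrow> \<not> [x] \<lhd>\<^sub>N u"
  unfolding rows_def tri_def by (cases u) auto

lemma N_tab_singleton_less:
  assumes "u \<in> rows n" "[x] \<in> rows n" "x < hd u"
  shows "N_tab (x # u) = [x # u]"
proof -
  have less: "\<forall>y\<in>set u. x < y" using assms unfolding rows_def by (cases u) auto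
  then have "bump [x] u = {}" unfolding bump_def by (auto simp: nxt_Some_iff)
  then show ?thesis
    using N_tab_two_rows[of "[x]" u] assms rows_ConsI[OF assms]
      sorted_wrt_less_sorted_list_of_set[of "x # u"] unfolding rows_def by simp
qed

text \<open>Bumped letters come from \<open>u\<close>, so a new top row still lies above
  \<open>x\<close>. This keeps the bound on three-row words stable under steps.\<close>

lemma hd_N_tab:
  assumes "u \<in> rows n" "v \<in> rows n" "x < hd u" "length (N_tab (u @ v)) \<noteq> 1"
  shows "x < hd (hd (N_tab (u @ v)))" "length (N_tab (u @ v)) = 2"
proof -
  have N: "N_tab (u @ v) = [sorted_list_of_set (bump u v), sorted_list_of_set (set u \<union> set v)]"
    and ne: "bump u v \<noteq> {}"
    using N_tab_two_rows[of u v] assms unfolding rows_def by (auto split: if_splits)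
  have "\<forall>y\<in>set u. x < y" using assms unfolding rows_def by (cases u) auto
  moreover have "hd (sorted_list_of_set (bump u v)) \<in> bump u v"
    using ne hd_in_set[of "sorted_list_of_set (bump u v)"] by simp
  ultimately show "x < hd (hd (N_tab (u @ v)))" using bump_subset N by force
  show "length (N_tab (u @ v)) = 2" using N by simp
qed

lemma length_N_tab: "u \<in> rows n \<Longrightarrow> v \<in> rows n \<Longrightarrow> length (N_tab (u @ v)) = 1 \<or> length (N_tab (u @ v)) = 2"
  using N_tab_two_rows[of u v] unfolding rows_def by auto

text \<open>
  Under this restriction on \<open>w\<close> only triples starting with \<open>[x]\<close>, or of the form
  \<open>(x # p, q, t)\<close> with \<open>p \<lhd>\<^sub>N q\<close>, occur; all of them are in \<open>T1_triples n\<close>.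
\<close>

lemma peq_singleton_Lambda:
  assumes "w \<in> lists (rows n)" "[x] \<in> rows n"
    and "length w \<le> 2 \<or> length w = 3 \<and> x < hd (hd w)"
  shows "peq ([x] # w) (whisker [[x]] (Lambda_path w) [] @ Lambda_path ([x] # nf w))
    (Lambda_path ([x] # w))"
  using assms(1,3)
proof (induction w rule: wf_induct_rule[OF wf_row_order[of n]])
  case (1 w)
  note w = 1(2) and x = assms(2)
  have xw: "[x] # w \<in> lists (rows n)" using w x by simp
  show ?case
  proof (cases "leftmost_step w")
    case None
    then have "tableau w" by (simp add: leftmost_step_None_iff)
    then have "Lambda_path w = []" "nf w = w" using Lambda_path_None[OF w] nf_tableau[OF w] by auto
    then show ?thesis using peq_refl[OF row_path_Lambda[OF xw]] by simp
  next
    case (Some s)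
    note s = leftmost_step_Some[OF Some]
    have sl: "src_step s \<in> lists (rows n)" using s(1) w by simp
    let ?w = "step_target s"
    have wl: "?w \<in> lists (rows n)" by (rule step_target_lists[OF sl])
    obtain a u v b where s_def: "s = (a, (u, v), b)" by (cases s rule: src_step.cases)
    have w_def: "w = a @ [u, v] @ b" using s(1) s_def by simp
    have uv: "u \<in> rows n" "v \<in> rows n" "\<not> u \<lhd>\<^sub>N v" using s(2) w s_def w_def by auto
    \<comment> \<open>A three-row word becomes shorter, or keeps its first row, or gets a first row
      of letters bumped from the old one.\<close>
    have cond: "length ?w \<le> 2 \<or> length ?w = 3 \<and> x < hd (hd ?w)"
    proof (cases a)
      case Nil
      then have w': "?w = N_tab (u @ v) @ b" "w = u # v # b" using s_def w_def by auto
      show ?thesis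
      proof (cases "length (N_tab (u @ v)) = 1")
        case True
        then show ?thesis using w' 1(3) by auto
      next
        case False
        then have l: "length (N_tab (u @ v)) = 2" using length_N_tab[OF uv(1,2)] by blast
        show ?thesis
        proof (cases b)
          case Nil
          then show ?thesis using w' l by simp
        next
          case (Cons t b')
          then have "x < hd u" "b' = []" using 1(3) w' by auto
          moreover have "N_tab (u @ v) \<noteq> []" using l by auto
          ultimately show ?thesis using hd_N_tab(1)[OF uv(1,2) _ False] w' l Cons by simp
        qed
      qed
    next
      case (Cons p a')
      then have "a' = []" "b = []" "x < hd p" using 1(3) w_def by auto
      then show ?thesis using length_N_tab[OF uv(1,2)] s_def Cons by auto
    qed
    have "(?w, w) \<in> row_order n" using row_order_step_target[OF sl s(2)] s(1) by simp
    from 1(1)[OF this wl cond]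
    have IH: "peq ([x] # ?w) (whisker [[x]] (Lambda_path ?w) [] @ Lambda_path ([x] # nf w)) (Lambda_path ([x] # ?w))"
      using nf_step_target[OF sl] s(1) by simp
    let ?s = "wh_step [[x]] [] s"
    have L: "whisker [[x]] (Lambda_path w) [] = ?s # whisker [[x]] (Lambda_path ?w) []"
      using Lambda_path_Some[OF w Some] by simp
    have ss: "src_step ?s = [x] # w" "src_step ?s \<in> lists (rows n)" "is_redex ?s" "step_target ?s = [x] # ?w"
      using s xw by simp_all
    have 2: "peq ([x] # w) (?s # whisker [[x]] (Lambda_path ?w) [] @ Lambda_path ([x] # nf w))
      (?s # Lambda_path ([x] # ?w))"
      using peq_Cons[OF ss(2,3)] IH unfolding ss(1,4) by blast
    have 3: "peq ([x] # w) (?s # Lambda_path ([x] # ?w)) (Lambda_path ([x] # w))"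
    proof (cases a)
      case Nil
      then show ?thesis
        using triple_filled_right[OF triple_filled_single[OF x uv], of b] xw uv(3) s_def w_def by simp
    next
      case (Cons p a')
      then have ab: "a' = []" "b = []" "x < hd p" using 1(3) w_def by auto
      have "tableau (a @ [u])" using Some s_def by (simp add: leftmost_step_Some_iff)
      then have p: "p \<in> rows n" "p \<lhd>\<^sub>N u" using w w_def Cons ab by auto
      let ?f = "x # p"
      have f: "?f \<in> rows n" and N: "N_tab (x # p) = [?f]" and nt: "\<not> [x] \<lhd>\<^sub>N p"
        using rows_ConsI N_tab_singleton_less not_tri_hd p(1) x ab(3) by auto
      \<comment> \<open>Here \<open>tl ?f = p\<close> and \<open>p \<lhd>\<^sub>N u\<close>, which
        keeps the triple out of \<open>S_triples\<close>.\<close>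
      have 4: "triple_filled ?f u v"
      proof (cases "?f \<lhd>\<^sub>N u")
        case True
        then show ?thesis using triple_filled_tri f uv by blast
      next
        case False
        then have "(?f, u, v) \<in> T1_triples n"
          using f uv p by (auto simp: T1_triples_def confl_triples_def S_triples_def)
        then show ?thesis by (rule triple_filled_T1)
      qed
      have 5: "peq [?f, u, v] (([?f], (u, v), []) # Lambda_path (?f # N_tab (u @ v))) (Lambda_path [?f, u, v])"
        using 4 unfolding triple_filled_def by simp
      have l4: "[[x], p, u, v] \<in> lists (rows n)" using x p uv by simp
      have Nl: "N_tab (u @ v) \<in> lists (rows n)" using N_tab_lists uv by blast
      \<comment> \<open>Merging \<open>[x]\<close> with \<open>p\<close> commutes with the step on
        \<open>(u, v)\<close>, and it is the leftmost step both before and after that step. The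
        claim is thereby reduced to the triple \<open>(?f, u, v)\<close>.\<close>
      have "peq [[x], p, u, v]
          [([], ([x], p), [u, v]), ([?f], (u, v), [])]
          [([[x], p], (u, v), []), ([], ([x], p), N_tab (u @ v))]"
        using peq_exchange[of "[]" "[x]" p "[]" u v "[]"] l4 nt uv N by simp
      from peq_append_right[OF peq_sym[OF this], of "?f # N_tab (u @ v)" "Lambda_path (?f # N_tab (u @ v))" "nf (?f # N_tab (u @ v))"]
      have 6: "peq [[x], p, u, v]
          (([[x], p], (u, v), []) # ([], ([x], p), N_tab (u @ v)) # Lambda_path (?f # N_tab (u @ v)))
          (([], ([x], p), [u, v]) # ([?f], (u, v), []) # Lambda_path (?f # N_tab (u @ v)))"
        using row_path_Lambda[of "?f # N_tab (u @ v)"] l4 nt uv N f Nl by simp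
      have 7: "peq [[x], p, u, v]
          (([], ([x], p), [u, v]) # ([?f], (u, v), []) # Lambda_path (?f # N_tab (u @ v)))
          (([], ([x], p), [u, v]) # Lambda_path [?f, u, v])"
        using peq_Cons[of "([], ([x], p), [u, v])"] 5 l4 nt N by simp
      have 8: "Lambda_path [[x], p, u, v] = ([], ([x], p), [u, v]) # Lambda_path [?f, u, v]"
        using Lambda_path_Some[OF l4] nt N by simp
      have 9: "Lambda_path ([x] # p # N_tab (u @ v)) = ([], ([x], p), N_tab (u @ v)) # Lambda_path (?f # N_tab (u @ v))"
        using Lambda_path_Some[of "[x] # p # N_tab (u @ v)" n] l4 nt N Nl by simp
      show ?thesis using peq_trans[OF 6 7] 8 9 s_def w_def Cons ab by simp
    qed
    show ?thesis using peq_trans[OF 2 3] L by simp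
  qed
qed

lemma triple_filled_all:
  assumes "u \<in> rows n" "v \<in> rows n" "t \<in> rows n" "\<not> v \<lhd>\<^sub>N t"
  shows "triple_filled u v t"
  using assms
proof (induction "length u" arbitrary: u v t rule: less_induct)
  case less
  note vt = less.prems(4)
  show ?case
  proof (cases "u \<lhd>\<^sub>N v \<or> (u, v, t) \<in> T1_triples n")
    case True
    then show ?thesis using triple_filled_tri triple_filled_T1 less.prems by blast
  next
    case False
    then have S: "\<not> u \<lhd>\<^sub>N v" "length u \<ge> 2" "\<not> tl u \<lhd>\<^sub>N v"
      using less.prems by (auto simp: T1_triples_def confl_triples_def S_triples_def)
    obtain x u' where u: "u = x # u'" "u' \<noteq> []" using S(2) by (cases u; cases "tl u") auto
    have x: "[x] \<in> rows n" and u': "u' \<in> rows n" and xu': "x < hd u'"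
      using less.prems(1) u by (auto simp: rows_def)
    have uv: "\<not> u' \<lhd>\<^sub>N v" using S u by simp
    note N = N_tab_singleton_less[OF u' x xu'] and nt = not_tri_hd[OF x u' xu']
    let ?\<alpha> = "([], ([x], u'), [v, t])" and ?N = "N_tab (u' @ v)" and ?M = "N_tab (v @ t)"
    note r = less.prems(1-3)
    have Nl: "?N \<in> lists (rows n)" "?M \<in> lists (rows n)" using N_tab_lists r u' by auto
    have l: "[[x], u', v, t] \<in> lists (rows n)" "[u, v, t] \<in> lists (rows n)" "[u', v, t] \<in> lists (rows n)"
      "u' # ?M \<in> lists (rows n)" "?N @ [t] \<in> lists (rows n)" "u # ?M \<in> lists (rows n)" "[x] # u' # ?M \<in> lists (rows n)"
      "[x] # ?N @ [t] \<in> lists (rows n)"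
      using x u' r Nl by auto
    have nf1: "nf (?N @ [t]) = nf [u', v, t]" and nf2: "nf (u' # ?M) = nf [u', v, t]"
      using nf_step_target[of "([], (u', v), [t])" n] nf_step_target[of "([u'], (v, t), [])" n] l by simp_all
    have cond1: "length (?N @ [t]) \<le> 2 \<or> length (?N @ [t]) = 3 \<and> x < hd (hd (?N @ [t]))"
    proof (cases "length ?N = 1")
      case False
      then have "?N \<noteq> []" using length_N_tab[OF u' r(2)] by auto
      then show ?thesis using hd_N_tab[OF u' r(2) xu' False] by simp
    qed simp
    have cond2: "length (u' # ?M) \<le> 2 \<or> length (u' # ?M) = 3 \<and> x < hd (hd (u' # ?M))"
      using length_N_tab[OF r(2,3)] xu' by auto
    have A: "Lambda_path [[x], u', v, t] = ?\<alpha> # Lambda_path [u, v, t]"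
      using Lambda_path_Some[OF l(1)] nt N u by simp
    have B: "peq [[x], u', v, t] (([[x]], (u', v), [t]) # Lambda_path ([x] # ?N @ [t])) (?\<alpha> # Lambda_path [u, v, t])"
      using triple_filled_right[OF triple_filled_single[OF x u' r(2) uv], of "[t]"] l A uv by simp
    have C: "peq ([x] # ?N @ [t]) (whisker [[x]] (Lambda_path (?N @ [t])) [] @ Lambda_path ([x] # nf [u', v, t]))
      (Lambda_path ([x] # ?N @ [t]))"
      using peq_singleton_Lambda[OF l(5) x cond1] nf1 by simp
    have D: "peq ([x] # u' # ?M) (whisker [[x]] (Lambda_path (u' # ?M)) [] @ Lambda_path ([x] # nf [u', v, t]))
      (Lambda_path ([x] # u' # ?M))"
      using peq_singleton_Lambda[OF l(4) x cond2] nf2 by simp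
    have E: "triple_filled u' v t" using less.hyps u' r vt u by simp
    then have "peq [u', v, t] (([u'], (v, t), []) # Lambda_path (u' # ?M)) (([], (u', v), [t]) # Lambda_path (?N @ [t]))"
      unfolding triple_filled_def using L_path_Lambda[OF u' r(2,3) uv] by simp
    from peq_whisker[OF this, of "[[x]]" "[]"]
    have "peq [[x], u', v, t]
        (([[x], u'], (v, t), []) # whisker [[x]] (Lambda_path (u' # ?M)) [])
        (([[x]], (u', v), [t]) # whisker [[x]] (Lambda_path (?N @ [t])) [])"
      using x by simp
    from peq_append_right[OF this, of "[x] # nf [u', v, t]" "Lambda_path ([x] # nf [u', v, t])" "nf ([x] # nf [u', v, t])"]
    have F: "peq [[x], u', v, t]
        (([[x], u'], (v, t), []) # whisker [[x]] (Lambda_path (u' # ?M)) [] @ Lambda_path ([x] # nf [u', v, t]))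
        (([[x]], (u', v), [t]) # whisker [[x]] (Lambda_path (?N @ [t])) [] @ Lambda_path ([x] # nf [u', v, t]))"
      using row_path_Lambda[of "[x] # nf [u', v, t]"] nf_lists[OF l(3)] x l vt
        row_path_whisker[OF row_path_Lambda[OF l(4)], of "[[x]]" "[]"] nf2 by simp
    have G: "peq [[x], u', v, t] (?\<alpha> # ([u], (v, t), []) # Lambda_path (u # ?M))
        (([[x], u'], (v, t), []) # Lambda_path ([x] # u' # ?M))"
    proof -
      have "peq [[x], u', v, t] [?\<alpha>, ([u], (v, t), [])] [([[x], u'], (v, t), []), ([], ([x], u'), ?M)]"
        using peq_exchange[of "[]" "[x]" u' "[]" v t "[]"] l nt vt N u by simp
      from peq_append_right[OF this, of "u # ?M" "Lambda_path (u # ?M)" "nf (u # ?M)"]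
      show ?thesis
        using row_path_Lambda[of "u # ?M"] l nt vt N u Lambda_path_Some[OF l(7)] by simp
    qed
    have H: "peq [[x], u', v, t] (([[x], u'], (v, t), []) # Lambda_path ([x] # u' # ?M))
        (([[x], u'], (v, t), []) # whisker [[x]] (Lambda_path (u' # ?M)) [] @ Lambda_path ([x] # nf [u', v, t]))"
      using peq_Cons[of "([[x], u'], (v, t), [])"] peq_sym[OF D] l vt by simp
    have I: "peq [[x], u', v, t]
        (([[x]], (u', v), [t]) # whisker [[x]] (Lambda_path (?N @ [t])) [] @ Lambda_path ([x] # nf [u', v, t]))
        (([[x]], (u', v), [t]) # Lambda_path ([x] # ?N @ [t]))"
      using peq_Cons[of "([[x]], (u', v), [t])"] C l uv by simp
    \<comment> \<open>Around the diagram: \<open>G\<close> exchanges the merging step with the step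
      on \<open>(v, t)\<close>; \<open>H\<close> and \<open>I\<close> pass between leftmost paths
      and paths that normalize behind \<open>[x]\<close>; \<open>F\<close> is the induction
      hypothesis whiskered by \<open>[x]\<close>; \<open>B\<close> is the confluence of
      \<open>([x], u', v)\<close> with \<open>t\<close> to its right. Both ends begin with
      \<open>?\<alpha>\<close>, which is cancelled next.\<close>
    have "peq [[x], u', v, t] ([?\<alpha>] @ ([u], (v, t), []) # Lambda_path (u # ?M)) ([?\<alpha>] @ Lambda_path [u, v, t])"
      using peq_trans[OF G peq_trans[OF H peq_trans[OF F peq_trans[OF I B]]]] by simp
    from peq_cancel[OF this, of "[u, v, t]"]
    have "peq [u, v, t] (([u], (v, t), []) # Lambda_path (u # ?M)) (Lambda_path [u, v, t])"
      using l nt N u by simp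
    then show ?thesis unfolding triple_filled_def by simp
  qed
qed

end

section \<open>Coherence\<close>

lemma fill2_cancel_right:
  assumes P: "is_polygraph2 P" and f: "is_cell2 P f u v" and g: "is_cell2 P g u v"
    and a: "is_cell2 P a v w" and fg: "fill2 P (f \<star>\<^sub>1 a) (g \<star>\<^sub>1 a)"
  shows "fill2 P f g"
proof -
  note i = is_cell2.inv[OF a]
  have *: "eq2 P ((h \<star>\<^sub>1 a) \<star>\<^sub>1 Inv2 a) h" if h: "is_cell2 P h u v" for h
  proof -
    have "eq2 P ((h \<star>\<^sub>1 a) \<star>\<^sub>1 Inv2 a) (h \<star>\<^sub>1 (a \<star>\<^sub>1 Inv2 a))" by (rule eq2.assoc1[OF h a i])
    also have "eq2 P \<dots> (h \<star>\<^sub>1 Id2 v)"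
      by (rule eq2.cong1[OF eq2.refl[OF h] eq2.inv_right[OF a] h is_cell2.comp1[OF a i]])
    also have "eq2 P \<dots> h" by (rule eq2.unit1_right[OF h])
    finally show ?thesis .
  qed
  have "fill2 P ((f \<star>\<^sub>1 a) \<star>\<^sub>1 Inv2 a) ((g \<star>\<^sub>1 a) \<star>\<^sub>1 Inv2 a)"
    by (rule fill2_comp1[OF fg fill2_refl[OF i] is_cell2.comp1[OF f a] i])
  from fill2_trans[OF fill2_sym[OF fill2_eq2[OF P *[OF f]]]
      fill2_trans[OF this fill2_eq2[OF P *[OF g]]]]
  show ?thesis .
qed

text \<open>Since \<open>a @ [u]\<close> is a tableau, no redex starts left of the leftmost one. The
  cases are the trivial, overlapping and disjoint branchings of Squier's argument.\<close>

lemma leftmost_step_cases: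
  assumes s0: "leftmost_step (src_step s) = Some (a, (u, v), y)" and s: "is_redex s"
  obtains "s = (a, (u, v), y)"
  | t z where "s = (a @ [u], (v, t), z)" "y = t # z"
  | m u' v' z where "s = (a @ [u, v] @ m, (u', v'), z)" "y = m @ [u', v'] @ z"
proof -
  obtain a' u' v' z where s_def: "s = (a', (u', v'), z)" by (cases s rule: src_step.cases)
  have w: "a' @ [u', v'] @ z = a @ [u, v] @ y" and t: "tableau (a @ [u])" and r: "\<not> u' \<lhd>\<^sub>N v'"
    using s0 s s_def by (auto simp: leftmost_step_Some_iff)
  from w obtain us where
    "a' = a @ us \<and> us @ [u', v'] @ z = [u, v] @ y \<or> a' @ us = a \<and> [u', v'] @ z = us @ [u, v] @ y"
    using append_eq_append_conv2[of a' "[u', v'] @ z" a "[u, v] @ y"] by blast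
  then show thesis
  proof (elim disjE conjE)
    assume *: "a' = a @ us" "us @ [u', v'] @ z = [u, v] @ y"
    consider "us = []" | "us = [u]" | m where "us = u # v # m"
      using *(2) by (cases us; cases "tl us") auto
    then show thesis using * s_def that by cases auto
  next
    assume *: "a' @ us = a" "[u', v'] @ z = us @ [u, v] @ y"
    show thesis
    proof (cases us)
      case Nil
      then show thesis using * s_def that(1) by auto
    next
      case (Cons c us')
      then have "c = u'" "hd (us' @ [u]) = v'" using *(2) by (cases us'; auto)+
      moreover have "tableau (a' @ c # us' @ [u])" using t * Cons by auto
      then have "c \<lhd>\<^sub>N hd (us' @ [u])"
        by (cases us') (auto simp: successively_append_iff)
      ultimately show thesis using r by simp
    qed
  qed
qed

context row_cells_T1
begin

text \<open>\<open>D\<close> is the induction hypothesis of the next lemma. Every word on the path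
  lies below \<open>w\<close>, so each step can be absorbed into a leftmost path.\<close>

lemma peq_path_Lambda_below:
  assumes D: "\<And>s. (src_step s, w) \<in> (row_order n)\<^sup>+ \<Longrightarrow> src_step s \<in> lists (rows n) \<Longrightarrow> is_redex s
      \<Longrightarrow> peq (src_step s) (s # Lambda_path (step_target s)) (Lambda_path (src_step s))"
    and "(w', w) \<in> (row_order n)\<^sup>+" "row_path n w' p w''"
  shows "peq w' (p @ Lambda_path w'') (Lambda_path w')"
  using assms(2,3)
proof (induction p arbitrary: w')
  case Nil
  then show ?case using peq_refl[OF row_path_Lambda] by auto
next
  case (Cons s p)
  then have s: "src_step s = w'" "src_step s \<in> lists (rows n)" "is_redex s"
    and p: "row_path n (step_target s) p w''" by simp_all
  have "(step_target s, w) \<in> (row_order n)\<^sup>+"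
    using row_order_step_target[OF s(2,3)] Cons.prems(1) s(1) by (metis trancl_into_trancl2)
  from Cons.IH[OF this p]
  have "peq w' (s # p @ Lambda_path w'') (s # Lambda_path (step_target s))"
    using peq_Cons[OF s(2,3)] s(1) by simp
  then show ?case using peq_trans D[of s] s Cons.prems(1) by fastforce
qed

text \<open>Newman's argument with fillings: \<open>s\<close> and the leftmost step are joined by a
  triple or by an exchange, and the induction hypothesis replaces what follows by leftmost
  paths.\<close>

lemma peq_step_Lambda:
  "src_step s \<in> lists (rows n) \<Longrightarrow> is_redex s
    \<Longrightarrow> peq (src_step s) (s # Lambda_path (step_target s)) (Lambda_path (src_step s))"
proof (induction "src_step s" arbitrary: s rule: wf_induct_rule[OF wf_trancl[OF wf_row_order[of n]]])
  case (1 s)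
  let ?w = "src_step s"
  note sl = 1(2) and sr = 1(3)
  have below: "peq w' (p @ Lambda_path w'') (Lambda_path w')"
    if "(w', ?w) \<in> row_order n" "row_path n w' p w''" for w' p w''
    using peq_path_Lambda_below[OF 1(1) r_into_trancl[OF that(1)] that(2)] by blast
  have "\<not> tableau ?w"
    using sr by (cases s rule: src_step.cases) (auto simp: successively_append_iff)
  then obtain a u v y where s0: "leftmost_step ?w = Some (a, (u, v), y)"
    using leftmost_step_None_iff[of ?w] by (metis not_None_eq prod.exhaust)
  let ?s0 = "(a, (u, v), y)"
  have s0': "src_step ?s0 = ?w" "is_redex ?s0" using leftmost_step_Some[OF s0] .
  have L: "Lambda_path ?w = ?s0 # Lambda_path (step_target ?s0)"
    by (rule Lambda_path_Some[OF sl s0])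
  have s0l: "src_step ?s0 \<in> lists (rows n)" using s0' sl by simp
  note lt = row_order_step_target[OF sl sr] row_order_step_target[OF s0l s0'(2), unfolded s0'(1)]
  from s0 sr show ?case
  proof (cases rule: leftmost_step_cases)
    case 1
    then show ?thesis using L peq_refl[OF row_path_Lambda[OF sl]] by simp
  next
    case (2 t z)
    have w: "?w = a @ [u, v, t] @ z" using 2 by simp
    have l: "a \<in> lists (rows n)" "u \<in> rows n" "v \<in> rows n" "t \<in> rows n" "z \<in> lists (rows n)"
      using sl w by auto
    have r: "\<not> v \<lhd>\<^sub>N t" "\<not> u \<lhd>\<^sub>N v" using sr s0' 2 by auto
    have l3: "[u, v, t] \<in> lists (rows n)" "u # N_tab (v @ t) \<in> lists (rows n)" "N_tab (u @ v) @ [t] \<in> lists (rows n)"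
      using l N_tab_lists by auto
    have nf: "nf (u # N_tab (v @ t)) = nf [u, v, t]" "nf (N_tab (u @ v) @ [t]) = nf [u, v, t]"
      using nf_step_target[of "([u], (v, t), [])" n] nf_step_target[of "([], (u, v), [t])" n] l3 by simp_all
    let ?n = "a @ nf [u, v, t] @ z"
    let ?p = "whisker a (Lambda_path (u # N_tab (v @ t))) z"
    let ?q = "whisker a (Lambda_path (N_tab (u @ v) @ [t])) z"
    have p: "row_path n (step_target s) ?p ?n" and q: "row_path n (step_target ?s0) ?q ?n"
      using row_path_whisker[OF row_path_Lambda[OF l3(2)] l(1,5)]
        row_path_whisker[OF row_path_Lambda[OF l3(3)] l(1,5)] nf 2 by simp_all
    have n: "?n \<in> lists (rows n)" using nf_lists[OF l3(1)] l by simp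
    have "peq ?w (s # ?p) (?s0 # ?q)"
      using triple_filled_context[OF triple_filled_all[OF l(2-4) r(1)], of a z] r(1) sl w 2
        L_path_Lambda[OF l(2-4) r(2), symmetric] by simp
    from peq_append_right[OF this _ row_path_Lambda[OF n]]
    have A: "peq ?w (s # ?p @ Lambda_path ?n) (?s0 # ?q @ Lambda_path ?n)" using p sl sr by simp
    have B: "peq ?w (s # ?p @ Lambda_path ?n) (s # Lambda_path (step_target s))"
      by (rule peq_Cons[OF sl sr below[OF lt(1) p]])
    have C: "peq ?w (?s0 # ?q @ Lambda_path ?n) (?s0 # Lambda_path (step_target ?s0))"
      using peq_Cons[OF s0l s0'(2) below[OF lt(2) q]] unfolding s0'(1) .
    show ?thesis unfolding L by (rule peq_trans[OF peq_sym[OF B] peq_trans[OF A C]])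
  next
    case (3 m u' v' z)
    let ?N = "N_tab (u @ v)" and ?N' = "N_tab (u' @ v')"
    have w: "?w = a @ [u, v] @ m @ [u', v'] @ z" using 3 by simp
    have r: "\<not> u' \<lhd>\<^sub>N v'" "\<not> u \<lhd>\<^sub>N v" using sr s0' 3 by auto
    let ?s' = "(a @ ?N @ m, (u', v'), z)" and ?s1 = "(a, (u, v), m @ ?N' @ z)"
    let ?n = "a @ ?N @ m @ ?N' @ z"
    have Nl: "?N \<in> lists (rows n)" "?N' \<in> lists (rows n)" using N_tab_lists sl w by auto
    have nl: "?n \<in> lists (rows n)" using Nl sl w by auto
    have tl: "step_target s = a @ [u, v] @ m @ ?N' @ z" "step_target s \<in> lists (rows n)"
      using 3 Nl sl w by auto
    \<comment> \<open>A step strictly to the right leaves \<open>(u, v)\<close> the leftmost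
      redex.\<close>
    have "leftmost_step (step_target s) = Some ?s1"
      unfolding tl(1) using s0 by (simp add: leftmost_step_Some_iff)
    then have L1: "Lambda_path (step_target s) = ?s1 # Lambda_path ?n"
      using Lambda_path_Some[OF tl(2)] by simp
    have "peq ?w [?s0, ?s'] [s, ?s1]"
      using peq_exchange[of a u v m u' v' z] sl w r 3 by simp
    from peq_append_right[OF this _ row_path_Lambda[OF nl]]
    have A: "peq ?w (?s0 # ?s' # Lambda_path ?n) (s # Lambda_path (step_target s))"
      using sl r Nl nl w 3 L1 by simp
    have "row_path n (step_target ?s0) [?s'] ?n" using Nl nl sl r w 3 by simp
    from peq_Cons[OF s0l s0'(2) below[OF lt(2) this]]
    have B: "peq ?w (?s0 # ?s' # Lambda_path ?n) (?s0 # Lambda_path (step_target ?s0))"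
      unfolding s0'(1) by simp
    show ?thesis unfolding L by (rule peq_trans[OF peq_sym[OF A] B])
  qed
qed

lemma peq_path_Lambda:
  "row_path n w p w' \<Longrightarrow> peq w (p @ Lambda_path w') (Lambda_path w)"
proof (induction p arbitrary: w)
  case Nil
  then show ?case using peq_refl[OF row_path_Lambda] by auto
next
  case (Cons s p)
  then have s: "src_step s = w" "src_step s \<in> lists (rows n)" "is_redex s"
    and p: "row_path n (step_target s) p w'" by simp_all
  show ?case
    using peq_trans[OF peq_Cons[OF s(2,3) Cons.IH[OF p]] peq_step_Lambda[OF s(2,3)]] s(1) by simp
qed

section \<open>Naturality of the normalization cells\<close>

definition norm_cell :: "row list \<Rightarrow> (row, row_cell) cell2" where
  "norm_cell w = path_cell w (Lambda_path w)"

lemma is_cell2_norm_cell: "w \<in> lists (rows n) \<Longrightarrow> is_cell2 P (norm_cell w) w (nf w)"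
  unfolding norm_cell_def by (rule is_cell2_path[OF row_path_Lambda])

text \<open>Normalizing \<open>v\<close>, then \<open>w\<close>, then the two tableaux side by side
  is one more path from \<open>v @ w\<close> to its normal form. It supplies the horizontal case of
  naturality.\<close>

lemma norm_cell_append:
  assumes v: "v \<in> lists (rows n)" and w: "w \<in> lists (rows n)"
  shows "fill2 P (norm_cell (v @ w)) ((norm_cell v \<star>\<^sub>0 norm_cell w) \<star>\<^sub>1 norm_cell (nf v @ nf w))"
proof -
  let ?p = "whisker [] (Lambda_path v) w" and ?q = "whisker (nf v) (Lambda_path w) []"
  note nv = nf_lists[OF v] and nw = nf_lists[OF w]
  have nvw: "nf v @ nf w \<in> lists (rows n)" using nv nw by simp
  have p: "row_path n (v @ w) ?p (nf v @ w)"
    using row_path_whisker[OF row_path_Lambda[OF v] lists.Nil w] by simp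
  have q: "row_path n (nf v @ w) ?q (nf v @ nf w)"
    using row_path_whisker[OF row_path_Lambda[OF w] nv lists.Nil] by simp
  note cv = is_cell2_norm_cell[OF v] and cw = is_cell2_norm_cell[OF w]
  have cp: "eq2 P (path_cell (v @ w) ?p) (norm_cell v \<star>\<^sub>0 Id2 w)"
    using eq2.trans[OF path_cell_whisker[OF lists.Nil w row_path_Lambda[OF v]]
        eq2.unit0_left[OF is_cell2.comp0[OF is_cell2_path[OF row_path_Lambda[OF v]] is_cell2_Id2[OF w]]]]
    unfolding norm_cell_def by simp
  have cq: "eq2 P (path_cell (nf v @ w) ?q) (Id2 (nf v) \<star>\<^sub>0 norm_cell w)"
    using eq2.trans[OF path_cell_whisker[OF nv lists.Nil row_path_Lambda[OF w]]
        eq2_comp0_right[OF eq2.unit0_right[OF is_cell2_path[OF row_path_Lambda[OF w]]] is_cell2_Id2[OF nv]]]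
    unfolding norm_cell_def by simp
  have cpq: "eq2 P (path_cell (v @ w) (?p @ ?q)) (norm_cell v \<star>\<^sub>0 norm_cell w)"
  proof -
    have "eq2 P (path_cell (v @ w) (?p @ ?q)) (path_cell (v @ w) ?p \<star>\<^sub>1 path_cell (nf v @ w) ?q)"
      by (rule path_cell_append[OF p q])
    also have "eq2 P \<dots> ((norm_cell v \<star>\<^sub>0 Id2 w) \<star>\<^sub>1 (Id2 (nf v) \<star>\<^sub>0 norm_cell w))"
      by (rule eq2.cong1[OF cp cq is_cell2_path[OF p] is_cell2_path[OF q]])
    also have "eq2 P \<dots> ((norm_cell v \<star>\<^sub>1 Id2 (nf v)) \<star>\<^sub>0 (Id2 w \<star>\<^sub>1 norm_cell w))"
      by (rule eq2.sym[OF eq2.exchange[OF cv is_cell2_Id2[OF nv] is_cell2_Id2[OF w] cw]])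
    also have "eq2 P \<dots> (norm_cell v \<star>\<^sub>0 norm_cell w)"
      by (rule eq2.cong0[OF eq2.unit1_right[OF cv] eq2.unit1_left[OF cw]])
    finally show ?thesis .
  qed
  have pq: "row_path n (v @ w) (?p @ ?q) (nf v @ nf w)" using p q row_path_append by blast
  have "peq (v @ w) ((?p @ ?q) @ Lambda_path (nf v @ nf w)) (Lambda_path (v @ w))"
    by (rule peq_path_Lambda[OF pq])
  then have "fill2 P (path_cell (v @ w) ((?p @ ?q) @ Lambda_path (nf v @ nf w))) (norm_cell (v @ w))"
    unfolding peq_def norm_cell_def by blast
  moreover have "eq2 P (path_cell (v @ w) ((?p @ ?q) @ Lambda_path (nf v @ nf w)))
      (path_cell (v @ w) (?p @ ?q) \<star>\<^sub>1 norm_cell (nf v @ nf w))"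
    unfolding norm_cell_def by (rule path_cell_append[OF pq row_path_Lambda[OF nvw]])
  moreover have "eq2 P (path_cell (v @ w) (?p @ ?q) \<star>\<^sub>1 norm_cell (nf v @ nf w))
      ((norm_cell v \<star>\<^sub>0 norm_cell w) \<star>\<^sub>1 norm_cell (nf v @ nf w))"
    by (rule eq2.cong1[OF cpq eq2.refl[OF is_cell2_norm_cell[OF nvw]] is_cell2_path[OF pq] is_cell2_norm_cell[OF nvw]])
  ultimately show ?thesis
    using fill2_sym fill2_trans fill2_eq2[OF polygraph2] eq2.trans by meson
qed

text \<open>Normalization absorbs every 2-cell: steps by \<open>peq_step_Lambda\<close>, horizontal
  composites by \<open>norm_cell_append\<close>, inverses by cancellation.\<close>

lemma norm_cell_natural:
  "is_cell2 P f u v \<Longrightarrow> nf u = nf v \<and> fill2 P (f \<star>\<^sub>1 norm_cell v) (norm_cell u)"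
proof (induction rule: is_cell2.induct)
  case (id w)
  then have "w \<in> lists (rows n)" by (simp add: cells1)
  then show ?case using fill2_eq2[OF polygraph2 eq2.unit1_left[OF is_cell2_norm_cell]] by simp
next
  case (gen b)
  obtain u v where b: "b = (u, v)" by (cases b)
  let ?s = "([], (u, v), [])"
  have s: "src_step ?s \<in> lists (rows n)" "is_redex ?s" using gen b cells2 by auto
  have N: "N_tab (u @ v) \<in> lists (rows n)" using N_tab_lists s by simp
  have uv: "[u, v] \<in> lists (rows n)" using s by simp
  have g: "is_cell2 P (Gen2 b) [u, v] (N_tab (u @ v))"
    using is_cell2_gen s b by simp
  have "fill2 P (step_cell ?s \<star>\<^sub>1 norm_cell (N_tab (u @ v))) (norm_cell [u, v])"
    using peq_step_Lambda[OF s] unfolding peq_def norm_cell_def by simp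
  moreover have "eq2 P (Gen2 b) (step_cell ?s)"
    using eq2.sym[OF eq2.trans[OF eq2.unit0_left[OF is_cell2.comp0[OF g is_cell2_Id2[OF lists.Nil]]]
          eq2.unit0_right[OF g]]] b by simp
  from eq2.cong1[OF this eq2.refl[OF is_cell2_norm_cell[OF N]] g is_cell2_norm_cell[OF N]]
  have "fill2 P (Gen2 b \<star>\<^sub>1 norm_cell (N_tab (u @ v))) (step_cell ?s \<star>\<^sub>1 norm_cell (N_tab (u @ v)))"
    by (rule fill2_eq2[OF polygraph2])
  ultimately show ?case
    using fill2_trans b nf_step_target[OF s(1)] by (simp add: src2 tgt2) 
next
  case (comp0 f u v g u' v')
  have l: "u \<in> lists (rows n)" "v \<in> lists (rows n)" "u' \<in> lists (rows n)" "v' \<in> lists (rows n)"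
    using is_cell2_lists[OF polygraph2] comp0.hyps cells1 by auto
  have nfe: "nf (u @ u') = nf (v @ v')"
  proof -
    have "nf (x @ y) = nf (nf x @ nf y)" if "x \<in> lists (rows n)" "y \<in> lists (rows n)" for x y
    proof -
      have "row_path n (x @ y) (whisker [] (Lambda_path x) y) (nf x @ y)"
        using row_path_whisker[OF row_path_Lambda[OF that(1)] lists.Nil that(2)] by simp
      moreover have "row_path n (nf x @ y) (whisker (nf x) (Lambda_path y) []) (nf x @ nf y)"
        using row_path_whisker[OF row_path_Lambda[OF that(2)] nf_lists[OF that(1)] lists.Nil] by simp
      ultimately show ?thesis using nf_row_path by metis
    qed
    then show ?thesis using l comp0.IH by metis
  qed
  let ?K = "norm_cell (nf v @ nf v')"
  have Kl: "nf v @ nf v' \<in> lists (rows n)" using nf_lists l by simp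
  note c = l[THEN is_cell2_norm_cell] and cK = is_cell2_norm_cell[OF Kl]
  note fg = is_cell2.comp0[OF comp0.hyps]
  have cvv: "is_cell2 P (norm_cell v \<star>\<^sub>0 norm_cell v') (v @ v') (nf v @ nf v')"
    by (rule is_cell2.comp0[OF c(2,4)])
  have "fill2 P ((f \<star>\<^sub>0 g) \<star>\<^sub>1 norm_cell (v @ v'))
      ((f \<star>\<^sub>0 g) \<star>\<^sub>1 ((norm_cell v \<star>\<^sub>0 norm_cell v') \<star>\<^sub>1 ?K))"
    by (rule fill2_comp1[OF fill2_refl[OF fg] norm_cell_append[OF l(2,4)] fg is_cell2_norm_cell])
      (use l in simp)
  also have "fill2 P \<dots> (((f \<star>\<^sub>0 g) \<star>\<^sub>1 (norm_cell v \<star>\<^sub>0 norm_cell v')) \<star>\<^sub>1 ?K)"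
    by (rule fill2_eq2[OF polygraph2 eq2.sym[OF eq2.assoc1[OF fg cvv cK]]])
  also have "fill2 P \<dots> (((f \<star>\<^sub>1 norm_cell v) \<star>\<^sub>0 (g \<star>\<^sub>1 norm_cell v')) \<star>\<^sub>1 ?K)"
    by (rule fill2_eq2[OF polygraph2 eq2.cong1[OF eq2.sym[OF eq2.exchange[OF comp0.hyps(1) c(2) comp0.hyps(2) c(4)]]
            eq2.refl[OF cK] is_cell2.comp1[OF fg cvv] cK]])
  also have "fill2 P \<dots> ((norm_cell u \<star>\<^sub>0 norm_cell u') \<star>\<^sub>1 ?K)"
    by (rule fill2_comp1[OF fill2_comp0 fill2_refl[OF cK]
          is_cell2.comp0[OF is_cell2.comp1[OF comp0.hyps(1) c(2)] is_cell2.comp1[OF comp0.hyps(2) c(4)]] cK])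
      (use comp0.IH in auto)
  also have "fill2 P \<dots> (norm_cell (u @ u'))"
    using fill2_sym[OF norm_cell_append[OF l(1,3)]] comp0.IH by simp
  finally show ?case using nfe by simp
next
  case (comp1 f u v g w)
  have l: "v \<in> lists (rows n)" "w \<in> lists (rows n)"
    using is_cell2_lists[OF polygraph2] comp1.hyps cells1 by auto
  note c = l[THEN is_cell2_norm_cell]
  have "fill2 P ((f \<star>\<^sub>1 g) \<star>\<^sub>1 norm_cell w) (f \<star>\<^sub>1 (g \<star>\<^sub>1 norm_cell w))"
    by (rule fill2_eq2[OF polygraph2 eq2.assoc1[OF comp1.hyps c(2)]])
  also have "fill2 P \<dots> (f \<star>\<^sub>1 norm_cell v)"
    by (rule fill2_comp1[OF fill2_refl[OF comp1.hyps(1)] _ comp1.hyps(1) is_cell2.comp1[OF comp1.hyps(2) c(2)]])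
      (use comp1.IH in blast)
  also have "fill2 P \<dots> (norm_cell u)" using comp1.IH by blast
  finally show ?case using comp1.IH by simp
next
  case (inv f u v)
  have l: "u \<in> lists (rows n)" "v \<in> lists (rows n)"
    using is_cell2_lists[OF polygraph2] inv.hyps cells1 by auto
  note c = l[THEN is_cell2_norm_cell] and i = is_cell2.inv[OF inv.hyps]
  have "fill2 P (Inv2 f \<star>\<^sub>1 norm_cell u) (Inv2 f \<star>\<^sub>1 (f \<star>\<^sub>1 norm_cell v))"
    by (rule fill2_comp1[OF fill2_refl[OF i] fill2_sym i c(1)]) (use inv.IH in blast)
  also have "fill2 P \<dots> ((Inv2 f \<star>\<^sub>1 f) \<star>\<^sub>1 norm_cell v)"
    by (rule fill2_eq2[OF polygraph2 eq2.sym[OF eq2.assoc1[OF i inv.hyps c(2)]]])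
  also have "fill2 P \<dots> (Id2 v \<star>\<^sub>1 norm_cell v)"
    by (rule fill2_eq2[OF polygraph2 eq2.cong1[OF eq2.inv_left[OF inv.hyps] eq2.refl[OF c(2)] is_cell2.comp1[OF i inv.hyps] c(2)]])
  also have "fill2 P \<dots> (norm_cell v)" by (rule fill2_eq2[OF polygraph2 eq2.unit1_left[OF c(2)]])
  finally show ?case using inv.IH by simp
qed

lemma fill2_parallel:
  assumes "is_cell2 P f u v" "is_cell2 P g u v"
  shows "fill2 P f g"
proof -
  have "v \<in> lists (rows n)" using is_cell2_lists[OF polygraph2 assms(1)] cells1 by simp
  note c = is_cell2_norm_cell[OF this]
  have "fill2 P (f \<star>\<^sub>1 norm_cell v) (g \<star>\<^sub>1 norm_cell v)"
    using norm_cell_natural[OF assms(1)] norm_cell_natural[OF assms(2)] fill2_sym fill2_trans by metis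
  then show ?thesis by (rule fill2_cancel_right[OF polygraph2 assms c])
qed

end

section \<open>The row cells present the stylic monoid\<close>

context row_cells
begin

lemma row_rels_lists: "{(src2 P b, tgt2 P b) | b. b \<in> cells2 P} \<subseteq> lists (rows n) \<times> lists (rows n)"
  using polygraph2 unfolding is_polygraph2_def cells1 by blast

lemma is_cell2_styl_cong:
  "is_cell2 P f u v \<Longrightarrow> styl_cong n (concat u) (concat v)"
proof (induction rule: is_cell2.induct)
  case (id w)
  then show ?case using word_cong.refl[OF rows_concat] cells1 by simp
next
  case (gen b)
  then have "src_step ([], b, []) \<in> lists (rows n)" using cells2 by auto
  from styl_cong_concat_step[OF this] show ?case by (cases b) (simp add: src2 tgt2)
next
  case (comp0 f u v g u' v')
  then show ?case using word_cong_append[OF styl_rels_lists] by simp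
qed (blast intro: word_cong.sym word_cong.trans)+

text \<open>Row words with congruent concatenations rewrite to the same tableau; conversely, each
  row cell holds in the stylic monoid.\<close>

lemma word_cong_iff_styl_cong:
  assumes "u \<in> lists (rows n)" "v \<in> lists (rows n)"
  shows "word_cong (rows n) {(src2 P b, tgt2 P b) | b. b \<in> cells2 P} u v \<longleftrightarrow> styl_cong n (concat u) (concat v)"
  unfolding cells1[symmetric] word_cong_is_cell2[OF polygraph2]
proof
  assume "styl_cong n (concat u) (concat v)"
  then have nf: "nf u = nf v" unfolding nf_def by (rule styl_cong_N_tab)
  have "is_cell2 P (Inv2 (path_cell v (Lambda_path v))) (nf u) v"
    unfolding nf by (rule is_cell2.inv[OF is_cell2_path[OF row_path_Lambda[OF assms(2)]]])
  from is_cell2.comp1[OF is_cell2_path[OF row_path_Lambda[OF assms(1)]] this]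
  show "\<exists>f. is_cell2 P f u v" by blast
qed (use is_cell2_styl_cong in blast)

lemma presents_Styl: "presents P (Styl n)"
  unfolding presents_def Styl_def cells1
proof (rule presented_monoid_iso[where \<phi> = concat, OF row_rels_lists styl_rels_lists])
  fix w assume "w \<in> lists {1..n}"
  \<comment> \<open>Each word is the concatenation of its letters taken as one-letter rows.\<close>
  then have "map (\<lambda>x. [x]) w \<in> lists (rows n)" "concat (map (\<lambda>x. [x]) w) = w"
    by (auto simp: rows_def)
  then show "\<exists>u\<in>lists (rows n). styl_cong n (concat u) w"
    using word_cong.refl \<open>w \<in> lists {1..n}\<close> by metis
qed (use word_cong_iff_styl_cong rows_concat in auto)

end

section \<open>Kept pairs\<close>

lemma finite_rows: "finite (rows n)"
proof (rule finite_subset)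
  show "rows n \<subseteq> sorted_list_of_set ` Pow {1..n}"
  proof
    fix u assume "u \<in> rows n"
    then have "u = sorted_list_of_set (set u)" "set u \<in> Pow {1..n}"
      by (auto simp: rows_def sorted_wrt_less_sorted_list_of_set)
    then show "u \<in> sorted_list_of_set ` Pow {1..n}" by (rule image_eqI)
  qed
qed simp

lemma finite_T1_triples: "finite (T1_triples n)"
  by (rule finite_subset[of _ "rows n \<times> rows n \<times> rows n"])
    (auto simp: T1_triples_def confl_triples_def finite_rows)

lemma finite_eligible: "finite (eligible n)"
proof (rule finite_subset)
  show "eligible n \<subseteq> (\<Union>\<tau>\<in>T1_triples n. {\<tau>} \<times> step_gen ` (set (L_path \<tau>) \<union> set (R_path \<tau>)))"
  proof clarify
    fix u v t p q assume "((u, v, t), (p, q)) \<in> eligible n"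
    then have "(u, v, t) \<in> T1_triples n" "([], (p, q), []) \<in> set (L_path (u, v, t)) \<union> set (R_path (u, v, t))"
      unfolding eligible_def by blast+
    then show "((u, v, t), (p, q)) \<in> (\<Union>\<tau>\<in>T1_triples n. {\<tau>} \<times> step_gen ` (set (L_path \<tau>) \<union> set (R_path \<tau>)))"
      by (intro UN_I[of "(u, v, t)"] SigmaI image_eqI[of _ _ "([], (p, q), [])"]) simp_all
  qed
qed (simp add: finite_T1_triples)

text \<open>Insertions of elements with distinct keys commute; injectivity thus makes the fold over
  the set well defined.\<close>

lemma set_sorted_key_list_of_set_inj:
  fixes f :: "'a \<Rightarrow> 'b :: linorder"
  assumes "inj f" "finite A"
  shows "set (sorted_key_list_of_set f A) = A"
proof -
  interpret folding_on UNIV "insort_key f" "[]"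
  proof
    fix x y
    show "insort_key f y \<circ> insort_key f x = insort_key f x \<circ> insort_key f y"
    proof (cases "x = y")
      case False
      then have "f x \<noteq> f y" using injD[OF assms(1)] by blast
      then show ?thesis using insort_key_left_comm by (auto simp: fun_eq_iff)
    qed simp
  qed
  show ?thesis
    using assms(2) unfolding sorted_key_list_of_set_def
    by induction (simp_all add: set_insort_key)
qed

lemma inj_cell_key: "inj cell_key"
  by (rule injI) (auto elim!: cell_key.elims)

lemma inj_pair_key: "inj pair_key"
proof (rule injI)
  fix x y assume "pair_key x = pair_key y"
  then show "x = y"
    using inj_cell_key by (cases x; cases y) (auto dest: injD)
qed

text \<open>Invariants of the greedy scan; injectivity of \<open>snd\<close> is what makes
  \<open>tau_of\<close> well defined.\<close>

lemma kept_pairs_fold: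
  fixes step :: "triple \<times> row_cell \<Rightarrow> (triple \<times> row_cell) set \<Rightarrow> (triple \<times> row_cell) set"
  defines "step \<equiv> \<lambda>(\<tau>, \<beta>) K. if \<tau> \<notin> fst ` K \<and> \<beta> \<notin> snd ` K then insert (\<tau>, \<beta>) K else K"
  assumes "K \<subseteq> E" "inj_on snd K" "set xs \<subseteq> E"
  shows "fold step xs K \<subseteq> E \<and> inj_on snd (fold step xs K)"
  using assms(2-)
proof (induction xs arbitrary: K)
  case (Cons x xs)
  have "step x K \<subseteq> E" "inj_on snd (step x K)"
    using Cons.prems unfolding step_def by (auto split: prod.splits)
  then show ?case using Cons by simp
qed simp

lemma kept_pairs: "kept_pairs n \<subseteq> eligible n" "inj_on snd (kept_pairs n)"
  using kept_pairs_fold[of "{}" "eligible n" "sorted_key_list_of_set pair_key (eligible n)"]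
  unfolding kept_pairs_def
  by (simp_all add: set_sorted_key_list_of_set_inj inj_pair_key finite_eligible)

lemma tau_of_eligible:
  assumes "\<beta> \<in> B_match n" shows "(tau_of n \<beta>, \<beta>) \<in> eligible n"
proof -
  obtain \<tau> where \<tau>: "(\<tau>, \<beta>) \<in> kept_pairs n" using assms unfolding B_match_def by force
  have "\<tau>' = \<tau>" if "(\<tau>', \<beta>) \<in> kept_pairs n" for \<tau>'
    using inj_onD[OF kept_pairs(2) _ that \<tau>] by simp
  then have "tau_of n \<beta> = \<tau>" unfolding tau_of_def using \<tau> by (intro the_equality)
  then show ?thesis using \<tau> kept_pairs(1) by blast
qed

lemma finite_B_match: "finite (B_match n)"
  unfolding B_match_def using finite_subset[OF kept_pairs(1) finite_eligible] by simp

lemma acyclic_fold: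
  fixes step :: "'b \<Rightarrow> 'b set \<Rightarrow> 'b set" and G :: "('b \<times> 'b) set"
  defines "step \<equiv> \<lambda>\<beta> K. if acyclic (G \<inter> insert \<beta> K \<times> insert \<beta> K) then insert \<beta> K else K"
  assumes "K \<subseteq> B" "acyclic (G \<inter> K \<times> K)" "set xs \<subseteq> B"
  shows "fold step xs K \<subseteq> B \<and> acyclic (G \<inter> fold step xs K \<times> fold step xs K)"
  using assms(2-)
proof (induction xs arbitrary: K)
  case (Cons x xs)
  have "step x K \<subseteq> B" "acyclic (G \<inter> step x K \<times> step x K)"
    using Cons.prems unfolding step_def by auto
  then show ?case using Cons by simp
qed simp

lemma B_acyc: "B_acyc n \<subseteq> B_match n" "acyclic (dep_graph n \<inter> B_acyc n \<times> B_acyc n)"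
  using acyclic_fold[of "{}" "B_match n" "dep_graph n" "sorted_key_list_of_set cell_key (B_match n)"]
  unfolding B_acyc_def
  by (simp_all add: acyclic_def set_sorted_key_list_of_set_inj inj_cell_key finite_B_match)

text \<open>The induction principle behind both the termination of \<open>reduce_cell2\<close> and
  the typing of its values.\<close>

lemma wf_dep_graph: "wf (dep_graph n \<inter> B_acyc n \<times> B_acyc n)"
proof (rule finite_acyclic_wf)
  have "finite (B_acyc n)" using finite_subset[OF B_acyc(1) finite_B_match] .
  then show "finite (dep_graph n \<inter> B_acyc n \<times> B_acyc n)" by blast
qed (fact B_acyc(2))

section \<open>The semi-coherent row presentation\<close>

lemma row_scoh_simps [simp]:
  "cells1 (row_scoh n) = rows n"
  "cells2 (row_scoh n) = {(u, v). u \<in> rows n \<and> v \<in> rows n \<and> \<not> u \<lhd>\<^sub>N v}"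
  "src2 (row_scoh n) = (\<lambda>(u, v). [u, v])"
  "tgt2 (row_scoh n) = (\<lambda>(u, v). N_tab (u @ v))"
  "cells3 (row_scoh n) = X_cell ` T1_triples n"
  "src3 (row_scoh n) = row_src3 n"
  "tgt3 (row_scoh n) = row_tgt3"
  by (simp_all add: row_scoh_def row_polygraph_def polygraph2.defs)

lemma row_N_simps [simp]:
  "cells1 (row_N n) = rows n"
  "cells2 (row_N n) = {(u, v). u \<in> rows n \<and> v \<in> rows n \<and> \<not> u \<lhd>\<^sub>N v}"
  "src2 (row_N n) = (\<lambda>(u, v). [u, v])"
  "tgt2 (row_N n) = (\<lambda>(u, v). N_tab (u @ v))"
  "cells3 (row_N n) = X_cell ` T1_triples n - (\<lambda>\<beta>. X_cell (tau_of n \<beta>)) ` B_acyc n \<union> A_cell ` B_acyc n"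
  "src3 (row_N n) = row_src3 n"
  "tgt3 (row_N n) = row_tgt3"
  by (simp_all add: row_N_def)

interpretation scoh: row_cells_T1 n "row_scoh n" for n
proof
  fix \<tau> assume "\<tau> \<in> T1_triples n"
  then show "fill2 (row_scoh n) (L_cell \<tau>) (R_cell \<tau>)"
    using fill2_gen[of "X_cell \<tau>" "row_scoh n"] by simp
qed simp_all

interpretation rowN: row_cells n "row_N n" for n
  by standard simp_all

lemma is_cell2_mono:
  assumes "is_cell2 P f u v" "cells1 P \<subseteq> cells1 Q" "cells2 P \<subseteq> cells2 Q"
    "\<And>b. b \<in> cells2 P \<Longrightarrow> src2 P b = src2 Q b" "\<And>b. b \<in> cells2 P \<Longrightarrow> tgt2 P b = tgt2 Q b"
  shows "is_cell2 Q f u v"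
  using assms(1)
proof induction
  case (id w)
  then have "w \<in> lists (cells1 Q)" using assms(2) by auto
  then show ?case by (rule is_cell2.id)
next
  case (gen b)
  then show ?case using is_cell2.gen[of b Q] assms by auto
next
  case (comp0 f u v g u' v')
  then show ?case by (intro is_cell2.comp0)
qed (auto intro: is_cell2.comp1 is_cell2.inv)

lemma is_cell2_gens2: "is_cell2 P f u v \<Longrightarrow> gens2 f \<subseteq> cells2 P"
  by (induction rule: is_cell2.induct) auto

lemma row_path_L_R:
  assumes "\<tau> \<in> confl_triples n"
  shows "row_path n (word3 \<tau>) (L_path \<tau>) (nf (word3 \<tau>))" "row_path n (word3 \<tau>) (R_path \<tau>) (nf (word3 \<tau>))"
proof -
  obtain u v t where \<tau>: "\<tau> = (u, v, t)" by (cases \<tau>)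
  then have *: "u \<in> rows n" "v \<in> rows n" "t \<in> rows n" "\<not> u \<lhd>\<^sub>N v" "\<not> v \<lhd>\<^sub>N t"
    using assms by (auto simp: confl_triples_def)
  then have "[u, v, t] \<in> lists (rows n)" by simp
  then show "row_path n (word3 \<tau>) (L_path \<tau>) (nf (word3 \<tau>))"
    using row_path_Lambda rowN.L_path_Lambda[OF *(1-4)] unfolding \<tau> word3.simps by metis
  show "row_path n (word3 \<tau>) (R_path \<tau>) (nf (word3 \<tau>))"
    using rowN.row_path_R_path[OF *(1-3,5)] unfolding \<tau> word3.simps .
qed

lemma is_cell2_L_R:
  assumes "\<tau> \<in> T1_triples n"
  shows "is_cell2 (row_N n) (L_cell \<tau>) (word3 \<tau>) (nf (word3 \<tau>))"
    and "is_cell2 (row_N n) (R_cell \<tau>) (word3 \<tau>) (nf (word3 \<tau>))"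
  using rowN.is_cell2_path[OF row_path_L_R(1)] rowN.is_cell2_path[OF row_path_L_R(2)] assms
  unfolding L_cell_def R_cell_def T1_triples_def by auto

text \<open>The side containing \<open>\<beta>\<close> splits as \<open>U = f @ ?s # g\<close>, and
  \<open>S_cell\<close> is the other side \<open>V\<close> conjugated by \<open>f\<close> and
  \<open>g\<close>. So it is parallel to \<open>Gen2 \<beta>\<close>, and a filling between these
  two gives one between \<open>U\<close> and \<open>V\<close>.\<close>

lemma eligible_cell:
  assumes "(\<tau>, \<beta>) \<in> eligible n"
  shows "\<tau> \<in> T1_triples n" "\<beta> \<in> cells2 (row_N n)"
    and "is_cell2 (row_N n) (S_cell (\<tau>, \<beta>)) (src2 (row_N n) \<beta>) (tgt2 (row_N n) \<beta>)"
    and "fill2 (row_N n) (S_cell (\<tau>, \<beta>)) (Gen2 \<beta>) \<Longrightarrow> fill2 (row_N n) (L_cell \<tau>) (R_cell \<tau>)"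
proof -
  let ?s = "([], \<beta>, [])"
  show T1: "\<tau> \<in> T1_triples n" using assms unfolding eligible_def by blast
  have s: "?s \<in> set (L_path \<tau>) \<union> set (R_path \<tau>)" using assms unfolding eligible_def by blast
  have "\<tau> \<in> confl_triples n" using T1 unfolding T1_triples_def by blast
  note LR = row_path_L_R[OF this]
  define U where "U = (if ?s \<in> set (L_path \<tau>) then L_path \<tau> else R_path \<tau>)"
  define V where "V = (if ?s \<in> set (L_path \<tau>) then R_path \<tau> else L_path \<tau>)"
  define f where "f = takeWhile (\<lambda>s'. s' \<noteq> ?s) U"
  define g where "g = tl (dropWhile (\<lambda>s'. s' \<noteq> ?s) U)"
  have U: "row_path n (word3 \<tau>) U (nf (word3 \<tau>))" and V: "row_path n (word3 \<tau>) V (nf (word3 \<tau>))"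
    using LR unfolding U_def V_def by auto
  have sU: "?s \<in> set U" using s unfolding U_def by auto
  have "dropWhile (\<lambda>s'. s' \<noteq> ?s) U = ?s # g"
  proof -
    have ne: "dropWhile (\<lambda>s'. s' \<noteq> ?s) U \<noteq> []" using sU by auto
    then show ?thesis using hd_dropWhile[OF ne] unfolding g_def by (metis list.collapse)
  qed
  then have Ufg: "U = f @ ?s # g" unfolding f_def by (metis takeWhile_dropWhile_id)
  then obtain w where f: "row_path n (word3 \<tau>) f w" and sg: "row_path n w (?s # g) (nf (word3 \<tau>))"
    using U row_path_append by metis
  have w: "src_step ?s = w" "src_step ?s \<in> lists (rows n)" "is_redex ?s"
    and g: "row_path n (step_target ?s) g (nf (word3 \<tau>))" using sg by simp_all
  obtain p q where \<beta>: "\<beta> = (p, q)" by (cases \<beta>)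
  have w2: "w = src2 (row_N n) \<beta>" "step_target ?s = tgt2 (row_N n) \<beta>" using w(1) \<beta> by auto
  show b: "\<beta> \<in> cells2 (row_N n)" using w \<beta> by auto
  note cf = rowN.is_cell2_path[OF f] and cV = rowN.is_cell2_path[OF V] and cg = rowN.is_cell2_path[OF g]
  have cb: "is_cell2 (row_N n) (Gen2 \<beta>) w (step_target ?s)"
    using is_cell2.gen[OF b] unfolding w2 .
  have S: "S_cell (\<tau>, \<beta>) = Inv2 (path_cell (word3 \<tau>) f) \<star>\<^sub>1 path_cell (word3 \<tau>) V
      \<star>\<^sub>1 Inv2 (path_cell (step_target ?s) g)"
    unfolding f_def g_def U_def V_def by (simp add: Let_def)
  show "is_cell2 (row_N n) (S_cell (\<tau>, \<beta>)) (src2 (row_N n) \<beta>) (tgt2 (row_N n) \<beta>)"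
    unfolding S w2[symmetric]
    by (rule is_cell2.comp1[OF is_cell2.inv[OF cf] is_cell2.comp1[OF cV is_cell2.inv[OF cg]]])
  assume "fill2 (row_N n) (S_cell (\<tau>, \<beta>)) (Gen2 \<beta>)"
  then have 1: "fill2 (row_N n) (path_cell (word3 \<tau>) V)
      (path_cell (word3 \<tau>) f \<star>\<^sub>1 Gen2 \<beta> \<star>\<^sub>1 path_cell (step_target ?s) g)"
    unfolding S by (rule fill2_conjugate[OF rowN.polygraph2 cf cb cg cV])
  \<comment> \<open>The context of \<open>?s\<close> is empty, so its cell is the generator up to
    units.\<close>
  have gb: "eq2 (row_N n) (Gen2 \<beta>) (step_cell ?s)"
    using eq2.sym[OF eq2.trans[OF eq2.unit0_left[OF is_cell2.comp0[OF cb rowN.is_cell2_Id2[OF lists.Nil]]]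
          eq2.unit0_right[OF cb]]] by simp
  have "eq2 (row_N n) (Gen2 \<beta> \<star>\<^sub>1 path_cell (step_target ?s) g) (path_cell w (?s # g))"
    using eq2.cong1[OF gb eq2.refl[OF cg] cb cg] by simp
  from eq2.cong1[OF eq2.refl[OF cf] this cf is_cell2.comp1[OF cb cg]]
  have "eq2 (row_N n) (path_cell (word3 \<tau>) f \<star>\<^sub>1 Gen2 \<beta> \<star>\<^sub>1 path_cell (step_target ?s) g) (path_cell (word3 \<tau>) U)"
    using eq2.trans eq2.sym[OF rowN.path_cell_append[OF f sg]] unfolding Ufg by blast
  from fill2_trans[OF 1 fill2_eq2[OF rowN.polygraph2 this]]
  have "fill2 (row_N n) (path_cell (word3 \<tau>) V) (path_cell (word3 \<tau>) U)" .
  then show "fill2 (row_N n) (L_cell \<tau>) (R_cell \<tau>)"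
    unfolding U_def V_def L_cell_def R_cell_def using fill2_sym by (auto split: if_splits)
qed

lemma B_acyc_cell:
  assumes "\<beta> \<in> B_acyc n"
  shows "tau_of n \<beta> \<in> T1_triples n" "\<beta> \<in> cells2 (row_N n)"
    and "is_cell2 (row_N n) (S_of n \<beta>) (src2 (row_N n) \<beta>) (tgt2 (row_N n) \<beta>)"
    and "fill2 (row_N n) (L_cell (tau_of n \<beta>)) (R_cell (tau_of n \<beta>))"
proof -
  have "\<beta> \<in> B_match n" using assms B_acyc(1) by blast
  note e = eligible_cell[OF tau_of_eligible[OF this]]
  show "tau_of n \<beta> \<in> T1_triples n" "\<beta> \<in> cells2 (row_N n)"
    "is_cell2 (row_N n) (S_of n \<beta>) (src2 (row_N n) \<beta>) (tgt2 (row_N n) \<beta>)"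
    using e(1-3) unfolding S_of_def .
  have "A_cell \<beta> \<in> cells3 (row_N n)" using assms by simp
  from fill2_gen[OF this]
  show "fill2 (row_N n) (L_cell (tau_of n \<beta>)) (R_cell (tau_of n \<beta>))"
    using e(4) by (simp add: S_of_def)
qed

lemma is_cell2_scoh_N: "is_cell2 (row_scoh n) f u v \<longleftrightarrow> is_cell2 (row_N n) f u v"
  using is_cell2_mono[of "row_scoh n" f u v "row_N n"] is_cell2_mono[of "row_N n" f u v "row_scoh n"]
  by auto

text \<open>The identity on expressions carries fillings over from \<open>row_scoh\<close>: each
  \<open>X_cell\<close> either survives or has its boundary filled by means of an
  \<open>A_cell\<close>.\<close>

lemma fill2_row_N:
  assumes "is_cell2 (row_N n) f u v" "is_cell2 (row_N n) g u v"
  shows "fill2 (row_N n) f g"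
proof (rule fill2_functor[where F = "\<lambda>f. f" and P = "row_scoh n"])
  show "fill2 (row_scoh n) f g"
    using scoh.fill2_parallel assms by (simp add: is_cell2_scoh_N)
next
  fix c assume "c \<in> cells3 (row_scoh n)"
  then obtain \<tau> where c: "c = X_cell \<tau>" and \<tau>: "\<tau> \<in> T1_triples n" by auto
  show "parallel2 (row_scoh n) (src3 (row_scoh n) c) (tgt3 (row_scoh n) c)"
    unfolding parallel2_def is_cell2_scoh_N using is_cell2_L_R[OF \<tau>] c by auto
  show "fill2 (row_N n) (src3 (row_scoh n) c) (tgt3 (row_scoh n) c)"
  proof (cases "c \<in> cells3 (row_N n)")
    case True
    then show ?thesis using fill2_gen[OF True] by simp
  next
    case False
    then obtain \<beta> where "\<beta> \<in> B_acyc n" "\<tau> = tau_of n \<beta>" using \<tau> c by auto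
    then show ?thesis using B_acyc_cell(4) c by simp
  qed
qed (simp_all add: rowN.polygraph2 scoh.polygraph2 is_cell2_scoh_N)

section \<open>The reduction\<close>

lemma removed2_Gamma2: "removed2 (row_N n) (Gamma2 n) = B_acyc n"
  unfolding removed2_def Gamma2_def by auto

lemma remover_Gamma2: "\<beta> \<in> B_acyc n \<Longrightarrow> remover (row_N n) (Gamma2 n) \<beta> = A_cell \<beta>"
  unfolding remover_def Gamma2_def by (rule the_equality) auto

text \<open>The recursion is structural except at generators.\<close>

lemma reduce_cell2_domI:
  assumes "\<And>b. b \<in> gens2 f \<Longrightarrow> reduce_cell2_dom (P, C, Gen2 b)"
  shows "reduce_cell2_dom (P, C, f)"
  using assms by (induction f) (auto intro: reduce_cell2.domintros)

abbreviation red :: "nat \<Rightarrow> (row, row_cell) cell2 \<Rightarrow> (row, row_cell) cell2" where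
  "red n \<equiv> reduce_cell2 (row_N n) (Gamma2 n)"

lemma dep_graphI:
  "\<beta> \<in> B_acyc n \<Longrightarrow> \<beta>' \<in> B_acyc n \<Longrightarrow> \<beta>' \<in> gens2 (S_of n \<beta>)
    \<Longrightarrow> (\<beta>', \<beta>) \<in> dep_graph n \<inter> B_acyc n \<times> B_acyc n"
  using B_acyc(1) unfolding dep_graph_def by blast

text \<open>Unfolding \<open>\<beta>\<close> produces \<open>S_of n \<beta>\<close>, whose removed
  generators precede \<open>\<beta>\<close> in the well-founded dependency graph.\<close>

lemma reduce_cell2_dom: "reduce_cell2_dom (row_N n, Gamma2 n, f)"
proof (rule reduce_cell2_domI)
  fix \<beta>
  show "reduce_cell2_dom (row_N n, Gamma2 n, Gen2 \<beta>)"
  proof (induction \<beta> rule: wf_induct_rule[OF wf_dep_graph[of n]])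
    case (1 \<beta>)
    show ?case
    proof (rule reduce_cell2.domintros)
      assume "\<beta> \<in> removed2 (row_N n) (Gamma2 n)"
      then have \<beta>: "\<beta> \<in> B_acyc n" by (simp add: removed2_Gamma2)
      have "reduce_cell2_dom (row_N n, Gamma2 n, S_of n \<beta>)"
      proof (rule reduce_cell2_domI)
        fix b assume "b \<in> gens2 (S_of n \<beta>)"
        then show "reduce_cell2_dom (row_N n, Gamma2 n, Gen2 b)"
          using 1[of b] dep_graphI[OF \<beta>, of b]
          by (cases "b \<in> B_acyc n") (auto intro: reduce_cell2.domintros simp: removed2_Gamma2)
      qed
      then show "reduce_cell2_dom (row_N n, Gamma2 n, src3 (row_N n) (remover (row_N n) (Gamma2 n) \<beta>))"
        by (simp add: remover_Gamma2 \<beta>)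
    qed
  qed
qed

lemmas red_simps = reduce_cell2.psimps[OF reduce_cell2_dom]

lemma red_Gen2: "red n (Gen2 \<beta>) = (if \<beta> \<in> B_acyc n then red n (S_of n \<beta>) else Gen2 \<beta>)"
  by (subst red_simps(2)) (simp add: removed2_Gamma2 remover_Gamma2)

lemma row_red_simps [simp]:
  "cells1 (row_red n) = rows n"
  "cells2 (row_red n) = cells2 (row_N n) - B_acyc n"
  "src2 (row_red n) = src2 (row_N n)"
  "tgt2 (row_red n) = tgt2 (row_N n)"
  "cells3 (row_red n) = X_cell ` (T1_triples n - tau_of n ` B_acyc n)"
  "src3 (row_red n) c = red n (row_src3 n c)"
  "tgt3 (row_red n) c = red n (row_tgt3 c)"
  by (auto simp: row_red_def homotopical_reduction_def removed2_Gamma2[unfolded Gamma2_def] Gamma2_def)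

lemma red_id: "gens2 f \<inter> B_acyc n = {} \<Longrightarrow> red n f = f"
  by (induction f) (auto simp: red_simps(1,3-5) red_Gen2)

text \<open>Separates the structural part of the typing from the well-founded recursion on
  generators in \<open>is_cell2_red\<close>.\<close>

lemma is_cell2_red_gens:
  assumes "is_cell2 (row_N n) f u v"
    and "\<And>b. b \<in> gens2 f \<Longrightarrow> is_cell2 (row_red n) (red n (Gen2 b)) (src2 (row_N n) b) (tgt2 (row_N n) b)"
  shows "is_cell2 (row_red n) (red n f) u v"
  using assms
proof induction
  case (id w)
  then show ?case using is_cell2.id[of w "row_red n"] by (simp add: red_simps(1))
next
  case (gen b)
  then show ?case by simp
next
  case (comp0 f u v g u' v')
  then show ?case by (auto simp: red_simps(3) intro!: is_cell2.comp0)
next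
  case (comp1 f u v g w)
  then have "is_cell2 (row_red n) (red n f) u v" "is_cell2 (row_red n) (red n g) v w" by auto
  then show ?case unfolding red_simps(4) by (rule is_cell2.comp1)
next
  case (inv f u v)
  then show ?case by (auto simp: red_simps(5) intro: is_cell2.inv)
qed

lemma is_cell2_red:
  assumes "is_cell2 (row_N n) f u v"
  shows "is_cell2 (row_red n) (red n f) u v"
proof -
  have gen: "b \<in> cells2 (row_N n) \<Longrightarrow>
    is_cell2 (row_red n) (red n (Gen2 b)) (src2 (row_N n) b) (tgt2 (row_N n) b)" for b
  proof (induction b rule: wf_induct_rule[OF wf_dep_graph[of n]])
    case (1 \<beta>)
    have gen: "is_cell2 (row_red n) (red n (Gen2 b)) (src2 (row_N n) b) (tgt2 (row_N n) b)"
      if "b \<in> cells2 (row_N n)" "b \<notin> B_acyc n" for b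
      using is_cell2.gen[of b "row_red n"] that by (simp add: red_Gen2 del: row_N_simps)
    show ?case
    proof (cases "\<beta> \<in> B_acyc n")
      case True
      note S = B_acyc_cell(3)[OF True]
      have "is_cell2 (row_red n) (red n (S_of n \<beta>)) (src2 (row_N n) \<beta>) (tgt2 (row_N n) \<beta>)"
      proof (rule is_cell2_red_gens[OF S])
        fix b assume b: "b \<in> gens2 (S_of n \<beta>)"
        then have "b \<in> cells2 (row_N n)" using is_cell2_gens2[OF S] by blast
        then show "is_cell2 (row_red n) (red n (Gen2 b)) (src2 (row_N n) b) (tgt2 (row_N n) b)"
          using 1(1)[OF dep_graphI[OF True _ b]] gen by blast
      qed
      then show ?thesis using True by (simp add: red_Gen2)
    next
      case False
      then show ?thesis using gen 1(2) by blast
    qed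
  qed
  show ?thesis
    by (rule is_cell2_red_gens[OF assms]) (use gen is_cell2_gens2[OF assms] in blast)
qed

lemma is_cell2_row_red:
  assumes "is_cell2 (row_red n) f u v"
  shows "is_cell2 (row_N n) f u v" "red n f = f"
proof -
  show "is_cell2 (row_N n) f u v" by (rule is_cell2_mono[OF assms]) auto
  show "red n f = f" using is_cell2_gens2[OF assms] by (intro red_id) auto
qed

lemma polygraph2_row_red: "is_polygraph2 (row_red n)"
  using rowN.polygraph2[of n] unfolding is_polygraph2_def by auto

lemma parallel2_row_N:
  assumes "c \<in> cells3 (row_N n)"
  shows "parallel2 (row_N n) (src3 (row_N n) c) (tgt3 (row_N n) c)"
proof (cases c)
  case (X_cell \<tau>)
  then have "\<tau> \<in> T1_triples n" using assms by auto
  from is_cell2_L_R[OF this] show ?thesis unfolding parallel2_def using X_cell by auto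
next
  case (A_cell \<beta>)
  then have \<beta>: "\<beta> \<in> B_acyc n" using assms by auto
  show ?thesis
    unfolding parallel2_def using A_cell B_acyc_cell(3)[OF \<beta>] is_cell2.gen[OF B_acyc_cell(2)[OF \<beta>]]
    by (auto simp del: row_N_simps(1-5))
qed

lemma fill2_row_red:
  assumes "is_cell2 (row_red n) f u v" "is_cell2 (row_red n) g u v"
  shows "fill2 (row_red n) f g"
proof -
  have "fill2 (row_red n) (red n f) (red n g)"
  proof (rule fill2_functor[where F = "red n" and P = "row_N n"])
    show "fill2 (row_N n) f g"
      using fill2_row_N[OF is_cell2_row_red(1)[OF assms(1)] is_cell2_row_red(1)[OF assms(2)]] .
  next
    fix c assume c: "c \<in> cells3 (row_N n)"
    then show "parallel2 (row_N n) (src3 (row_N n) c) (tgt3 (row_N n) c)" by (rule parallel2_row_N)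
    show "fill2 (row_red n) (red n (src3 (row_N n) c)) (red n (tgt3 (row_N n) c))"
    proof (cases c)
      case (X_cell \<tau>)
      then have "c \<in> cells3 (row_red n)" using c by auto
      from fill2_gen[OF this] show ?thesis by simp
    next
      case (A_cell \<beta>)
      then have \<beta>: "\<beta> \<in> B_acyc n" using c by auto
      \<comment> \<open>By \<open>red_Gen2\<close> the images of \<open>S_of n \<beta>\<close> and
        \<open>\<beta>\<close> are the same expression, so reflexivity suffices.\<close>
      from fill2_refl[OF is_cell2_red[OF B_acyc_cell(3)[OF \<beta>]]]
      show ?thesis using A_cell \<beta> by (simp add: red_Gen2)
    qed
  qed (use rowN.polygraph2 polygraph2_row_red is_cell2_red in \<open>auto simp: red_simps(1,3-5)\<close>)
  then show ?thesis using is_cell2_row_red(2) assms by metis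
qed

text \<open>Two words are connected by a 2-cell of \<open>row_red\<close> iff they are in
  \<open>row_N\<close>: by inclusion one way, by \<open>red\<close> the other. The two congruences,
  hence the two monoids, are equal.\<close>

lemma presents_row_red: "presents (row_red n) (Styl n)"
proof -
  let ?R = "\<lambda>P :: (row, row_cell, row_cell3) polygraph31. {(src2 P b, tgt2 P b) | b. b \<in> cells2 P}"
  have "word_cong (cells1 (row_red n)) (?R (row_red n)) u v \<longleftrightarrow> word_cong (cells1 (row_N n)) (?R (row_N n)) u v" for u v
    unfolding word_cong_is_cell2[OF polygraph2_row_red] word_cong_is_cell2[OF rowN.polygraph2]
    using is_cell2_row_red(1) is_cell2_red by blast
  then have "word_rel (cells1 (row_red n)) (?R (row_red n)) = word_rel (cells1 (row_N n)) (?R (row_N n))"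
    unfolding word_rel_def by blast
  then have "presented_monoid (cells1 (row_red n)) (?R (row_red n)) = presented_monoid (cells1 (row_N n)) (?R (row_N n))"
    unfolding presented_monoid_def by simp
  then show ?thesis using rowN.presents_Styl[of n] unfolding presents_def by simp
qed

theorem theorem4p3p8:
  fixes n :: nat
  assumes "n \<ge> 1"
  shows "finite_polygraph31 (row_red n)
    \<and> coherent_presentation (row_red n) (Styl n)
    \<and> cells2 (row_red n) = cells2 (row_polygraph n) - B_acyc n
    \<and> cells3 (row_red n) = X_cell ` (T1_triples n - tau_of n ` B_acyc n)
    \<and> (\<forall>\<tau> \<in> T1_triples n - tau_of n ` B_acyc n.
          src3 (row_red n) (X_cell \<tau>) = reduce_cell2 (row_N n) (Gamma2 n) (L_cell \<tau>)
        \<and> tgt3 (row_red n) (X_cell \<tau>) = reduce_cell2 (row_N n) (Gamma2 n) (R_cell \<tau>))"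
proof (intro conjI ballI)
  have "finite (cells2 (row_N n))"
    by (rule finite_subset[of _ "rows n \<times> rows n"]) (auto simp: finite_rows)
  then show "finite_polygraph31 (row_red n)"
    unfolding finite_polygraph31_def using finite_rows finite_T1_triples by simp
  \<comment> \<open>Reduced boundaries remain parallel because \<open>red\<close> preserves sources
    and targets.\<close>
  have "parallel2 (row_red n) (src3 (row_red n) c) (tgt3 (row_red n) c)"
    if "c \<in> cells3 (row_red n)" for c
  proof -
    have "c \<in> cells3 (row_N n)" using that by auto
    from parallel2_row_N[OF this] obtain u v where
      "is_cell2 (row_N n) (row_src3 n c) u v" "is_cell2 (row_N n) (row_tgt3 c) u v"
      unfolding parallel2_def by auto
    from is_cell2_red[OF this(1)] is_cell2_red[OF this(2)]
    show ?thesis unfolding parallel2_def by auto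
  qed
  then show "coherent_presentation (row_red n) (Styl n)"
    unfolding coherent_presentation_def is_polygraph31_def
    using polygraph2_row_red presents_row_red fill2_row_red unfolding fill2_def parallel2_def by blast
  show "cells2 (row_red n) = cells2 (row_polygraph n) - B_acyc n"
    by (simp add: row_polygraph_def)
qed simp_all

end
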